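(* For all $k,r,\alpha\in\mathbb{N}$ there is some $c=c(k,r,\alpha)$ such that for every $k$-uniform hypergraph $G$ with independence number $\alpha(G)\le\alpha$ and every colouring of the edges of $G$ with $r$ colours, the vertex set of $G$ can be partitioned into at most $c$ monochromatic tight cycles.
   Context: A $k$-graph ($k$-uniform hypergraph) is a pair $(V,E)$ with $E\subseteq\binom{V}{k}$. The independence number $\alpha(G)$ is the largest size of a vertex set containing no edge of $G$. The tight $k$-uniform cycle of length $m$ is the $k$-graph on $m$ cyclically ordered vertices in which every $k$ cyclically consecutive vertices form an edge; a tight cycle is monochromatic if all its edges have the same colour. By convention, a single vertex also counts as a (monochromatic) tight cycle. *)

theory Defs
  imports Main "HOL-Library.Ramsey" "HOL-Library.Disjoint_Sets"
begin

definition k_graph :: "nat \<Rightarrow> 'a set \<Rightarrow> 'a set set \<Rightarrow> bool" where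
  "k_graph k V E \<longleftrightarrow> finite V \<and> E \<subseteq> nsets V k"

definition independent_set :: "'a set \<Rightarrow> 'a set set \<Rightarrow> 'a set \<Rightarrow> bool" where
  "independent_set V E S \<longleftrightarrow> S \<subseteq> V \<and> (\<forall>e\<in>E. \<not> e \<subseteq> S)"

definition independence_number :: "'a set \<Rightarrow> 'a set set \<Rightarrow> nat" where
  "independence_number V E = Max (card ` {S. independent_set V E S})"

definition edge_colouring :: "nat \<Rightarrow> 'a set set \<Rightarrow> ('a set \<Rightarrow> nat) \<Rightarrow> bool" where
  "edge_colouring r E col \<longleftrightarrow> (\<forall>e\<in>E. col e < r)"

text \<open>A cyclic ordering of a finite vertex set is given by a list without repetitions.\<close>

definition cyclic_window :: "nat \<Rightarrow> 'a list \<Rightarrow> nat \<Rightarrow> 'a set" where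
  "cyclic_window k vs i = (\<lambda>j. vs ! ((i + j) mod length vs)) ` {..<k}"

definition tight_cycle_edges :: "nat \<Rightarrow> 'a list \<Rightarrow> 'a set set" where
  "tight_cycle_edges k vs = cyclic_window k vs ` {..<length vs}"

text \<open>A tight cycle has length greater than \<open>k\<close>, so that a lone edge (the case of length \<open>k\<close>)
  is not counted as a cycle. The only degenerate cycles are the single vertices, on which
  no edge condition is imposed (also for \<open>k = 1\<close>).\<close>

definition mono_tight_cycle ::
    "nat \<Rightarrow> 'a set \<Rightarrow> 'a set set \<Rightarrow> ('a set \<Rightarrow> nat) \<Rightarrow> 'a list \<Rightarrow> bool" where
  "mono_tight_cycle k V E col vs \<longleftrightarrow>
     distinct vs \<and> set vs \<subseteq> V \<and>
     (length vs = 1 \<or>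
      k < length vs \<and> tight_cycle_edges k vs \<subseteq> E \<and>
      (\<exists>a. \<forall>e\<in>tight_cycle_edges k vs. col e = a))"

text \<open>The blocks of the partition are the vertex sets of the cycles.\<close>

definition mono_tight_cycle_partition ::
    "nat \<Rightarrow> 'a set \<Rightarrow> 'a set set \<Rightarrow> ('a set \<Rightarrow> nat) \<Rightarrow> 'a set set \<Rightarrow> bool" where
  "mono_tight_cycle_partition k V E col P \<longleftrightarrow>
     partition_on V P \<and> (\<forall>C\<in>P. \<exists>vs. set vs = C \<and> mono_tight_cycle k V E col vs)"

end

theory Submission
  imports Defs Complex_Main
begin

text \<open>
  For sets \<open>B\<^sub>1, \<dots>, B\<^sub>m\<close> and a further set \<open>D\<close>, walk through \<open>m\<close>-tuples of
  \<open>B\<^sub>1 \<times> \<dots> \<times> B\<^sub>m\<close> by letting \<open>d \<in> D\<close> join \<open>x\<close> to \<open>y\<close> if \<open>d\<close> together with any coordinatewise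
  mixture of \<open>x\<close> and \<open>y\<close> is an edge. A closed walk reads off as a tight cycle, and a positive density
  of edges gives a positive density of such steps. Dependent random choice then produces a large set
  of tuples any two of which are joined by bounded walks avoiding any given small set of vertices, so
  that one closed walk can be led through any small set \<open>B\<close> of vertices with steps into this set.

  Applied to the hypergraph of monochromatic \<open>(k + 1)\<close>-cliques, which is dense by Ramsey's theorem,
  this yields a monochromatic tight cycle of linear length with a linear set of vertices any of which may
  be dropped (an absorber). Greedily removing cycles leaves a remainder much smaller than the absorber.
  A remaining vertex whose link is dense in one colour to some earlier absorbers
  \<open>A\<^sub>1, \<dots>, A\<^sub>k\<^sub>-\<^sub>1\<close> is covered through a connecting set \<open>D\<close>; if no connecting set available
  so far fits, an absorber among such vertices is a new one, and this happens boundedly often because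
  the measure of connected pairs grows. Among the vertices all of whose links are sparse, a further
  absorber is found and added to the list of the \<open>A\<^sub>i\<close>; after \<open>\<alpha> + 1\<close> additions
  almost all transversals would be independent sets of size \<open>\<alpha> + 1\<close>.
\<close>

section \<open>Averages over finite sets and over lists of representatives\<close>

text \<open>The cycle reads a step from \<open>x\<close> to \<open>z\<close> over \<open>e\<close>
  as \<open>x\<close>, \<open>e\<close>, \<open>z\<close>. A window starting at position
  \<open>i\<close> of \<open>x\<close> sees a suffix of \<open>x\<close>, perhaps \<open>e\<close>,
  and at most the first \<open>i\<close> entries of \<open>z\<close>; hence the demand on all
  mixtures. In a colour class the tuples have one entry fewer than an edge, and windows are edges
  only while every connector is present. In the clique hypergraph they have one entry more than
  that, so windows of length \<open>k\<close> survive the loss of connectors: this extra entry is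
  what absorbs.

  The obstacle is the order of the constants. A new absorber lies inside a remainder and may be tiny
  compared with the older ones, yet later stages may consume vertices of it in proportion to what is
  then left. So both inductions count the stages still to come: the constants \<open>c'\<close>,
  \<open>K'\<close>, \<open>M'\<close> of the next stage are fixed first, and only then is an
  absorber taken whose remainder is at most 1/(M'+1) of its size. Every covering step also bounds
  the vertices it borrows from older sets, since these are forbidden afterwards.\<close>

definition avg :: "'x set \<Rightarrow> ('x \<Rightarrow> real) \<Rightarrow> real" where
  "avg X f = (\<Sum>x\<in>X. f x) / card X"

abbreviation pr :: "'x set \<Rightarrow> ('x \<Rightarrow> bool) \<Rightarrow> real" where
  "pr X Q \<equiv> avg X (\<lambda>x. of_bool (Q x))"

lemma avg_mono: "(\<And>x. x \<in> X \<Longrightarrow> f x \<le> g x) \<Longrightarrow> avg X f \<le> avg X g"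
  unfolding avg_def by (intro divide_right_mono sum_mono) auto

lemma avg_cong: "(\<And>x. x \<in> X \<Longrightarrow> f x = g x) \<Longrightarrow> avg X f = avg X g"
  unfolding avg_def by (simp cong: sum.cong)

lemma avg_const [simp]: "finite X \<Longrightarrow> X \<noteq> {} \<Longrightarrow> avg X (\<lambda>_. c) = c"
  unfolding avg_def by simp

lemma avg_add: "avg X (\<lambda>x. f x + g x) = avg X f + avg X g"
  unfolding avg_def by (simp add: sum.distrib add_divide_distrib)

lemma avg_diff: "avg X (\<lambda>x. f x - g x) = avg X f - avg X g"
  unfolding avg_def by (simp add: sum_subtractf diff_divide_distrib)

lemma avg_cmult: "avg X (\<lambda>x. c * f x) = c * avg X f"
  unfolding avg_def by (simp add: sum_distrib_left)

lemma avg_sum: "avg X (\<lambda>x. \<Sum>i\<in>I. f i x) = (\<Sum>i\<in>I. avg X (f i))"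
  unfolding avg_def by (subst sum.swap) (simp add: sum_divide_distrib)

lemma avg_swap: "avg X (\<lambda>x. avg Y (\<lambda>y. f x y)) = avg Y (\<lambda>y. avg X (\<lambda>x. f x y))"
  unfolding avg_def
  by (simp add: sum_divide_distrib[symmetric] sum.swap[of _ Y X] mult.commute)

lemma avg_nonneg: "(\<And>x. x \<in> X \<Longrightarrow> 0 \<le> f x) \<Longrightarrow> 0 \<le> avg X f"
  unfolding avg_def by (simp add: sum_nonneg)

lemma avg_le_1: "finite X \<Longrightarrow> X \<noteq> {} \<Longrightarrow> (\<And>x. x \<in> X \<Longrightarrow> f x \<le> 1) \<Longrightarrow> avg X f \<le> 1"
  using avg_mono[of X f "\<lambda>_. 1"] by simp

lemma avg_square:
  assumes "finite X" "X \<noteq> {}"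
  shows "(avg X f)\<^sup>2 \<le> avg X (\<lambda>x. (f x)\<^sup>2)"
proof -
  let ?c = "avg X f"
  have "0 \<le> avg X (\<lambda>x. (f x - ?c)\<^sup>2)"
    by (intro avg_nonneg) simp
  also have "\<dots> = avg X (\<lambda>x. ((f x)\<^sup>2 + ?c\<^sup>2) - (2 * ?c) * f x)"
    by (intro avg_cong) (simp add: power2_eq_square algebra_simps)
  also have "\<dots> = avg X (\<lambda>x. (f x)\<^sup>2) - ?c\<^sup>2"
    using assms by (simp only: avg_diff avg_add avg_cmult avg_const power2_eq_square) simp
  finally show ?thesis by simp
qed

lemma avg_ex:
  assumes "finite X" "X \<noteq> {}"
  shows "\<exists>x\<in>X. avg X f \<le> f x"
proof (rule ccontr)
  assume "\<not> ?thesis"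
  then have "\<forall>x\<in>X. f x < avg X f" by force
  then have "sum f X < (\<Sum>x\<in>X. avg X f)"
    using assms by (intro sum_strict_mono) auto
  then show False using assms by (simp add: avg_def)
qed

lemma pr_mono: "(\<And>x. x \<in> X \<Longrightarrow> P x \<Longrightarrow> Q x) \<Longrightarrow> pr X P \<le> pr X Q"
  by (intro avg_mono) auto

lemma pr_nonneg: "0 \<le> pr X P" by (intro avg_nonneg) auto

lemma pr_le_1: "pr X P \<le> 1"
proof (cases "finite X \<and> X \<noteq> {}")
  case True then show ?thesis by (intro avg_le_1) auto
next
  \<comment> \<open>For empty or infinite \<open>X\<close> the denominator \<open>card X\<close> is
    0 and the quotient is 0 by convention.\<close>
  case False then show ?thesis by (auto simp: avg_def)
qed

lemma pr_ex: "0 < pr X Q \<Longrightarrow> \<exists>x\<in>X. Q x"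
proof (rule ccontr)
  assume a: "0 < pr X Q" "\<not> (\<exists>x\<in>X. Q x)"
  then have "pr X Q = avg X (\<lambda>_. 0)" by (intro avg_cong) auto
  with a show False by (simp add: avg_def)
qed

lemma pr_card: "finite X \<Longrightarrow> pr X Q = card {x\<in>X. Q x} / card X"
  unfolding avg_def by (simp add: sum.If_cases of_bool_def Int_def conj_commute)

text \<open>A point where \<open>f\<close> is below \<open>c\<close> contributes at most
  \<open>c\<close>, any other point at most 1. With \<open>c\<close> halved this is the reverse
  Markov inequality \<open>pr_markov\<close>.\<close>

lemma avg_le_pr:
  assumes "finite X" "X \<noteq> {}" "0 \<le> c" "\<And>x. x \<in> X \<Longrightarrow> f x \<le> 1"
  shows "avg X f \<le> pr X (\<lambda>x. c \<le> f x) + c"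
proof -
  have "f x \<le> of_bool (c \<le> f x) + c" if "x \<in> X" for x
    using assms(3) assms(4)[OF that] by auto
  then have "avg X f \<le> avg X (\<lambda>x. of_bool (c \<le> f x) + c)"
    by (rule avg_mono)
  then show ?thesis using assms(1,2) by (simp add: avg_add)
qed

lemma pr_markov:
  assumes "finite X" "X \<noteq> {}" "0 \<le> c" "\<And>x. x \<in> X \<Longrightarrow> f x \<le> 1" "c \<le> avg X f"
  shows "c / 2 \<le> pr X (\<lambda>x. c / 2 \<le> f x)"
  using avg_le_pr[of X "c/2" f] assms by auto

lemma pr_disj: "pr X (\<lambda>x. P x \<or> Q x) \<le> pr X P + pr X Q"
  unfolding avg_add[symmetric] by (intro avg_mono) auto

section \<open>Uniform random transversals of a list of sets\<close>

lemma set_Cons_eq_image: "set_Cons A XS = (\<lambda>(a, x). a # x) ` (A \<times> XS)"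
  by (auto simp: set_Cons_def)

lemma finite_listset: "\<forall>A\<in>set As. finite A \<Longrightarrow> finite (listset As)"
  by (induction As) (auto simp: set_Cons_eq_image)

lemma listset_nonempty: "\<forall>A\<in>set As. A \<noteq> {} \<Longrightarrow> listset As \<noteq> {}"
  by (induction As) (auto simp: set_Cons_eq_image)

lemma length_listset: "x \<in> listset As \<Longrightarrow> length x = length As"
  by (induction As arbitrary: x) (auto simp: set_Cons_eq_image)

lemma set_listset: "x \<in> listset As \<Longrightarrow> set x \<subseteq> \<Union>(set As)"
  by (induction As arbitrary: x) (fastforce simp: set_Cons_eq_image)+

lemma avg_listset_Cons:
  "avg (listset (A # As)) f = avg A (\<lambda>a. avg (listset As) (\<lambda>x. f (a # x)))"
proof -
  have inj: "inj_on (\<lambda>(a, x). a # x) (A \<times> listset As)" by (auto simp: inj_on_def)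
  show ?thesis
    unfolding avg_def listset.simps set_Cons_eq_image
    by (simp only: card_image[OF inj] sum.reindex[OF inj])
      (simp add: sum.cartesian_product case_prod_unfold o_def
        card_cartesian_product sum_divide_distrib[symmetric] mult.commute)
qed

lemma avg_listset_Nil: "avg (listset []) f = f []"
  by (simp add: avg_def)

text \<open>Union bound over the coordinates, each of which is uniform on its own set.\<close>

lemma pr_hit:
  fixes s :: real
  assumes "\<forall>A\<in>set As. finite A \<and> A \<noteq> {} \<and> real (card (F \<inter> A)) \<le> s * card A"
  shows "pr (listset As) (\<lambda>x. set x \<inter> F \<noteq> {}) \<le> length As * s"
  using assms
proof (induction As)
  case Nil then show ?case by (simp add: avg_def)
next
  case (Cons A As)
  note fin = finite_listset[of As] listset_nonempty[of As]
  have A: "finite A" "A \<noteq> {}" "real (card (F \<inter> A)) \<le> s * card A" using Cons.prems by auto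
  have "pr (listset (A # As)) (\<lambda>x. set x \<inter> F \<noteq> {})
      \<le> avg A (\<lambda>a. of_bool (a \<in> F) + length As * s)"
    unfolding avg_listset_Cons
  proof (rule avg_mono)
    fix a assume "a \<in> A"
    show "pr (listset As) (\<lambda>x. set (a # x) \<inter> F \<noteq> {}) \<le> of_bool (a \<in> F) + length As * s"
    proof (cases "a \<in> F")
      case True
      have "0 \<le> s * card A" using A(3) by linarith
      then have "0 \<le> length As * s" using A by (simp add: zero_le_mult_iff card_gt_0_iff)
      then show ?thesis
        using True pr_le_1[of "listset As" "\<lambda>x. set (a # x) \<inter> F \<noteq> {}"] by simp
    next
      case False
      then show ?thesis using Cons by auto
    qed
  qed
  also have "\<dots> = pr A (\<lambda>a. a \<in> F) + length As * s"
    using A(1,2) by (simp add: avg_add)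
  also have "pr A (\<lambda>a. a \<in> F) \<le> s"
  proof -
    have "{x \<in> A. x \<in> F} = F \<inter> A" by auto
    moreover have "0 < real (card A)" using A by (simp add: card_gt_0_iff)
    ultimately show ?thesis using A by (simp add: pr_card divide_le_eq)
  qed
  finally show ?case by (simp add: algebra_simps)
qed

lemma ex_avoiding:
  fixes s :: real
  assumes "\<forall>A\<in>set As. finite A \<and> A \<noteq> {} \<and> real (card (F \<inter> A)) \<le> s * card A"
    and "length As * s < pr (listset As) Q"
  shows "\<exists>x\<in>listset As. Q x \<and> set x \<inter> F = {}"
proof -
  have "pr (listset As) Q \<le> pr (listset As) (\<lambda>x. (Q x \<and> set x \<inter> F = {}) \<or> set x \<inter> F \<noteq> {})"
    by (rule pr_mono) auto
  also have "\<dots> \<le> pr (listset As) (\<lambda>x. Q x \<and> set x \<inter> F = {}) + pr (listset As) (\<lambda>x. set x \<inter> F \<noteq> {})"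
    by (rule pr_disj)
  finally have "0 < pr (listset As) (\<lambda>x. Q x \<and> set x \<inter> F = {})"
    using pr_hit[OF assms(1)] assms(2) by linarith
  then show ?thesis by (rule pr_ex)
qed

text \<open>Restricting a random transversal to some positions gives a uniform transversal of the
  corresponding sublist, so this is a union bound over sets of positions. The sum runs over a list
  because equal sublists at different positions must be counted separately.\<close>

lemma pr_subseqs:
  assumes "\<forall>A\<in>set As. finite A \<and> A \<noteq> {}"
  shows "pr (listset As) (\<lambda>x. \<exists>y\<in>set (subseqs x). Q y)
    \<le> (\<Sum>Bs\<leftarrow>subseqs As. pr (listset Bs) Q)"
  using assms
proof (induction As arbitrary: Q)
  case Nil then show ?case by (simp add: avg_def)
next
  case (Cons A As)
  have A: "finite A" "A \<noteq> {}" using Cons.prems by auto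
  have *: "avg A (\<lambda>a. \<Sum>Bs\<leftarrow>Bss. pr (listset Bs) (\<lambda>y. Q (a # y)))
      = (\<Sum>Bs\<leftarrow>Bss. pr (listset (A # Bs)) Q)" for Bss
    by (induction Bss) (simp_all add: avg_add avg_listset_Cons A del: listset.simps)
  have "pr (listset (A # As)) (\<lambda>x. \<exists>y\<in>set (subseqs x). Q y)
     = avg A (\<lambda>a. pr (listset As) (\<lambda>x. (\<exists>y\<in>set (subseqs x). Q (a # y)) \<or> (\<exists>y\<in>set (subseqs x). Q y)))"
    unfolding avg_listset_Cons
    by (intro avg_cong arg_cong[of _ _ of_bool]) (auto simp: Let_def)
  also have "\<dots> \<le> avg A (\<lambda>a. (\<Sum>Bs\<leftarrow>subseqs As. pr (listset Bs) (\<lambda>y. Q (a # y)))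
       + (\<Sum>Bs\<leftarrow>subseqs As. pr (listset Bs) Q))"
    using Cons.prems by (intro avg_mono order_trans[OF pr_disj] add_mono Cons.IH) auto
  also have "\<dots> = (\<Sum>Bs\<leftarrow>subseqs As. pr (listset (A # Bs)) Q) + (\<Sum>Bs\<leftarrow>subseqs As. pr (listset Bs) Q)"
    using A by (simp add: avg_add * del: listset.simps)
  also have "\<dots> = (\<Sum>Bs\<leftarrow>subseqs (A # As). pr (listset Bs) Q)"
    by (simp add: Let_def o_def)
  finally show ?case .
qed

section \<open>Blow-ups and robustly connected sets\<close>

definition mixes :: "'a list \<Rightarrow> 'a list \<Rightarrow> 'a list set" where
  "mixes x y = listset (map2 (\<lambda>a b. {a, b}) x y)"

lemma mixes_Cons: "mixes (a # x) (b # y) = (\<lambda>(c, z). c # z) ` ({a, b} \<times> mixes x y)"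
  by (simp add: mixes_def set_Cons_eq_image)

lemma mixes_commute: "mixes x y = mixes y x"
proof -
  have "map2 (\<lambda>a b. {a, b}) x y = map2 (\<lambda>a b. {a, b}) y x"
  proof (induction x arbitrary: y)
    case (Cons a x)
    then show ?case by (cases y) auto
  qed simp
  then show ?thesis by (simp add: mixes_def)
qed

text \<open>These are the mixtures that occur in windows: the window of length
  \<open>Suc (length x)\<close> of \<open>x @ e # y\<close> at position \<open>s\<close> consists of
  \<open>e\<close> and the entries of this mixture.\<close>

lemma take_drop_in_mixes: "length x = length y \<Longrightarrow> take s y @ drop s x \<in> mixes x y"
proof (induction x arbitrary: y s)
  case Nil then show ?case by (simp add: mixes_def)
next
  case (Cons a x)
  obtain b y' where y: "y = b # y'" using Cons.prems by (cases y) auto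
  have "take (s - 1) y' @ drop (s - 1) x \<in> mixes x y'" "x \<in> mixes x y'"
    using Cons.IH[of y'] Cons.IH[of y' 0] Cons.prems y by auto
  then show ?case by (cases s) (force simp: y mixes_Cons)+
qed

text \<open>One coordinate is doubled at a time. By Cauchy-Schwarz, density \<delta> gives average
  codegree \<delta> squared; half of it serves as the density for the remaining coordinates and half
  as the weight of the pairs.\<close>

primrec blowup_density :: "nat \<Rightarrow> real \<Rightarrow> real" where
  "blowup_density 0 \<delta> = 1"
| "blowup_density (Suc m) \<delta> = blowup_density m (\<delta>\<^sup>2 / 2) * (\<delta>\<^sup>2 / 2)"

lemma blowup_density_pos: "0 < \<delta> \<Longrightarrow> 0 < blowup_density m \<delta>"
  by (induction m arbitrary: \<delta>) auto

lemma blowup_density_le: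
  assumes "0 < \<delta>" "length Bs = m" "\<forall>B\<in>set Bs. finite B \<and> B \<noteq> {}" "\<delta> \<le> pr (listset Bs) S"
  shows "blowup_density m \<delta> \<le> avg (listset Bs) (\<lambda>x. pr (listset Bs) (\<lambda>y. \<forall>z\<in>mixes x y. S z))"
  using assms
proof (induction m arbitrary: \<delta> Bs S)
  case 0
  have "S []" using 0 by (cases "S []") (auto simp: avg_listset_Nil simp del: listset.simps)
  then show ?case using 0
    by (simp add: avg_listset_Nil mixes_def del: listset.simps) (simp add: listset.simps)
next
  case (Suc m)
  note Bs = Suc.prems(2,3) and dens = Suc.prems(4)
  define \<delta>' where "\<delta>' = \<delta>\<^sup>2 / 2"
  have "0 < \<delta>'" using Suc.prems by (simp add: \<delta>'_def)
  define p where "p = blowup_density m \<delta>'"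
  have p: "0 < p" using blowup_density_pos[OF \<open>0 < \<delta>'\<close>] by (simp add: p_def)
  have "p * \<delta>' \<le> avg (listset Bs) (\<lambda>x. pr (listset Bs) (\<lambda>y. \<forall>z\<in>mixes x y. S z))"
  proof -
    obtain A As where As: "Bs = A # As" using Bs by (cases Bs) auto
    have A: "finite A" "A \<noteq> {}" using Bs As by auto
    let ?X = "listset As"
    have X: "finite ?X" "?X \<noteq> {}"
      using Bs As by (auto intro!: finite_listset simp: listset_nonempty)
    define q where "q a b = pr ?X (\<lambda>x. S (a # x) \<and> S (b # x))" for a b
    define T where "T a b = avg ?X (\<lambda>x. pr ?X (\<lambda>y. \<forall>z\<in>mixes x y. S (a # z) \<and> S (b # z)))" for a b
    have T0: "0 \<le> T a b" for a b unfolding T_def by (intro avg_nonneg) auto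
    \<comment> \<open>This linear bound avoids splitting off the pairs of large codegree: it is
      trivial below \<delta>', and above it \<open>T\<close> is at least \<open>p\<close> while
      \<open>q\<close> is at most 1. Its average over all pairs is at least p \<delta>'.\<close>
    have qT: "p * (q a b - \<delta>') \<le> T a b" for a b
    proof (cases "\<delta>' \<le> q a b")
      case True
      have "p \<le> T a b" unfolding T_def
        unfolding p_def using True Bs As \<open>0 < \<delta>'\<close> by (intro Suc.IH) (auto simp: q_def)
      moreover have "q a b \<le> 1" unfolding q_def by (rule pr_le_1)
      then have "p * (q a b - \<delta>') \<le> p * 1"
        using p \<open>0 < \<delta>'\<close> by (intro mult_left_mono) auto
      ultimately show ?thesis by simp
    next
      case False
      then have "p * (q a b - \<delta>') \<le> 0" using p by (intro mult_nonneg_nonpos) auto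
      with T0[of a b] show ?thesis by linarith
    qed
    have "\<delta>\<^sup>2 \<le> (avg A (\<lambda>a. pr ?X (\<lambda>x. S (a # x))))\<^sup>2"
      using dens Suc.prems by (intro power_mono) (simp_all add: As avg_listset_Cons del: listset.simps)
    also have "\<dots> = (avg ?X (\<lambda>x. pr A (\<lambda>a. S (a # x))))\<^sup>2"
      by (subst avg_swap) simp
    also have "\<dots> \<le> avg ?X (\<lambda>x. (pr A (\<lambda>a. S (a # x)))\<^sup>2)"
      by (rule avg_square[OF X])
    also have "\<dots> = avg ?X (\<lambda>x. avg A (\<lambda>a. avg A (\<lambda>b. of_bool (S (a # x) \<and> S (b # x)))))"
      by (simp add: power2_eq_square avg_cmult[symmetric] of_bool_conj mult.commute)
    also have "\<dots> = avg A (\<lambda>a. avg A (q a))"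
      unfolding q_def by (subst avg_swap, subst avg_swap) simp
    finally have "p * \<delta>' \<le> p * (avg A (\<lambda>a. avg A (q a)) - \<delta>')"
      using p by (intro mult_left_mono) (auto simp: \<delta>'_def)
    also have "\<dots> = avg A (\<lambda>a. avg A (\<lambda>b. p * (q a b - \<delta>')))"
      using A by (simp add: avg_cmult avg_diff)
    also have "\<dots> \<le> avg A (\<lambda>a. avg A (\<lambda>b. T a b))"
      by (intro avg_mono qT)
    also have "\<dots> = avg A (\<lambda>a. avg ?X (\<lambda>x. avg A (\<lambda>b. pr ?X (\<lambda>y. \<forall>z\<in>mixes (a # x) (b # y). S z))))"
      unfolding T_def
      by (subst avg_swap) (intro avg_cong arg_cong[of _ _ of_bool], auto simp: mixes_Cons)
    also have "\<dots> = avg (listset Bs) (\<lambda>x. pr (listset Bs) (\<lambda>y. \<forall>z\<in>mixes x y. S z))"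
      by (simp add: As avg_listset_Cons del: listset.simps)
    finally show ?thesis .
  qed
  then show ?case by (simp add: p_def \<delta>'_def del: listset.simps)
qed

text \<open>Dependent random choice: most pairs in the neighbourhood of a suitable vertex \<open>z\<close>
  have many common neighbours.\<close>

lemma robustly_connected_subset:
  fixes g :: "'x \<Rightarrow> 'x \<Rightarrow> bool" and \<rho> :: real
  assumes X: "finite X" "X \<noteq> {}" and sym: "\<And>x y. x \<in> X \<Longrightarrow> y \<in> X \<Longrightarrow> g x y = g y x"
    and \<rho>: "0 < \<rho>" "\<rho> \<le> avg X (\<lambda>x. pr X (g x))"
    and good_def: "\<And>x y. good x y \<longleftrightarrow> \<rho>\<^sup>2 / 16 \<le> pr X (\<lambda>z. g x z \<and> g z y)"
  shows "\<exists>U\<subseteq>X. \<rho> / 4 \<le> pr X (\<lambda>x. x \<in> U) \<and>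
    (\<forall>x\<in>U. \<forall>y\<in>U. \<rho> / 4 \<le> pr X (\<lambda>s. good x s \<and> good s y)) \<and>
    (\<forall>x\<in>U. \<rho>\<^sup>2 / 16 \<le> pr X (g x))"
proof -
  define bad where "bad x y \<longleftrightarrow> \<not> good x y" for x y
  have good_sym: "good x y = good y x" if "x \<in> X" "y \<in> X" for x y
  proof -
    have "pr X (\<lambda>z. g x z \<and> g z y) = pr X (\<lambda>z. g y z \<and> g z x)"
      using sym that by (intro avg_cong) auto
    then show ?thesis by (simp add: good_def)
  qed
  define deg where "deg z = pr X (g z)" for z
  define B where "B z = avg X (\<lambda>x. pr X (\<lambda>y. g z x \<and> g z y \<and> bad x y))" for z
  have "avg X B = avg X (\<lambda>x. avg X (\<lambda>y. pr X (\<lambda>z. g z x \<and> g z y \<and> bad x y)))"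
    unfolding B_def by (subst avg_swap, subst avg_swap) simp
  also have "\<dots> \<le> avg X (\<lambda>x. avg X (\<lambda>y. \<rho>\<^sup>2 / 16))"
  proof (intro avg_mono)
    fix x y assume xy: "x \<in> X" "y \<in> X"
    show "pr X (\<lambda>z. g z x \<and> g z y \<and> bad x y) \<le> \<rho>\<^sup>2 / 16"
    proof (cases "good x y")
      case True
      then have "pr X (\<lambda>z. g z x \<and> g z y \<and> bad x y) = avg X (\<lambda>_. 0)"
        by (intro avg_cong) (simp add: bad_def)
      then show ?thesis using X by simp
    next
      case False
      have "pr X (\<lambda>z. g z x \<and> g z y \<and> bad x y) \<le> pr X (\<lambda>z. g x z \<and> g z y)"
        using sym xy by (intro pr_mono) auto
      with False show ?thesis by (simp add: good_def)
    qed
  qed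
  finally have B: "avg X B \<le> \<rho>\<^sup>2 / 16" using X by simp
  have "\<rho>\<^sup>2 \<le> (avg X deg)\<^sup>2"
    using \<rho> unfolding deg_def[abs_def] by (intro power_mono) auto
  also have "\<dots> \<le> avg X (\<lambda>z. (deg z)\<^sup>2)" by (rule avg_square[OF X])
  \<comment> \<open>Degree is traded against bad pairs. The weight 8 costs only half of the squared
    density, and it gives \<open>B z\<close> at most an eighth of the square of \<nu>, so that
    \<open>U\<close> keeps at least half of the neighbourhood of \<open>z\<close>.\<close>
  finally have "\<rho>\<^sup>2 / 2 \<le> avg X (\<lambda>z. (deg z)\<^sup>2 - 8 * B z)"
    using B by (simp add: avg_diff avg_cmult)
  then obtain z where z: "z \<in> X" "\<rho>\<^sup>2 / 2 \<le> (deg z)\<^sup>2 - 8 * B z"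
    using avg_ex[OF X] order_trans by blast
  define \<nu> where "\<nu> = deg z"
  have "0 \<le> B z" unfolding B_def by (intro avg_nonneg) auto
  moreover have "(\<rho> / 2)\<^sup>2 = \<rho>\<^sup>2 / 4" by (simp add: power_divide)
  ultimately have "(\<rho> / 2)\<^sup>2 \<le> \<nu>\<^sup>2"
    using z(2) zero_le_power2[of "deg z"] unfolding \<nu>_def by linarith
  moreover have "0 \<le> \<nu>" unfolding \<nu>_def deg_def by (rule pr_nonneg)
  ultimately have \<nu>: "\<rho> / 2 \<le> \<nu>" by (rule power2_le_imp_le)
  then have \<nu>0: "0 < \<nu>" using \<rho> by linarith
  have Bz: "B z \<le> \<nu>\<^sup>2 / 8" using z \<rho>(1) by (simp add: \<nu>_def) (smt (verit) zero_le_power2)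
  \<comment> \<open>Two members of \<open>U\<close> together spoil at most \<nu>/4 + \<nu>/4 of the
    neighbourhood of \<open>z\<close>; the remaining half is good to both.\<close>
  define U where "U = {x \<in> X. g z x \<and> pr X (\<lambda>y. g z y \<and> bad x y) \<le> \<nu> / 4}"
  have "\<nu> \<le> avg X (\<lambda>x. of_bool (x \<in> U) + 4 / \<nu> * pr X (\<lambda>y. g z x \<and> g z y \<and> bad x y))"
    unfolding \<nu>_def[unfolded deg_def]
  proof (intro avg_mono)
    fix x assume x: "x \<in> X"
    have 0: "0 \<le> 4 / \<nu> * pr X (\<lambda>y. g z x \<and> g z y \<and> bad x y)"
      using \<nu>0 pr_nonneg by (intro mult_nonneg_nonneg) auto
    show "of_bool (g z x) \<le> of_bool (x \<in> U) + 4 / pr X (g z) * pr X (\<lambda>y. g z x \<and> g z y \<and> bad x y)"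
    proof (cases "g z x \<and> x \<notin> U")
      case True
      then have "\<nu> / 4 \<le> pr X (\<lambda>y. g z x \<and> g z y \<and> bad x y)" using x by (auto simp: U_def)
      then have "1 \<le> 4 / \<nu> * pr X (\<lambda>y. g z x \<and> g z y \<and> bad x y)"
        using \<nu>0 by (simp add: field_simps)
      then show ?thesis using True by (simp add: \<nu>_def deg_def)
    next
      case False
      then show ?thesis using 0 by (auto simp: \<nu>_def deg_def)
    qed
  qed
  also have "\<dots> = pr X (\<lambda>x. x \<in> U) + 4 / \<nu> * B z"
    by (simp only: avg_add avg_cmult B_def)
  also have "4 / \<nu> * B z \<le> 4 / \<nu> * (\<nu>\<^sup>2 / 8)"
    using \<nu>0 Bz by (intro mult_left_mono) auto
  also have "\<dots> = \<nu> / 2" using \<nu>0 by (simp add: power2_eq_square)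
  finally have prU: "\<rho> / 4 \<le> pr X (\<lambda>x. x \<in> U)" using \<nu> by linarith
  have common: "\<rho> / 4 \<le> pr X (\<lambda>s. good x s \<and> good s y)" if xy: "x \<in> U" "y \<in> U" for x y
  proof -
    have "pr X (g z) \<le> pr X (\<lambda>s. (good x s \<and> good s y) \<or> (g z s \<and> bad x s) \<or> (g z s \<and> bad y s))"
      using xy good_sym by (intro pr_mono) (auto simp: bad_def U_def)
    also have "\<dots> \<le> pr X (\<lambda>s. good x s \<and> good s y) + (pr X (\<lambda>s. g z s \<and> bad x s) + pr X (\<lambda>s. g z s \<and> bad y s))"
      by (intro order_trans[OF pr_disj] add_left_mono pr_disj)
    also have "\<dots> \<le> pr X (\<lambda>s. good x s \<and> good s y) + (\<nu> / 4 + \<nu> / 4)"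
      using xy by (intro add_mono) (auto simp: U_def)
    finally show ?thesis using \<nu> by (simp add: \<nu>_def deg_def)
  qed
  have "\<rho>\<^sup>2 / 16 \<le> pr X (g x)" if x: "x \<in> U" for x
  proof -
    have "0 < pr X (\<lambda>s. good x s \<and> good s x)" using common[OF x x] \<rho> by linarith
    then obtain s where "good x s" by (auto dest: pr_ex)
    then have "\<rho>\<^sup>2 / 16 \<le> pr X (\<lambda>z. g x z \<and> g z s)" by (simp add: good_def)
    also have "\<dots> \<le> pr X (g x)" by (rule pr_mono) auto
    finally show ?thesis .
  qed
  with prU common show ?thesis by (intro exI[of _ U]) (auto simp: U_def)
qed

section \<open>Walks\<close>

definition link :: "'a set set \<Rightarrow> 'a \<Rightarrow> 'a list \<Rightarrow> 'a list \<Rightarrow> bool" where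
  "link H d x y \<longleftrightarrow> (\<forall>z\<in>mixes x y. insert d (set z) \<in> H)"

lemma link_commute: "link H d x y = link H d y x"
  by (simp add: link_def mixes_commute)

lemma link_left: "link H d x y \<Longrightarrow> length x = length y \<Longrightarrow> insert d (set x) \<in> H"
  using take_drop_in_mixes[of x y 0] by (auto simp: link_def)

definition flat :: "('a \<times> 'a list) list \<Rightarrow> 'a list" where
  "flat ps = concat (map (\<lambda>(d, z). d # z) ps)"

lemma flat_simps [simp]:
  "flat [] = []" "flat ((d, z) # ps) = d # z @ flat ps" "flat (ps @ qs) = flat ps @ flat qs"
  by (simp_all add: flat_def)

lemma length_flat: "\<forall>z\<in>snd ` set ps. length z = m \<Longrightarrow> length (flat ps) = length ps * Suc m"
  by (induction ps) auto

text \<open>Each entry of the list is a connector with the tuple it leads to, and \<open>d\<close>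
  is the connector of the final step into \<open>y\<close>. The vertices strictly between the two
  end tuples are therefore \<open>flat ps @ [d]\<close>.\<close>

fun walk :: "'a set set \<Rightarrow> 'a list \<Rightarrow> ('a \<times> 'a list) list \<Rightarrow> 'a \<Rightarrow> 'a list \<Rightarrow> bool" where
  "walk H x [] d y = link H d x y"
| "walk H x ((e, z) # ps) d y = (link H e x z \<and> walk H z ps d y)"

lemma walk_append: "walk H x ps d z \<Longrightarrow> walk H z qs e y \<Longrightarrow> walk H x (ps @ (d, z) # qs) e y"
  by (induction H x ps d z rule: walk.induct) auto

text \<open>Used to see that a tuple in the middle of a walk has distinct entries: it lies in an
  edge.\<close>

lemma walk_start:
  assumes "walk H x ps d y" "\<forall>z\<in>snd ` set ps. length z = length x" "length y = length x"
  shows "\<exists>e. insert e (set x) \<in> H"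
  using assms link_left by (cases ps) fastforce+

text \<open>The parameter \<sigma> is the fraction of each set that may become forbidden; it enters
  through \<open>small\<close>. The exact size of the edges makes a connector and the entries of its
  tuple pairwise distinct.\<close>

locale tuple_system =
  fixes Bs :: "'a set list" and D :: "'a set" and H :: "'a set set" and \<sigma> :: real
  assumes fin: "\<And>A. A \<in> set (D # Bs) \<Longrightarrow> finite A \<and> A \<noteq> {}"
    and H_card: "\<And>e. e \<in> H \<Longrightarrow> card e = Suc (length Bs)"
begin

abbreviation X :: "'a list set" where "X \<equiv> listset Bs"

lemma X: "finite X" "X \<noteq> {}"
  using fin by (auto intro!: finite_listset simp: listset_nonempty)

lemma D: "finite D" "D \<noteq> {}"
  using fin by auto

lemma edge_tupleD:
  assumes "insert d (set x) \<in> H" "length x = length Bs"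
  shows "distinct (d # x)"
proof -
  have "card (set (d # x)) = length (d # x)"
    using H_card[OF assms(1)] assms(2) by simp
  then show ?thesis by (rule card_distinct)
qed

lemma linkD:
  assumes "link H d x y" "length x = length Bs" "length y = length Bs"
  shows "distinct (d # x)" "distinct (d # y)"
  using edge_tupleD[OF link_left[of H d x y]] edge_tupleD[OF link_left[of H d y x]] assms
  by (auto simp: link_commute)

text \<open>Besides \<open>F\<close> itself, \<open>p\<close> further vertices are budgeted: a
  construction that uses up to \<open>p\<close> vertices can forbid them as it goes and stay below
  the fraction \<sigma> in every set.\<close>

definition small :: "nat \<Rightarrow> 'a set \<Rightarrow> bool" where
  "small p F \<longleftrightarrow> (\<forall>A\<in>set (D # Bs). real (card (F \<inter> A) + p) \<le> \<sigma> * card A)"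

lemma small_Un:
  assumes "small p F" "p' + length xs \<le> p"
  shows "small p' (F \<union> set xs)"
  unfolding small_def
proof
  fix A assume A: "A \<in> set (D # Bs)"
  have "card ((F \<union> set xs) \<inter> A) \<le> card ((F \<inter> A) \<union> set xs)"
    using fin[OF A] by (intro card_mono) auto
  also have "\<dots> \<le> card (F \<inter> A) + length xs"
    by (intro order_trans[OF card_Un_le] add_left_mono card_length)
  finally have "real (card ((F \<union> set xs) \<inter> A) + p') \<le> real (card (F \<inter> A) + p)"
    using assms(2) by linarith
  also have "\<dots> \<le> \<sigma> * card A" using assms(1) A by (auto simp: small_def)
  finally show "real (card ((F \<union> set xs) \<inter> A) + p') \<le> \<sigma> * card A" .
qed

lemma small_mono: "small p F \<Longrightarrow> p' \<le> p \<Longrightarrow> small p' F"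
  using small_Un[of p F p' "[]"] by simp

lemma ex_avoiding_small:
  assumes "small p F" "length Bs * \<sigma> < pr X Q"
  shows "\<exists>x\<in>X. Q x \<and> set x \<inter> F = {}"
proof (rule ex_avoiding[OF _ assms(2)])
  have "small 0 F" using assms(1) by (rule small_mono) simp
  then show "\<forall>A\<in>set Bs. finite A \<and> A \<noteq> {} \<and> real (card (F \<inter> A)) \<le> \<sigma> * card A"
    using fin by (auto simp: small_def)
qed

text \<open>Only the interior has to avoid \<open>F\<close>. The end tuples are exempt, so they can
  themselves be put into \<open>F\<close> to keep the interior away from them.\<close>

definition gwalk :: "'a set \<Rightarrow> nat \<Rightarrow> 'a list \<Rightarrow> ('a \<times> 'a list) list \<Rightarrow> 'a \<Rightarrow> 'a list \<Rightarrow> bool" where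
  "gwalk F L x ps d y \<longleftrightarrow> length ps \<le> L \<and> walk H x ps d y \<and> distinct (flat ps @ [d]) \<and>
     set (flat ps @ [d]) \<inter> F = {} \<and> set (flat ps @ [d]) \<subseteq> D \<union> \<Union>(set Bs) \<and>
     (\<forall>z\<in>snd ` set ps. length z = length Bs)"

text \<open>The budget is \<open>L\<close> interior tuples with their connectors plus the last
  connector, rounded up to a multiple of \<open>Suc (length Bs)\<close>.\<close>

definition rconn :: "nat \<Rightarrow> 'a list \<Rightarrow> 'a list \<Rightarrow> bool" where
  "rconn L x y \<longleftrightarrow> (\<forall>F. small (Suc L * Suc (length Bs)) F \<longrightarrow> (\<exists>ps d. gwalk F L x ps d y))"

lemma gwalk_length:
  assumes "gwalk F L x ps d y"
  shows "length (flat ps) \<le> L * Suc (length Bs)"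
proof -
  have "length (flat ps) = length ps * Suc (length Bs)"
    using assms by (intro length_flat) (auto simp: gwalk_def)
  also have "\<dots> \<le> L * Suc (length Bs)"
    using assms unfolding gwalk_def by (intro mult_right_mono) auto
  finally show ?thesis .
qed

lemma rconn_mono:
  assumes "rconn L x y" "L \<le> L'"
  shows "rconn L' x y"
  unfolding rconn_def
proof (intro allI impI)
  fix F assume "small (Suc L' * Suc (length Bs)) F"
  then have "small (Suc L * Suc (length Bs)) F"
    using assms(2) by (elim small_mono) (intro mult_right_mono, auto)
  then obtain ps d where "gwalk F L x ps d y" using assms(1) unfolding rconn_def by blast
  then have "gwalk F L' x ps d y" using assms(2) by (simp add: gwalk_def)
  then show "\<exists>ps d. gwalk F L' x ps d y" by blast
qed

text \<open>There are enough middle tuples for one to avoid \<open>F\<close>; the first walk then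
  avoids it, and the second avoids both. With m-tuples, the middle tuple and the first walk use at
  most m + L1 (m+1) + 1 = (L1+1)(m+1) vertices, which leaves exactly the budget of the second
  walk.\<close>

lemma rconn_compose:
  assumes "length Bs * \<sigma> < pr X (\<lambda>z. rconn L1 x z \<and> rconn L2 z y)" "length y = length Bs"
  shows "rconn (Suc (L1 + L2)) x y"
  unfolding rconn_def
proof (intro allI impI)
  let ?m = "length Bs"
  fix F assume F: "small (Suc (Suc (L1 + L2)) * Suc ?m) F"
  obtain z where z: "z \<in> X" "rconn L1 x z" "rconn L2 z y" "set z \<inter> F = {}"
    using ex_avoiding_small[OF F assms(1)] by blast
  have lz: "length z = ?m" using z by (simp add: length_listset)
  have zA: "set z \<subseteq> \<Union>(set Bs)" using z by (intro set_listset)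
  have F1: "small (Suc L1 * Suc ?m) (F \<union> set z)"
    using F lz by (elim small_Un) (simp add: algebra_simps)
  then obtain ps d where ps: "gwalk (F \<union> set z) L1 x ps d z" using z unfolding rconn_def by blast
  note lps = gwalk_length[OF ps]
  have "small (Suc L2 * Suc ?m) (F \<union> set (z @ flat ps @ [d]))"
    using F lz lps by (elim small_Un) (simp add: algebra_simps)
  then obtain qs e where qs: "gwalk (F \<union> set (z @ flat ps @ [d])) L2 z qs e y"
    using z unfolding rconn_def by blast
  have "distinct z"
  proof -
    obtain e' where "insert e' (set z) \<in> H"
      using qs walk_start[of H z qs e y] lz assms(2) by (auto simp: gwalk_def)
    then show ?thesis using edge_tupleD lz by fastforce
  qed
  then have "gwalk F (Suc (L1 + L2)) x (ps @ (d, z) # qs) e y"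
    using ps qs z(4) zA lz walk_append[of H x ps d z qs e y] unfolding gwalk_def by auto
  then show "\<exists>ps d. gwalk F (Suc (L1 + L2)) x ps d y" by blast
qed

lemma rconn_0:
  assumes "\<rho> \<le> pr D (\<lambda>d. link H d x y)" "\<sigma> \<le> \<rho>"
  shows "rconn 0 x y"
  unfolding rconn_def
proof (intro allI impI)
  fix F assume F: "small (Suc 0 * Suc (length Bs)) F"
  have cD: "0 < card D" using D by (simp add: card_gt_0_iff)
  have "\<exists>d\<in>D. link H d x y \<and> d \<notin> F"
  proof (rule ccontr)
    assume "\<not> ?thesis"
    then have "card {d\<in>D. link H d x y} \<le> card (F \<inter> D)" using D by (intro card_mono) auto
    \<comment> \<open>Strict, because the budget contains at least one vertex.\<close>
    moreover have "real (card (F \<inter> D)) < \<sigma> * card D" using F by (auto simp: small_def)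
    moreover have "\<sigma> * card D \<le> \<rho> * card D" using assms(2) by (intro mult_right_mono) auto
    moreover have "\<rho> * card D \<le> card {d\<in>D. link H d x y}"
      using assms(1) D cD by (simp add: pr_card field_simps)
    ultimately show False by linarith
  qed
  then obtain d where "d \<in> D" "link H d x y" "d \<notin> F" by blast
  then have "gwalk F 0 x [] d y" by (auto simp: gwalk_def)
  then show "\<exists>ps d. gwalk F 0 x ps d y" by blast
qed

text \<open>Counting blow-ups makes the graph \<open>g\<close> of pairs with many connectors dense,
  and dependent random choice yields \<open>U\<close>. But \<open>U\<close> may span few pairs of
  \<open>g\<close>; in a bipartite graph it can lie on one side. Adding the set \<open>U'\<close> of
  tuples with many neighbours in \<open>U\<close> makes steps with both ends in the set
  plentiful.\<close>

lemma ex_connected_set: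
  assumes dens: "\<And>d. d \<in> D \<Longrightarrow> \<delta> \<le> pr X (\<lambda>x. insert d (set x) \<in> H)" and \<delta>: "0 < \<delta>"
    and \<rho>_def: "\<rho> = blowup_density (length Bs) \<delta> / 2"
    and \<sigma>: "length Bs * \<sigma> < \<rho> ^ 3 / 128" "\<sigma> \<le> \<rho>"
  shows "\<exists>V\<subseteq>X. \<rho> ^ 4 / 128 \<le> avg D (\<lambda>d. avg X (\<lambda>x. pr X (\<lambda>y. x \<in> V \<and> y \<in> V \<and> link H d x y))) \<and>
    (\<forall>x\<in>V. \<forall>y\<in>V. rconn 5 x y)"
proof -
  let ?\<psi> = "blowup_density (length Bs) \<delta>"
  have \<rho>0: "0 < \<rho>" using blowup_density_pos[OF \<delta>] by (simp add: \<rho>_def)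
  define w where "w x y = pr D (\<lambda>d. link H d x y)" for x y
  define g where "g x y \<longleftrightarrow> \<rho> \<le> w x y" for x y
  have g_sym: "g x y = g y x" for x y by (simp add: g_def w_def link_commute)
  have "?\<psi> = avg D (\<lambda>_. ?\<psi>)" using D by simp
  also have "\<dots> \<le> avg D (\<lambda>d. avg X (\<lambda>x. pr X (\<lambda>y. link H d x y)))"
    unfolding link_def using \<delta> fin dens by (intro avg_mono blowup_density_le) auto
  also have "\<dots> = avg X (\<lambda>x. avg X (\<lambda>y. w x y))"
    unfolding w_def by (subst avg_swap, subst avg_swap[of D X]) simp
  also have "\<dots> \<le> avg X (\<lambda>x. pr X (g x) + \<rho>)"
    unfolding g_def w_def using X \<rho>0 by (intro avg_mono avg_le_pr) (auto simp: pr_le_1)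
  also have "\<dots> = avg X (\<lambda>x. pr X (g x)) + \<rho>" using X by (simp add: avg_add)
  finally have dens_g: "\<rho> \<le> avg X (\<lambda>x. pr X (g x))" by (simp add: \<rho>_def)
  have "avg X (\<lambda>x. pr X (g x)) \<le> 1" using X by (intro avg_le_1 pr_le_1) auto
  then have \<rho>1: "\<rho> \<le> 1" using dens_g by linarith
  have "\<rho> ^ 3 \<le> \<rho> ^ 2" "\<rho> ^ 3 \<le> \<rho> ^ 1" using \<rho>0 \<rho>1 by (intro power_decreasing; simp)+
  then have \<sigma>': "length Bs * \<sigma> < \<rho>\<^sup>2 / 16" "length Bs * \<sigma> < \<rho> / 4"
    using \<sigma> zero_less_power[OF \<rho>0, of 3] unfolding power_one_right by linarith+
  define good where "good x y \<longleftrightarrow> \<rho>\<^sup>2 / 16 \<le> pr X (\<lambda>z. g x z \<and> g z y)" for x y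
  obtain U where U: "U \<subseteq> X" "\<rho> / 4 \<le> pr X (\<lambda>x. x \<in> U)"
    "\<And>x y. x \<in> U \<Longrightarrow> y \<in> U \<Longrightarrow> \<rho> / 4 \<le> pr X (\<lambda>s. good x s \<and> good s y)"
    "\<And>x. x \<in> U \<Longrightarrow> \<rho>\<^sup>2 / 16 \<le> pr X (g x)"
    using robustly_connected_subset[OF X g_sym \<rho>0 dens_g good_def] by blast
  define U' where "U' = {y\<in>X. \<rho> ^ 3 / 128 \<le> pr X (\<lambda>x. x \<in> U \<and> g x y)}"
  have len: "x \<in> X \<Longrightarrow> length x = length Bs" for x by (rule length_listset)
  \<comment> \<open>Interior tuples needed: none for a pair of \<open>g\<close>, 1 for a good pair,
    3 inside \<open>U\<close>. An end in \<open>U'\<close> costs one more on its side, hence 4 and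
    finally 5.\<close>
  have g0: "rconn 0 x y" if "g x y" for x y
    using rconn_0[of \<rho> x y] that \<sigma> by (simp add: g_def w_def)
  have good1: "rconn 1 x y" if "good x y" "y \<in> X" for x y
  proof -
    have "\<rho>\<^sup>2 / 16 \<le> pr X (\<lambda>z. rconn 0 x z \<and> rconn 0 z y)"
      by (rule order_trans[OF that(1)[unfolded good_def] pr_mono]) (auto intro: g0)
    then show ?thesis using rconn_compose[of 0 x 0 y] \<sigma>' len[OF that(2)] by simp
  qed
  have UU: "rconn 3 x y" if "x \<in> U" "y \<in> U" for x y
  proof -
    have y: "y \<in> X" using that U by blast
    have "\<rho> / 4 \<le> pr X (\<lambda>z. rconn 1 x z \<and> rconn 1 z y)"
      by (rule order_trans[OF U(3)[OF that] pr_mono]) (auto intro: good1[unfolded One_nat_def] y)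
    then show ?thesis using rconn_compose[of 1 x 1 y] \<sigma>' len[OF y] by (simp add: numeral_3_eq_3)
  qed
  have UV: "rconn 4 x y" if x: "x \<in> U" and y: "y \<in> U \<union> U'" for x y
  proof (cases "y \<in> U")
    case True
    then show ?thesis using rconn_mono[OF UU[OF x]] by simp
  next
    case False
    then have y': "y \<in> X" "\<rho> ^ 3 / 128 \<le> pr X (\<lambda>u. u \<in> U \<and> g u y)" using y by (auto simp: U'_def)
    have "\<rho> ^ 3 / 128 \<le> pr X (\<lambda>u. rconn 3 x u \<and> rconn 0 u y)"
      by (rule order_trans[OF y'(2) pr_mono]) (auto intro: g0 UU x)
    then show ?thesis using rconn_compose[of 3 x 0 y] \<sigma> len[OF y'(1)] by (simp add: eval_nat_numeral)
  qed
  have VV: "rconn 5 x y" if x: "x \<in> U \<union> U'" and y: "y \<in> U \<union> U'" for x y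
  proof (cases "x \<in> U")
    case True
    then show ?thesis using rconn_mono[OF UV[OF _ y]] by simp
  next
    case False
    then have x': "\<rho> ^ 3 / 128 \<le> pr X (\<lambda>u. u \<in> U \<and> g u x)" using x by (auto simp: U'_def)
    have y': "y \<in> X" using y U by (auto simp: U'_def)
    have "\<rho> ^ 3 / 128 \<le> pr X (\<lambda>u. rconn 0 x u \<and> rconn 4 u y)"
      by (rule order_trans[OF x' pr_mono]) (use g_sym UV[OF _ y] g0 in blast)
    then show ?thesis using rconn_compose[of 0 x 4 y] \<sigma> len[OF y'] by (simp add: eval_nat_numeral)
  qed
  \<comment> \<open>Pairs of \<open>g\<close> starting in \<open>U\<close> have measure at least
    \<rho>^3/64, of which ends outside \<open>U'\<close> account for at most \<rho>^3/128. A
    fraction \<rho> of \<open>D\<close> connects each of the others, which gives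
    \<rho>^4/128.\<close>
  have "\<rho> ^ 3 / 64 = \<rho>\<^sup>2 / 16 * (\<rho> / 4)" by (simp add: power2_eq_square power3_eq_cube)
  also have "\<dots> \<le> \<rho>\<^sup>2 / 16 * pr X (\<lambda>x. x \<in> U)" using U(2) by (intro mult_left_mono) auto
  also have "\<dots> = avg X (\<lambda>x. \<rho>\<^sup>2 / 16 * of_bool (x \<in> U))" by (simp only: avg_cmult)
  also have "\<dots> \<le> avg X (\<lambda>x. pr X (\<lambda>y. x \<in> U \<and> g x y))"
  proof (rule avg_mono)
    fix x
    show "\<rho>\<^sup>2 / 16 * of_bool (x \<in> U) \<le> pr X (\<lambda>y. x \<in> U \<and> g x y)"
      using U(4)[of x] pr_nonneg[of X "\<lambda>y. x \<in> U \<and> g x y"] by (cases "x \<in> U") simp_all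
  qed
  also have "\<dots> = avg X (\<lambda>y. pr X (\<lambda>x. x \<in> U \<and> g x y))" by (rule avg_swap)
  also have "\<dots> \<le> avg X (\<lambda>y. pr X (\<lambda>x. x \<in> U \<and> y \<in> U' \<and> g x y) + \<rho> ^ 3 / 128)"
  proof (rule avg_mono)
    fix y assume "y \<in> X"
    show "pr X (\<lambda>x. x \<in> U \<and> g x y) \<le> pr X (\<lambda>x. x \<in> U \<and> y \<in> U' \<and> g x y) + \<rho> ^ 3 / 128"
    proof (cases "y \<in> U'")
      case True
      then show ?thesis using \<rho>0 by simp
    next
      case False
      then have "pr X (\<lambda>x. x \<in> U \<and> g x y) \<le> \<rho> ^ 3 / 128" using \<open>y \<in> X\<close> by (simp add: U'_def)
      then show ?thesis using pr_nonneg[of X "\<lambda>x. x \<in> U \<and> y \<in> U' \<and> g x y"] by linarith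
    qed
  qed
  also have "\<dots> = avg X (\<lambda>y. pr X (\<lambda>x. x \<in> U \<and> y \<in> U' \<and> g x y)) + \<rho> ^ 3 / 128"
    using X by (simp add: avg_add)
  finally have "\<rho> * (\<rho> ^ 3 / 128) \<le> \<rho> * avg X (\<lambda>y. pr X (\<lambda>x. x \<in> U \<and> y \<in> U' \<and> g x y))"
    using \<rho>0 by (intro mult_left_mono) auto
  also have "\<dots> = avg X (\<lambda>x. avg X (\<lambda>y. \<rho> * of_bool (x \<in> U \<and> y \<in> U' \<and> g x y)))"
    by (subst avg_swap) (simp only: avg_cmult)
  also have "\<dots> \<le> avg X (\<lambda>x. avg X (\<lambda>y. avg D (\<lambda>d. of_bool (x \<in> U \<union> U' \<and> y \<in> U \<union> U' \<and> link H d x y))))"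
  proof (intro avg_mono)
    fix x y
    show "\<rho> * of_bool (x \<in> U \<and> y \<in> U' \<and> g x y)
      \<le> avg D (\<lambda>d. of_bool (x \<in> U \<union> U' \<and> y \<in> U \<union> U' \<and> link H d x y))"
      by (cases "x \<in> U \<and> y \<in> U' \<and> g x y") (auto simp: g_def w_def pr_nonneg)
  qed
  also have "\<dots> = avg D (\<lambda>d. avg X (\<lambda>x. pr X (\<lambda>y. x \<in> U \<union> U' \<and> y \<in> U \<union> U' \<and> link H d x y)))"
    by (subst (2) avg_swap, subst avg_swap) simp
  finally have "\<rho> ^ 4 / 128 \<le> \<dots>" by (simp add: eval_nat_numeral)
  moreover have "U \<union> U' \<subseteq> X" using U by (auto simp: U'_def)
  ultimately show ?thesis using VV by blast
qed

section \<open>Closed walks through prescribed vertices\<close>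

lemma pick_link:
  assumes V: "V \<subseteq> X" and b: "\<eta> \<le> avg X (\<lambda>x. pr X (\<lambda>y. x \<in> V \<and> y \<in> V \<and> link H b x y))"
    and \<sigma>: "length Bs * \<sigma> < \<eta> / 2" "0 < \<eta>" and F: "small (length Bs) F"
  shows "\<exists>x\<in>V. \<exists>y\<in>V. link H b x y \<and> set x \<inter> F = {} \<and> set y \<inter> (F \<union> set x) = {}"
proof -
  let ?Q = "\<lambda>x. pr X (\<lambda>y. x \<in> V \<and> y \<in> V \<and> link H b x y)"
  \<comment> \<open>Choosing \<open>x\<close> first, with many partners left, allows
    \<open>y\<close> to avoid \<open>x\<close> as well.\<close>
  have "\<eta> / 2 \<le> pr X (\<lambda>x. \<eta> / 2 \<le> ?Q x)"
    using X \<sigma> b by (intro pr_markov pr_le_1) auto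
  then obtain x where x: "x \<in> X" "\<eta> / 2 \<le> ?Q x" "set x \<inter> F = {}"
    using ex_avoiding_small[OF F, of "\<lambda>x. \<eta> / 2 \<le> ?Q x"] \<sigma>(1) by auto
  have "small 0 (F \<union> set x)" using F length_listset[OF x(1)] by (intro small_Un) auto
  then obtain y where "x \<in> V" "y \<in> V" "link H b x y" "set y \<inter> (F \<union> set x) = {}"
    using ex_avoiding_small[of 0 "F \<union> set x" "\<lambda>y. x \<in> V \<and> y \<in> V \<and> link H b x y"] \<sigma>(1) x(2)
    by auto
  then show ?thesis using x(3) by blast
qed

text \<open>A long walk visits the prescribed vertices \<open>B\<close> one after the other, joined by
  bounded connections.\<close>

lemma ex_path_through:
  assumes V: "V \<subseteq> X" "\<And>x y. x \<in> V \<Longrightarrow> y \<in> V \<Longrightarrow> rconn 5 x y"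
    and \<sigma>: "length Bs * \<sigma> < \<eta> / 2" "0 < \<eta>"
    and B: "finite B" "B \<noteq> {}" "\<And>b. b \<in> B \<Longrightarrow> \<eta> \<le> avg X (\<lambda>x. pr X (\<lambda>y. x \<in> V \<and> y \<in> V \<and> link H b x y))"
    and F: "small (9 * Suc (length Bs) * Suc (card B)) F" "B \<inter> F = {}"
  shows "\<exists>x ps d y. x \<in> V \<and> y \<in> V \<and> walk H x ps d y \<and> (\<forall>z\<in>snd ` set ps. length z = length Bs) \<and>
    distinct (x @ flat ps @ [d] @ y) \<and> set (x @ flat ps @ [d] @ y) \<inter> F = {} \<and>
    B \<subseteq> insert d (fst ` set ps) \<and> set (x @ flat ps @ [d] @ y) \<subseteq> B \<union> D \<union> \<Union>(set Bs) \<and>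
    length (x @ flat ps @ [d] @ y) \<le> 8 * Suc (length Bs) * card B"
  using B F
proof (induction B arbitrary: F rule: finite_ne_induct)
  case (singleton b)
  have len: "\<And>x. x \<in> V \<Longrightarrow> length x = length Bs" "\<And>x. x \<in> V \<Longrightarrow> set x \<subseteq> \<Union>(set Bs)"
    using V length_listset set_listset by blast+
  have "small (length Bs) F" using singleton.prems(2) by (rule small_mono) simp
  from pick_link[OF V(1) singleton.prems(1) \<sigma> this, OF singletonI] obtain x y where
    xy: "x \<in> V" "y \<in> V" "link H b x y" "set x \<inter> F = {}" "set y \<inter> (F \<union> set x) = {}" by blast
  show ?case
    using xy linkD[OF xy(3)] len[OF xy(1)] len[OF xy(2)] singleton.prems(3)
    by (intro exI[of _ x] exI[of _ "[]"] exI[of _ b] exI[of _ y]) auto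
next
  case (insert b B)
  let ?m = "length Bs"
  have len: "\<And>x. x \<in> V \<Longrightarrow> length x = ?m" "\<And>x. x \<in> V \<Longrightarrow> set x \<subseteq> \<Union>(set Bs)"
    using V length_listset set_listset by blast+
  have cB: "card (insert b B) = Suc (card B)" using insert by simp
  \<comment> \<open>The path through \<open>B\<close> must not run into \<open>b\<close>, which is
    visited last; so \<open>b\<close> is forbidden in the induction hypothesis.\<close>
  have "small (9 * Suc ?m * Suc (card B)) (F \<union> set [b])"
    using insert.prems(2) unfolding cB by (rule small_Un) simp
  moreover have "B \<inter> (F \<union> set [b]) = {}" using insert by auto
  ultimately obtain x ps d y where P: "x \<in> V" "y \<in> V" "walk H x ps d y"
    "\<forall>z\<in>snd ` set ps. length z = ?m" "distinct (x @ flat ps @ [d] @ y)"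
    "set (x @ flat ps @ [d] @ y) \<inter> (F \<union> set [b]) = {}"
    "B \<subseteq> insert d (fst ` set ps)" "set (x @ flat ps @ [d] @ y) \<subseteq> B \<union> D \<union> \<Union>(set Bs)"
    "length (x @ flat ps @ [d] @ y) \<le> 8 * Suc ?m * card B"
    using insert.IH[of "F \<union> set [b]"] insert.prems(1) by blast
  define S where "S = x @ flat ps @ [d] @ y"
  note PS = P(5,6)[folded S_def]
  have lS: "length S \<le> 8 * Suc ?m * card B" using P(9) by (simp only: S_def)
  have s1: "small (?m + (?m + 6 * Suc ?m)) (F \<union> set (b # S))"
    using insert.prems(2) unfolding cB
    by (rule small_Un) (use lS in \<open>simp add: algebra_simps\<close>)
  have "small ?m (F \<union> set (b # S))" using s1 by (rule small_mono) simp
  from pick_link[OF V(1) insert.prems(1) \<sigma> this, OF insertI1] obtain x' y' where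
    xy: "x' \<in> V" "y' \<in> V" "link H b x' y'" "set x' \<inter> (F \<union> set (b # S)) = {}"
    "set y' \<inter> (F \<union> set (b # S) \<union> set x') = {}" by blast
  have "small (Suc 5 * Suc ?m) (F \<union> set (b # S) \<union> set (x' @ y'))"
    using s1 by (rule small_Un) (use len[OF xy(1)] len[OF xy(2)] in simp)
  then obtain qs e where Q: "gwalk (F \<union> set (b # S) \<union> set (x' @ y')) 5 y qs e x'"
    using V(2)[OF P(2) xy(1)] unfolding rconn_def by blast
  define ps' where "ps' = ps @ (d, y) # qs @ [(e, x')]"
  have wl: "walk H x ps' b y'"
    using walk_append[OF P(3) walk_append[of H y qs e x' "[]" b y']] Q xy(3)
    by (simp add: ps'_def gwalk_def)
  have list: "x @ flat ps' @ [b] @ y' = S @ flat qs @ e # x' @ b # y'"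
    by (simp add: ps'_def S_def)
  \<comment> \<open>Added are at most five tuples with their connectors, one more connector,
    \<open>x'\<close>, \<open>b\<close> and \<open>y'\<close>: with m-tuples, at most 7(m+1)
    vertices, within the 8(m+1) allowed.\<close>
  have "length (x @ flat ps' @ [b] @ y') \<le> 8 * Suc ?m * card (insert b B)"
    unfolding list cB using lS gwalk_length[OF Q] len[OF xy(1)] len[OF xy(2)] by simp
  moreover have "distinct (x @ flat ps' @ [b] @ y')"
    unfolding list using PS Q xy linkD[OF xy(3)] len[OF xy(1)] len[OF xy(2)]
    by (auto simp: gwalk_def)
  moreover have "set (x @ flat ps' @ [b] @ y') \<inter> F = {}"
    unfolding list using P(6) Q xy insert.prems(3) by (auto simp: S_def gwalk_def)
  moreover have "insert b B \<subseteq> insert b (fst ` set ps')"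
    using P(7) by (auto simp: ps'_def)
  moreover have "set (x @ flat ps' @ [b] @ y') \<subseteq> insert b B \<union> D \<union> \<Union>(set Bs)"
    unfolding list using P(8) Q len[OF xy(1)] len[OF xy(2)] by (auto simp: S_def gwalk_def)
  moreover have "\<forall>z\<in>snd ` set ps'. length z = ?m"
    using P(4) Q len[OF P(2)] len[OF xy(1)] by (auto simp: ps'_def gwalk_def)
  ultimately show ?case using wl P(1) xy(2) by blast
qed

text \<open>One more robust connection leads from the end of the path back to its start. It raises
  the factor 8 to 14 and makes \<open>ps\<close> nonempty.\<close>

lemma ex_closed_walk_through:
  assumes V: "V \<subseteq> X" "\<And>x y. x \<in> V \<Longrightarrow> y \<in> V \<Longrightarrow> rconn 5 x y"
    and \<sigma>: "length Bs * \<sigma> < \<eta> / 2" "0 < \<eta>"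
    and B: "finite B" "B \<noteq> {}" "\<And>b. b \<in> B \<Longrightarrow> \<eta> \<le> avg X (\<lambda>x. pr X (\<lambda>y. x \<in> V \<and> y \<in> V \<and> link H b x y))"
    and F: "small (9 * Suc (length Bs) * Suc (card B)) F" "B \<inter> F = {}"
  shows "\<exists>x ps d. walk H x ps d x \<and> length x = length Bs \<and> ps \<noteq> [] \<and>
    (\<forall>z\<in>snd ` set ps. length z = length Bs) \<and>
    distinct (x @ flat ps @ [d]) \<and> set (x @ flat ps @ [d]) \<inter> F = {} \<and>
    B \<subseteq> insert d (fst ` set ps) \<and> set (x @ flat ps @ [d]) \<subseteq> B \<union> D \<union> \<Union>(set Bs) \<and>
    length (x @ flat ps @ [d]) \<le> 14 * Suc (length Bs) * card B"
proof -
  let ?m = "length Bs"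
  have len: "\<And>x. x \<in> V \<Longrightarrow> length x = ?m"
    using V length_listset by blast
  obtain x ps d y where P: "x \<in> V" "y \<in> V" "walk H x ps d y"
    "\<forall>z\<in>snd ` set ps. length z = ?m" "distinct (x @ flat ps @ [d] @ y)"
    "set (x @ flat ps @ [d] @ y) \<inter> F = {}"
    "B \<subseteq> insert d (fst ` set ps)" "set (x @ flat ps @ [d] @ y) \<subseteq> B \<union> D \<union> \<Union>(set Bs)"
    "length (x @ flat ps @ [d] @ y) \<le> 8 * Suc ?m * card B"
    using ex_path_through[OF assms] by blast
  define S where "S = x @ flat ps @ [d] @ y"
  note PS = P(5,6)[folded S_def]
  have lS: "length S \<le> 8 * Suc ?m * card B" using P(9) by (simp only: S_def)
  have "small (Suc 5 * Suc ?m) (F \<union> set S)"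
    using F(1) by (rule small_Un) (use lS in \<open>simp add: algebra_simps\<close>)
  then obtain qs e where Q: "gwalk (F \<union> set S) 5 y qs e x"
    using V(2)[OF P(2) P(1)] unfolding rconn_def by blast
  define ps' where "ps' = ps @ (d, y) # qs"
  have wl: "walk H x ps' e x"
    using walk_append[OF P(3)] Q by (simp add: ps'_def gwalk_def)
  have list: "x @ flat ps' @ [e] = S @ flat qs @ [e]"
    by (simp add: ps'_def S_def)
  define q where "q = Suc ?m * card B"
  have "1 \<le> card B" using B by (simp add: Suc_leI card_gt_0_iff)
  then have "Suc ?m * 1 \<le> q" unfolding q_def by (rule mult_le_mono2)
  then have "Suc ?m \<le> q" by simp
  moreover have "length S \<le> 8 * q" using lS by (simp only: q_def mult.assoc)
  moreover have "length (x @ flat ps' @ [e]) = length S + length (flat qs) + 1"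
    unfolding list by simp
  moreover have "5 * Suc ?m \<le> 5 * q" "1 \<le> q" using \<open>Suc ?m \<le> q\<close> by simp_all
  ultimately have "length (x @ flat ps' @ [e]) \<le> 14 * q"
    using gwalk_length[OF Q] by linarith
  then have "length (x @ flat ps' @ [e]) \<le> 14 * Suc ?m * card B"
    by (simp only: q_def mult.assoc)
  moreover have "distinct (x @ flat ps' @ [e])"
    unfolding list using PS Q by (auto simp: gwalk_def)
  moreover have "set (x @ flat ps' @ [e]) \<inter> F = {}"
    unfolding list using P(6) Q by (auto simp: S_def gwalk_def)
  moreover have "B \<subseteq> insert e (fst ` set ps')"
    using P(7) by (auto simp: ps'_def)
  moreover have "set (x @ flat ps' @ [e]) \<subseteq> B \<union> D \<union> \<Union>(set Bs)"
    unfolding list using P(8) Q by (auto simp: S_def gwalk_def)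
  moreover have "\<forall>z\<in>snd ` set ps'. length z = ?m"
    using P(4) Q len[OF P(2)] by (auto simp: ps'_def gwalk_def)
  moreover have "ps' \<noteq> []" by (simp add: ps'_def)
  ultimately show ?thesis using wl len[OF P(1)] by blast
qed

end

section \<open>Closed walks and tight cycles\<close>

text \<open>The cyclic vertex list of a closed walk, with some connectors deleted.\<close>

fun cycle_list :: "('a \<Rightarrow> bool) \<Rightarrow> 'a list \<Rightarrow> ('a \<times> 'a list) list \<Rightarrow> 'a \<Rightarrow> 'a list" where
  "cycle_list K x [] d = x @ (if K d then [d] else [])"
| "cycle_list K x ((e, z) # ps) d = x @ (if K e then [e] else []) @ cycle_list K z ps d"

lemma set_cycle_list:
  assumes "distinct (x @ flat ps @ [d])"
  shows "set (cycle_list K x ps d) =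
    set (x @ flat ps @ [d]) - {e \<in> insert d (fst ` set ps). \<not> K e}"
  using assms
proof (induction ps arbitrary: x)
  case Nil then show ?case by auto
next
  case (Cons p ps)
  obtain e z where p: "p = (e, z)" by (cases p)
  have "fst ` set ps \<subseteq> set (flat ps)" by (force simp: flat_def)
  then show ?case using Cons.prems Cons.IH[of z] by (auto simp: p)
qed

lemma distinct_cycle_list:
  "distinct (x @ flat ps @ [d]) \<Longrightarrow> distinct (cycle_list K x ps d)"
proof (induction ps arbitrary: x)
  case Nil then show ?case by auto
next
  case (Cons p ps)
  obtain e z where p: "p = (e, z)" by (cases p)
  show ?case using Cons.prems Cons.IH[of z] set_cycle_list[of z ps d K] by (auto simp: p)
qed

lemma length_cycle_list:
  assumes "\<forall>z\<in>snd ` set ps. length z = m" "length x = m"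
  shows "Suc (length ps) * m \<le> length (cycle_list K x ps d)"
    and "(\<And>e. K e) \<Longrightarrow> length (cycle_list K x ps d) = Suc (length ps) * Suc m"
  using assms by (induction ps arbitrary: x; force)+

text \<open>A window starting at position \<open>i\<close> reaches at most the first
  \<open>i\<close> entries of \<open>z\<close>, so the mixture \<open>take i z @ drop i x\<close>
  together with \<open>e\<close> contains it. The list \<open>c\<close> is empty if the connector
  was deleted; the window may then be no longer than a tuple.\<close>

lemma window_subset:
  assumes "link H e x z" "length x = m" "length z = m" "c = [] \<or> c = [e]"
    and "k \<le> m + length c" "i < m + length c"
  shows "\<exists>u. length u = m \<and> insert e (set u) \<in> H \<and> set (take k (drop i (x @ c @ z @ rest))) \<subseteq> insert e (set u)"
proof -
  let ?u = "take i z @ drop i x"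
  have "?u \<in> mixes x z" using assms by (intro take_drop_in_mixes) simp
  then have u: "insert e (set ?u) \<in> H" using assms(1) unfolding link_def by blast
  have im: "i \<le> m" using assms(4,6) by auto
  have "take k (drop i (x @ c @ z @ rest)) = take k (drop i (x @ c)) @ take (k - (m + length c - i)) (z @ rest)"
  proof -
    have "drop i (x @ c @ z @ rest) = drop i (x @ c) @ z @ rest"
      using assms(2,6) drop_append[of i "x @ c" "z @ rest"] by simp
    moreover have "length (drop i (x @ c)) = m + length c - i" using assms(2) by simp
    ultimately show ?thesis by (simp only: take_append)
  qed
  moreover have "set (take k (drop i (x @ c))) \<subseteq> insert e (set (drop i x))"
    using assms(4) set_take_subset[of k "drop i (x @ c)"] set_drop_subset[of "i - length x" c] by auto
  moreover have "set (take (k - (m + length c - i)) (z @ rest)) \<subseteq> set (take i z)"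
  proof -
    have le: "k - (m + length c - i) \<le> i" using assms(5) by linarith
    then have "set (take (k - (m + length c - i)) (z @ rest)) \<subseteq> set (take i (z @ rest))"
      by (rule set_take_subset_set_take)
    then show ?thesis using im assms(3) by simp
  qed
  ultimately have "set (take k (drop i (x @ c @ z @ rest))) \<subseteq> insert e (set ?u)" by auto
  with u show ?thesis using im assms(2,3) by (intro exI[of _ ?u]) auto
qed

text \<open>The two regimes of the proof: windows no longer than a tuple tolerate any deletion of
  connectors (absorbing), windows longer by one need all of them (covering inside a colour class).
  Appending \<open>y\<close> supplies the windows that run over the end.\<close>

lemma cycle_list_window:
  assumes "walk H x ps d y" "\<forall>z\<in>snd ` set ps. length z = m" "length x = m" "length y = m"
    and "k \<le> m \<or> k = Suc m \<and> (\<forall>e. K e)" "i < length (cycle_list K x ps d)"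
  shows "\<exists>e u. length u = m \<and> insert e (set u) \<in> H \<and>
    set (take k (drop i (cycle_list K x ps d @ y))) \<subseteq> insert e (set u)"
  using assms
proof (induction H x ps d y arbitrary: i rule: walk.induct)
  case (1 H x d y)
  define c where "c = (if K d then [d] else [])"
  have L: "cycle_list K x [] d @ y = x @ c @ y @ []" by (simp add: c_def)
  have "k \<le> m + length c" "c = [] \<or> c = [d]" "i < m + length c" "link H d x y"
    using 1 by (auto simp: c_def)
  then show ?case
    unfolding L using 1 window_subset[of H d x y m c k i "[]"] by blast
next
  case (2 H x e z ps d y)
  define c where "c = (if K e then [e] else [])"
  have z: "length z = m" using 2 by auto
  obtain rest where rest: "cycle_list K z ps d @ y = z @ rest" by (cases ps) auto
  have L: "cycle_list K x ((e, z) # ps) d @ y = x @ c @ cycle_list K z ps d @ y"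
    by (simp add: c_def)
  show ?case
  proof (cases "i < m + length c")
    case True
    have "link H e x z" using 2 by simp
    moreover have "k \<le> m + length c" using 2 by (auto simp: c_def)
    moreover have "c = [] \<or> c = [e]" by (simp add: c_def)
    ultimately show ?thesis
      unfolding L rest using 2 z True window_subset[of H e x z m c k i rest] by blast
  next
    case False
    define j where "j = i - (m + length c)"
    have "j < length (cycle_list K z ps d)" using 2 False by (auto simp: j_def c_def)
    moreover have "drop i (x @ c @ cycle_list K z ps d @ y) = drop j (cycle_list K z ps d @ y)"
      using False 2 by (simp add: j_def)
    ultimately show ?thesis unfolding L using 2 z by auto
  qed
qed

text \<open>A window of length at most \<open>Suc (length x)\<close> overshoots the end by at most
  \<open>length x\<close> entries, so one repetition of the initial part \<open>x\<close> unrolls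
  the cycle far enough.\<close>

lemma cyclic_window_eq_take:
  assumes "vs = x @ rest" "i < length vs" "k \<le> Suc (length x)"
  shows "cyclic_window k vs i = set (take k (drop i (vs @ x)))"
proof -
  have nth: "(vs @ x) ! (i + j) = vs ! ((i + j) mod length vs)" if "j < k" for j
  proof (cases "i + j < length vs")
    case True
    then show ?thesis by (simp add: nth_append)
  next
    case False
    define l where "l = i + j - length vs"
    have l: "i + j = length vs + l" "l < length x" using False assms that by (auto simp: l_def)
    then have "l < length vs" using assms by simp
    then have "(i + j) mod length vs = l" using l by simp
    moreover have "(vs @ x) ! (i + j) = x ! l" unfolding l by simp
    moreover have "vs ! l = x ! l" using assms(1) l(2) by (simp add: nth_append)
    ultimately show ?thesis by simp
  qed
  have "take k (drop i L) = map (\<lambda>j. L ! (i + j)) [0..<k]" if "i + k \<le> length L" for L :: "'a list"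
    using that by (intro nth_equalityI) auto
  moreover have "i + k \<le> length (vs @ x)" using assms(2,3) by simp
  ultimately have "take k (drop i (vs @ x)) = map (\<lambda>j. (vs @ x) ! (i + j)) [0..<k]"
    by blast
  also have "\<dots> = map (\<lambda>j. vs ! ((i + j) mod length vs)) [0..<k]"
    using nth by (intro map_cong) auto
  finally show ?thesis by (auto simp: cyclic_window_def)
qed

lemma card_cyclic_window:
  assumes "distinct vs" "k \<le> length vs"
  shows "card (cyclic_window k vs i) = k"
proof (cases "vs = []")
  case True
  then show ?thesis using assms by (simp add: cyclic_window_def)
next
  case False
  let ?n = "length vs"
  have "inj_on (\<lambda>j. vs ! ((i + j) mod ?n)) {..<k}"
  proof (rule inj_onI)
    fix j j' assume j: "j \<in> {..<k}" "j' \<in> {..<k}" "vs ! ((i + j) mod ?n) = vs ! ((i + j') mod ?n)"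
    then have "(i + j) mod ?n = (i + j') mod ?n"
      using nth_eq_iff_index_eq[OF assms(1)] False by simp
    then obtain q q' where "i + j + ?n * q = i + j' + ?n * q'"
      by (auto simp: nat_mod_eq_iff)
    then have "j + ?n * q = j' + ?n * q'" by simp
    then have "j mod ?n = j' mod ?n" by (metis nat_mod_eq_iff)
    then show "j = j'" using j assms(2) by simp
  qed
  then show ?thesis by (simp add: cyclic_window_def card_image)
qed

lemma tight_cycle_edges_cycle_list:
  assumes "walk H x ps d x" "\<forall>z\<in>snd ` set ps. length z = m" "length x = m"
    and "k \<le> m \<or> k = Suc m \<and> (\<forall>e. K e)" "distinct (x @ flat ps @ [d])" "ps \<noteq> []"
    and "f \<in> tight_cycle_edges k (cycle_list K x ps d)"
  shows "\<exists>e u. length u = m \<and> insert e (set u) \<in> H \<and> f \<subseteq> insert e (set u) \<and> card f = k"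
proof -
  let ?vs = "cycle_list K x ps d"
  obtain rest where rest: "?vs = x @ rest" by (cases ps) auto
  obtain i where i: "i < length ?vs" "f = cyclic_window k ?vs i"
    using assms(7) by (auto simp: tight_cycle_edges_def)
  have "f = set (take k (drop i (?vs @ x)))"
    unfolding i(2) using rest i(1) assms(3,4) by (intro cyclic_window_eq_take) auto
  moreover have "k \<le> length ?vs"
  proof (cases "k \<le> m")
    case True
    then show ?thesis using rest assms(3) by simp
  next
    case False
    then have "k = Suc m" "\<And>e. K e" using assms(4) by auto
    then show ?thesis using length_cycle_list(2)[of ps m x K d] assms(2,3) by simp
  qed
  then have "card f = k"
    unfolding i(2) using assms(5) by (intro card_cyclic_window distinct_cycle_list)
  ultimately show ?thesis
    using cycle_list_window[OF assms(1,2,3,3,4) i(1)] by auto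
qed

section \<open>Absorbing cycles\<close>

definition admissible :: "nat \<Rightarrow> nat \<Rightarrow> nat \<Rightarrow> 'a set \<Rightarrow> 'a set set \<Rightarrow> ('a set \<Rightarrow> nat) \<Rightarrow> bool" where
  "admissible k r \<alpha> V E col \<longleftrightarrow> k_graph k V E \<and> edge_colouring r E col \<and>
     (\<forall>S\<subseteq>V. card S = Suc \<alpha> \<longrightarrow> (\<exists>e\<in>E. e \<subseteq> S))"

definition cycle_set :: "nat \<Rightarrow> 'a set \<Rightarrow> 'a set set \<Rightarrow> ('a set \<Rightarrow> nat) \<Rightarrow> 'a set \<Rightarrow> bool" where
  "cycle_set k V E col C \<longleftrightarrow> (\<exists>vs. set vs = C \<and> mono_tight_cycle k V E col vs)"

definition mono_cliques :: "nat \<Rightarrow> 'a set \<Rightarrow> 'a set set \<Rightarrow> ('a set \<Rightarrow> nat) \<Rightarrow> nat \<Rightarrow> nat \<Rightarrow> 'a set set" where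
  "mono_cliques k V E col t c = {T. T \<subseteq> V \<and> card T = t \<and> (\<forall>f\<subseteq>T. card f = k \<longrightarrow> f \<in> E \<and> col f = c)}"

lemma card_edge: "k_graph k V E \<Longrightarrow> e \<in> E \<Longrightarrow> finite e \<and> e \<subseteq> V \<and> card e = k"
  unfolding k_graph_def nsets_def by blast

text \<open>No connector is dropped, and a window is contained in an edge of the same size, hence
  equal to it.\<close>

lemma cycle_set_closed_walk:
  assumes "walk H x ps d x" "\<forall>z\<in>snd ` set ps. length z = m" "length x = m" "ps \<noteq> []"
    and "distinct (x @ flat ps @ [d])" "set (x @ flat ps @ [d]) \<subseteq> V"
    and G: "k_graph (Suc m) V E" and H: "H = {e \<in> E. col e = c}"
  shows "cycle_set (Suc m) V E col (set (x @ flat ps @ [d]))"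
proof -
  let ?vs = "cycle_list (\<lambda>_. True) x ps d"
  have set: "set ?vs = set (x @ flat ps @ [d])" using set_cycle_list[OF assms(5)] by auto
  have "length ?vs = Suc (length ps) * Suc m"
    using assms(2,3) by (intro length_cycle_list(2)) auto
  \<comment> \<open>At least two tuples occur, and this makes the cycle longer than its uniformity,
    as the definition of a cycle demands.\<close>
  moreover have "Suc (length ps) * Suc m \<ge> 2 * Suc m"
    using assms(4) by (intro mult_le_mono1) (cases ps, auto)
  moreover have "Suc m < 2 * Suc m" by simp
  ultimately have "Suc m < length ?vs" by (metis less_le_trans)
  moreover have "f \<in> H" if f: "f \<in> tight_cycle_edges (Suc m) ?vs" for f
  proof -
    obtain e u where eu: "length u = m" "insert e (set u) \<in> H" "f \<subseteq> insert e (set u)" "card f = Suc m"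
      using tight_cycle_edges_cycle_list[OF assms(1-3) _ assms(5,4) f] by auto
    have "card (insert e (set u)) = Suc m" using eu(2) H card_edge[OF G] by blast
    then have "f = insert e (set u)" using eu by (intro card_subset_eq) auto
    then show ?thesis using eu by simp
  qed
  ultimately show ?thesis
    unfolding cycle_set_def mono_tight_cycle_def
    using set assms(6) distinct_cycle_list[OF assms(5)] H by (intro exI[of _ ?vs]) auto
qed

text \<open>Since the tuples of a walk in the hypergraph of monochromatic \<open>(k + 1)\<close>-cliques have \<open>k\<close> entries,
  a window of length \<open>k\<close> stays inside a clique after deleting arbitrary connectors.\<close>

lemma cycle_set_clique_walk:
  assumes "walk H x ps d x" "\<forall>z\<in>snd ` set ps. length z = k" "length x = k" "ps \<noteq> []"
    and "distinct (x @ flat ps @ [d])" "set (x @ flat ps @ [d]) \<subseteq> V"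
    and k: "0 < k" and H: "H = mono_cliques k V E col (Suc k) c"
    and Y: "Y \<subseteq> insert d (fst ` set ps)"
  shows "cycle_set k V E col (set (x @ flat ps @ [d]) - Y)"
proof -
  let ?vs = "cycle_list (\<lambda>e. e \<notin> Y) x ps d"
  have set: "set ?vs = set (x @ flat ps @ [d]) - Y" using set_cycle_list[OF assms(5)] Y by auto
  have "Suc (length ps) * k \<le> length ?vs"
    using assms(2,3) by (intro length_cycle_list(1)) auto
  moreover have "Suc (length ps) * k \<ge> 2 * k"
    using assms(4) by (intro mult_le_mono1) (cases ps, auto)
  ultimately have "k < length ?vs" using k by linarith
  moreover have "f \<in> E \<and> col f = c" if f: "f \<in> tight_cycle_edges k ?vs" for f
  proof -
    obtain e u where "insert e (set u) \<in> H" "f \<subseteq> insert e (set u)" "card f = k"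
      using tight_cycle_edges_cycle_list[OF assms(1-3) _ assms(5,4) f] by auto
    then show ?thesis by (auto simp: H mono_cliques_def)
  qed
  ultimately show ?thesis
    unfolding cycle_set_def mono_tight_cycle_def
    using set assms(6) distinct_cycle_list[OF assms(5)] by (intro exI[of _ ?vs]) auto
qed

section \<open>Supersaturation of monochromatic cliques\<close>

lemma ex_mono_clique:
  "\<exists>N. \<forall>V E col S. admissible k r \<alpha> V E col \<longrightarrow> S \<subseteq> V \<longrightarrow> card S = N \<longrightarrow> finite S \<longrightarrow>
     (\<exists>T\<subseteq>S. \<exists>c<r. T \<in> mono_cliques k V E col t c)"
proof -
  \<comment> \<open>Ramsey is used with r + 1 colours, the extra colour \<open>r\<close> being that
    of the non-edges. A homogeneous set of size \<open>q\<close> has room for a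
    \<open>t\<close>-clique, and also for \<alpha> + 1 vertices, which excludes colour
    \<open>r\<close>.\<close>
  define q where "q = t + Suc \<alpha>"
  obtain N :: nat where N: "partn_lst {..<N} (replicate (Suc r) q) k" using ramsey_full[of "replicate (Suc r) q" k] by (elim exE)
  have "\<exists>T\<subseteq>S. \<exists>c<r. T \<in> mono_cliques k V E col t c"
    if G: "admissible k r \<alpha> V E col" and S: "S \<subseteq> V" "card S = N" "finite S" for V :: "'a set" and E col S
  proof -
    obtain h where h: "bij_betw h {..<N} S"
      using ex_bij_betw_nat_finite[OF S(3)] S(2) by (auto simp: atLeast0LessThan)
    define f where "f e = (if h ` e \<in> E then col (h ` e) else r)" for e
    have "f \<in> nsets {..<N} k \<rightarrow> {..<Suc r}"
      using G by (auto simp: f_def admissible_def edge_colouring_def less_Suc_eq)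
    then obtain i H where iH: "i < Suc r" "H \<in> nsets {..<N} q" "f ` nsets H k \<subseteq> {i}"
      using partn_lstE[OF N, of f "Suc r"] by (metis length_replicate nth_replicate)
    have inj: "inj_on h H" and hH: "h ` H \<subseteq> S" "card (h ` H) = q" "finite H"
    proof -
      have "H \<subseteq> {..<N}" "finite H" "card H = q" using iH(2) by (auto simp: nsets_def)
      then show "inj_on h H" "h ` H \<subseteq> S" "finite H" "card (h ` H) = q"
        using h inj_on_subset[of h "{..<N}" H] by (auto simp: bij_betw_def card_image)
    qed
    have col: "(if e \<in> E then col e else r) = i" if e: "e \<subseteq> h ` H" "card e = k" for e
    proof -
      obtain e' where e': "e' \<subseteq> H" "e = h ` e'" using e(1) by (auto simp: subset_image_iff)
      have "card e' = k" using e e' inj_on_subset[OF inj] by (simp add: card_image)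
      moreover have "finite e'" using e'(1) hH(3) by (rule finite_subset)
      ultimately have "e' \<in> nsets H k" using e' by (simp add: nsets_def)
      then have "f e' = i" using iH(3) by blast
      then show ?thesis unfolding f_def e'(2) .
    qed
    have "i \<noteq> r"
    proof
      assume "i = r"
      obtain S' where S': "S' \<subseteq> h ` H" "card S' = Suc \<alpha>"
        using obtain_subset_with_card_n[of "Suc \<alpha>" "h ` H"] hH(2) by (auto simp: q_def)
      then obtain e where e: "e \<in> E" "e \<subseteq> S'"
        using G S hH(1) unfolding admissible_def by (meson order_trans)
      have "card e = k" "col e < r"
        using G e by (auto simp: admissible_def edge_colouring_def dest: card_edge)
      then show False using col[of e] e S' \<open>i = r\<close> by auto
    qed
    then have "i < r" using iH(1) by simp
    obtain T where T: "T \<subseteq> h ` H" "card T = t"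
      using obtain_subset_with_card_n[of t "h ` H"] hH(2) by (auto simp: q_def)
    have "T \<in> mono_cliques k V E col t i"
      unfolding mono_cliques_def
    proof (intro CollectI conjI allI impI)
      fix f assume "f \<subseteq> T" "card f = k"
      then have "(if f \<in> E then col f else r) = i" using T by (intro col) auto
      then show "f \<in> E" "col f = i" using \<open>i < r\<close> by (auto split: if_splits)
    qed (use T hH S in auto)
    then show ?thesis using T hH(1) \<open>i < r\<close> by blast
  qed
  then show ?thesis by blast
qed

lemma pr_not_distinct:
  assumes "finite W" "W \<noteq> {}"
  shows "pr (listset (replicate n W)) (\<lambda>x. \<not> distinct x) \<le> real (n * n) / card W"
proof (induction n)
  case 0 then show ?case by (simp add: avg_def)
next
  case (Suc n)
  let ?X = "listset (replicate n W)"
  have cW: "0 < card W" using assms by (simp add: card_gt_0_iff)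
  have "pr (listset (replicate (Suc n) W)) (\<lambda>x. \<not> distinct x)
      = avg W (\<lambda>a. pr ?X (\<lambda>x. set x \<inter> {a} \<noteq> {} \<or> \<not> distinct x))"
    by (simp add: avg_listset_Cons del: listset.simps)
  also have "\<dots> \<le> avg W (\<lambda>a. n * (1 / card W) + real (n * n) / card W)"
  proof (intro avg_mono order_trans[OF pr_disj] add_mono Suc.IH)
    fix a assume "a \<in> W"
    have "card ({a} \<inter> W) \<le> card {a}" by (intro card_mono) auto
    then have "pr ?X (\<lambda>x. set x \<inter> {a} \<noteq> {}) \<le> length (replicate n W) * (1 / card W)"
      using assms cW by (intro pr_hit) (auto split: if_splits)
    then show "pr ?X (\<lambda>x. set x \<inter> {a} \<noteq> {}) \<le> n * (1 / card W)" by simp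
  qed
  also have "\<dots> = real (n + n * n) / card W" using assms by (simp add: add_divide_distrib)
  also have "\<dots> \<le> real (Suc n * Suc n) / card W" by (intro divide_right_mono) auto
  finally show ?case .
qed

text \<open>With \<open>N\<close> from \<open>ex_mono_clique\<close>, a random
  \<open>N\<close>-tuple has distinct entries with probability above 1/2, and then one of its 2^N
  subsequences is a monochromatic \<open>t\<close>-clique. Every subsequence of length
  \<open>t\<close> is a uniform \<open>t\<close>-tuple, so such a tuple is a clique with probability
  at least 1/(2 * 2^N), and some colour takes its share.\<close>

lemma ex_dense_mono_cliques:
  "\<exists>\<delta>>0. \<exists>n0. \<forall>V E col W. admissible k r \<alpha> V E col \<longrightarrow> W \<subseteq> V \<longrightarrow> n0 \<le> card W \<longrightarrow> finite W \<longrightarrow>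
     (\<exists>c<r. \<delta> \<le> pr (listset (replicate t W)) (\<lambda>x. set x \<in> mono_cliques k V E col t c))"
proof -
  obtain N where N: "\<And>(V :: 'a set) E col S. admissible k r \<alpha> V E col \<Longrightarrow> S \<subseteq> V \<Longrightarrow> card S = N \<Longrightarrow> finite S \<Longrightarrow>
     \<exists>T\<subseteq>S. \<exists>c<r. T \<in> mono_cliques k V E col t c"
    using ex_mono_clique[of k r \<alpha> t, where ?'a = 'a] by blast
  \<comment> \<open>A bound for \<open>r\<close> that is positive even if \<open>r\<close> is 0, fit
    for a denominator.\<close>
  have "real r \<le> real (Suc r) \<and> 0 < real (Suc r)" by simp
  then obtain q :: real where q: "r \<le> q" "0 < q" by blast
  define \<delta> :: real where "\<delta> = 1 / (2 * 2 ^ N * q)"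
  have "\<exists>c<r. \<delta> \<le> pr (listset (replicate t W)) (\<lambda>x. set x \<in> mono_cliques k V E col t c)"
    if G: "admissible k r \<alpha> V E col" and W: "W \<subseteq> V" "2 * (N * N) + 1 \<le> card W" "finite W"
    for V :: "'a set" and E col W
  proof (rule ccontr)
    let ?H = "mono_cliques k V E col t"
    assume contr: "\<not> ?thesis"
    have W0: "W \<noteq> {}" using W(2) by auto
    define Q where "Q y \<longleftrightarrow> length y = t \<and> (\<exists>c<r. set y \<in> ?H c)" for y
    define p where "p = pr (listset (replicate t W)) Q"
    have p: "p \<le> r * \<delta>"
    proof -
      have "p \<le> avg (listset (replicate t W)) (\<lambda>x. \<Sum>c<r. of_bool (set x \<in> ?H c))"
        unfolding p_def
      proof (rule avg_mono)
        fix x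
        show "of_bool (Q x) \<le> (\<Sum>c<r. of_bool (set x \<in> ?H c) :: real)"
        proof (cases "Q x")
          case True
          then obtain c where c: "c < r" "set x \<in> ?H c" by (auto simp: Q_def)
          have "(of_bool (set x \<in> ?H c) :: real) \<le> (\<Sum>c<r. of_bool (set x \<in> ?H c))"
            using c(1) by (intro member_le_sum) auto
          then show ?thesis using True c by simp
        qed (simp add: sum_nonneg)
      qed
      also have "\<dots> = (\<Sum>c<r. pr (listset (replicate t W)) (\<lambda>x. set x \<in> ?H c))" by (rule avg_sum)
      also have "\<dots> \<le> (\<Sum>c<r. \<delta>)" using contr by (intro sum_mono) force
      finally show ?thesis by simp
    qed
    let ?X = "listset (replicate N W)"
    have X: "finite ?X" "?X \<noteq> {}" using W W0 by (auto intro!: finite_listset listset_nonempty)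
    have "1 = pr ?X (\<lambda>x. distinct x \<or> \<not> distinct x)" using X by simp
    also have "\<dots> \<le> pr ?X distinct + pr ?X (\<lambda>x. \<not> distinct x)" by (rule pr_disj)
    also have "pr ?X (\<lambda>x. \<not> distinct x) \<le> real (N * N) / card W"
      by (rule pr_not_distinct[OF W(3) W0])
    also have "real (N * N) / card W < 1 / 2"
    proof -
      have "0 < card W" "real (2 * (N * N) + 1) \<le> card W" using W(2) by (linarith, simp only: of_nat_le_iff)
      then show ?thesis by (simp add: divide_less_eq)
    qed
    finally have "1 / 2 < pr ?X distinct" by simp
    also have "\<dots> \<le> pr ?X (\<lambda>x. \<exists>y\<in>set (subseqs x). Q y)"
    proof (rule pr_mono)
      fix x assume x: "x \<in> ?X" "distinct x"
      have "set x \<subseteq> V" using set_listset[OF x(1)] W(1) by (auto simp: set_replicate_conv_if split: if_splits)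
      moreover have "card (set x) = N" using x length_listset[OF x(1)] by (simp add: distinct_card)
      ultimately obtain T c where T: "T \<subseteq> set x" "c < r" "T \<in> ?H c" using N[OF G] by blast
      then have "T \<in> set ` set (subseqs x)" by (simp add: subseqs_powset)
      then obtain y where y: "y \<in> set (subseqs x)" "set y = T" by blast
      have "distinct y" using subseqs_distinctD[OF y(1) x(2)] .
      then have "length y = card T" using y by (simp add: distinct_card flip: y(2))
      then show "\<exists>y\<in>set (subseqs x). Q y" using y T by (intro bexI[of _ y]) (auto simp: Q_def mono_cliques_def)
    qed
    also have "\<dots> \<le> (\<Sum>Bs\<leftarrow>subseqs (replicate N W). pr (listset Bs) Q)"
      using W W0 by (intro pr_subseqs) auto
    also have "\<dots> \<le> (\<Sum>Bs\<leftarrow>subseqs (replicate N W). p)"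
    proof (rule sum_list_mono)
      fix Bs assume "Bs \<in> set (subseqs (replicate N W))"
      then have "set Bs \<in> set ` set (subseqs (replicate N W))" by blast
      then have "set Bs \<subseteq> {W}" unfolding subseqs_powset by (auto split: if_splits)
      then have Bs: "Bs = replicate (length Bs) W" by (intro replicate_eqI) auto
      show "pr (listset Bs) Q \<le> p"
      proof (cases "length Bs = t")
        case True
        then show ?thesis using Bs by (simp add: p_def)
      next
        case False
        have "pr (listset Bs) Q \<le> avg (listset Bs) (\<lambda>_. 0)"
          using False by (intro avg_mono) (auto simp: Q_def dest: length_listset)
        also have "\<dots> = 0" by (simp add: avg_def)
        also have "0 \<le> p" unfolding p_def by (rule pr_nonneg)
        finally show ?thesis .
      qed
    qed
    also have "\<dots> = 2 ^ N * p" by (simp add: sum_list_triv length_subseqs)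
    also have "\<dots> \<le> 2 ^ N * (r * \<delta>)" using p by (intro mult_left_mono) auto
    also have "\<dots> \<le> 2 ^ N * (q * \<delta>)"
      by (intro mult_left_mono mult_right_mono) (use q in \<open>auto simp: \<delta>_def\<close>)
    also have "\<dots> = 1 / 2" using q by (simp add: \<delta>_def)
    finally show False by simp
  qed
  moreover have "0 < \<delta>" using q by (simp add: \<delta>_def)
  ultimately show ?thesis by blast
qed

section \<open>Constants of the connecting argument\<close>

definition conn_density :: "nat \<Rightarrow> real \<Rightarrow> real" where
  "conn_density m \<delta> = blowup_density m \<delta> / 2"

text \<open>Half of the density of steps that \<open>ex_connected_set\<close> provides. The other
  half is lost in a Markov argument (absorbers) or to pairs connected before (connectors).\<close>

definition cover_density :: "nat \<Rightarrow> real \<Rightarrow> real" where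
  "cover_density m \<delta> = conn_density m \<delta> ^ 4 / 256"

text \<open>So many increments by \<open>cover_density\<close> exceed the total measure 1.\<close>

definition max_connectors :: "nat \<Rightarrow> real \<Rightarrow> nat" where
  "max_connectors m \<delta> = Suc (nat \<lceil>1 / cover_density m \<delta>\<rceil>)"

text \<open>A vertex below this threshold for each of at most \<open>max_connectors\<close>
  connectors has at most \<open>cover_density\<close> of its steps in all of them together.\<close>

definition cover_threshold :: "nat \<Rightarrow> real \<Rightarrow> real" where
  "cover_threshold m \<delta> = cover_density m \<delta> / max_connectors m \<delta>"

text \<open>The minimum serves direct steps, the composition of walks and the choice of a step
  through a prescribed vertex. It is divided by \<open>Suc m\<close> because each of
  \<open>m\<close> coordinates can be blocked in this proportion.\<close>

definition slack :: "nat \<Rightarrow> real \<Rightarrow> real" where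
  "slack m \<delta> = min (conn_density m \<delta>) (min (conn_density m \<delta> ^ 3 / 256) (cover_threshold m \<delta> / 4)) / Suc m"

lemma
  assumes "0 < \<delta>"
  shows cover_density_pos: "0 < cover_density m \<delta>"
    and cover_threshold_pos: "0 < cover_threshold m \<delta>"
    and max_connectors_gt: "1 < max_connectors m \<delta> * cover_density m \<delta>"
    and slack_pos: "0 < slack m \<delta>"
    and slack_le: "slack m \<delta> \<le> conn_density m \<delta>"
    and slack_bound: "m * slack m \<delta> < conn_density m \<delta> ^ 3 / 128"
      "m * slack m \<delta> < cover_threshold m \<delta> / 2" "m * slack m \<delta> < cover_density m \<delta> / 2"
proof -
  let ?\<rho> = "conn_density m \<delta>" and ?\<eta> = "cover_threshold m \<delta>" and ?\<kappa> = "cover_density m \<delta>"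
  define M where "M = min ?\<rho> (min (?\<rho> ^ 3 / 256) (?\<eta> / 4))"
  have \<rho>: "0 < ?\<rho>" using blowup_density_pos[OF assms] by (simp add: conn_density_def)
  then show \<kappa>: "0 < ?\<kappa>" by (simp add: cover_density_def)
  moreover have "0 < max_connectors m \<delta>" by (simp add: max_connectors_def)
  ultimately show \<eta>: "0 < ?\<eta>" by (simp add: cover_threshold_def)
  have "1 \<le> real (max_connectors m \<delta>)" unfolding max_connectors_def by linarith
  then have "?\<kappa> / max_connectors m \<delta> \<le> ?\<kappa> / 1"
    using \<kappa> by (intro divide_left_mono) auto
  then have \<eta>\<kappa>: "?\<eta> \<le> ?\<kappa>" by (simp add: cover_threshold_def)
  have "1 / ?\<kappa> \<le> real (nat \<lceil>1 / ?\<kappa>\<rceil>)" by (rule real_nat_ceiling_ge)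
  then have "1 / ?\<kappa> < max_connectors m \<delta>" unfolding max_connectors_def of_nat_Suc by linarith
  then show "1 < max_connectors m \<delta> * ?\<kappa>" using \<kappa> by (simp add: field_simps)
  have M: "0 < M" "M \<le> ?\<rho>" "M \<le> ?\<rho> ^ 3 / 256" "M \<le> ?\<eta> / 4"
    using \<rho> \<eta> by (auto simp: M_def)
  have s: "slack m \<delta> = M / Suc m" by (simp add: slack_def M_def)
  show "0 < slack m \<delta>" using M by (simp add: s)
  have "M / Suc m \<le> M / 1" using M by (intro divide_left_mono) auto
  then show "slack m \<delta> \<le> ?\<rho>" using M by (simp add: s)
  have "m * M \<le> Suc m * M" using M by (intro mult_right_mono) auto
  then have "m * slack m \<delta> \<le> M" by (simp add: s field_simps)
  moreover have "M < ?\<rho> ^ 3 / 128" using M(3) zero_less_power[OF \<rho>, of 3] by linarith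
  moreover have "M < ?\<eta> / 2" using M(4) \<eta> by linarith
  ultimately show "m * slack m \<delta> < ?\<rho> ^ 3 / 128" "m * slack m \<delta> < ?\<eta> / 2" "m * slack m \<delta> < ?\<kappa> / 2"
    using \<eta>\<kappa> by linarith+
qed

text \<open>The vertices of \<open>D\<close> have dense clique links, and those in \<open>B0\<close>
  also admit many steps inside the connected set. A small subset \<open>B\<close> of
  \<open>B0\<close> can thus be threaded as connectors of one closed walk, from which any of them
  may be dropped.\<close>

lemma ex_absorber:
  assumes k: "0 < k"
  shows "\<exists>\<epsilon>::real. 0 < \<epsilon> \<and> (\<exists>n0. \<forall>V E col W. admissible k r \<alpha> V E col \<longrightarrow> W \<subseteq> V \<longrightarrow> n0 \<le> card W \<longrightarrow> finite W \<longrightarrow>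
     (\<exists>A Z. A \<subseteq> Z \<and> Z \<subseteq> W \<and> \<epsilon> * card W \<le> card A \<and> (\<forall>Y\<subseteq>A. cycle_set k V E col (Z - Y))))"
proof -
  obtain \<delta> n1 where \<delta>: "0 < \<delta>" and dens: "\<And>(V :: 'a set) E col W. admissible k r \<alpha> V E col \<Longrightarrow> W \<subseteq> V \<Longrightarrow>
     n1 \<le> card W \<Longrightarrow> finite W \<Longrightarrow>
     \<exists>c<r. \<delta> \<le> pr (listset (replicate (Suc k) W)) (\<lambda>x. set x \<in> mono_cliques k V E col (Suc k) c)"
    using ex_dense_mono_cliques[of k r \<alpha> "Suc k", where ?'a = 'a] by blast
  define \<sigma> where "\<sigma> = slack k (\<delta> / 2)"
  define \<eta> where "\<eta> = cover_density k (\<delta> / 2)"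
  have \<delta>2: "0 < \<delta> / 2" using \<delta> by simp
  note const = slack_pos[OF \<delta>2, of k, folded \<sigma>_def] cover_density_pos[OF \<delta>2, of k, folded \<eta>_def]
    slack_le[OF \<delta>2, of k, folded \<sigma>_def] slack_bound(1,3)[OF \<delta>2, of k, folded \<sigma>_def \<eta>_def]
  \<comment> \<open>First term: the budget 9(k+1)(b+1) is at most 36(k+1) \<epsilon> |W| and must
    not exceed \<sigma> |D|, where |D| is at least \<delta> |W| / 2. Second term: b is at most 2
    \<epsilon> |W| and \<open>B0\<close> has at least \<eta> \<delta> |W| / 2 elements.\<close>
  define \<epsilon> where "\<epsilon> = min (\<sigma> * \<delta> / (72 * Suc k)) (\<eta> * \<delta> / 4)"
  have \<epsilon>0: "0 < \<epsilon>" using const \<delta> by (simp add: \<epsilon>_def)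
  have \<epsilon>\<sigma>: "36 * Suc k * \<epsilon> \<le> \<sigma> * (\<delta> / 2)"
  proof -
    have "36 * Suc k * \<epsilon> \<le> 36 * Suc k * (\<sigma> * \<delta> / (72 * Suc k))"
      unfolding \<epsilon>_def by (intro mult_left_mono) auto
    also have "\<dots> = \<sigma> * (\<delta> / 2)" by (simp add: field_simps)
    finally show ?thesis .
  qed
  \<comment> \<open>Gives \<epsilon> |W| at least 1, so rounding it up at most doubles it.\<close>
  define n0 where "n0 = n1 + nat \<lceil>1 / \<epsilon>\<rceil> + 1"
  have "\<exists>A Z. A \<subseteq> Z \<and> Z \<subseteq> W \<and> \<epsilon> * card W \<le> card A \<and> (\<forall>Y\<subseteq>A. cycle_set k V E col (Z - Y))"
    if G: "admissible k r \<alpha> V E col" and W: "W \<subseteq> V" "n0 \<le> card W" "finite W" for V :: "'a set" and E col W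
  proof -
    have cW: "n1 \<le> card W" "nat \<lceil>1 / \<epsilon>\<rceil> \<le> card W" "0 < card W"
      using W(2) unfolding n0_def by linarith+
    then have W0: "W \<noteq> {}" by auto
    have "1 / \<epsilon> \<le> real (nat \<lceil>1 / \<epsilon>\<rceil>)" by (rule real_nat_ceiling_ge)
    also have "\<dots> \<le> card W" using cW(2) by (simp only: of_nat_le_iff)
    finally have "1 / \<epsilon> \<le> card W" .
    then have \<epsilon>W: "1 \<le> \<epsilon> * card W" using \<epsilon>0 by (simp add: field_simps)
    obtain c where c: "\<delta> \<le> pr (listset (replicate (Suc k) W)) (\<lambda>x. set x \<in> mono_cliques k V E col (Suc k) c)"
      using dens[OF G W(1) cW(1) W(3)] by blast
    define H where "H = mono_cliques k V E col (Suc k) c"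
    define Bs where "Bs = replicate k W"
    define P where "P d = pr (listset Bs) (\<lambda>x. insert d (set x) \<in> H)" for d
    have P1: "P d \<le> 1" for d unfolding P_def by (rule pr_le_1)
    define D where "D = {d\<in>W. \<delta> / 2 \<le> P d}"
    have "\<delta> \<le> avg W P"
      using c by (simp add: avg_listset_Cons P_def[abs_def] Bs_def H_def del: listset.simps)
    then have "\<delta> / 2 \<le> pr W (\<lambda>d. \<delta> / 2 \<le> P d)"
      using W W0 \<delta> P1 by (intro pr_markov) auto
    then have cD: "\<delta> / 2 * card W \<le> card D" using W cW by (simp add: pr_card D_def field_simps)
    have "0 < \<delta> / 2 * card W" using \<delta> cW by simp
    with cD have "0 < card D" by linarith
    then have D0: "D \<noteq> {}" by auto
    have DW: "D \<subseteq> W" by (auto simp: D_def)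
    have finD: "finite D" using DW W(3) by (rule finite_subset)
    have lB: "length Bs = k" by (simp add: Bs_def)
    interpret tuple_system Bs D H \<sigma>
    proof
      show "finite A \<and> A \<noteq> {}" if "A \<in> set (D # Bs)" for A
        using that W(3) W0 finD D0 by (auto simp: Bs_def)
      show "card e = Suc (length Bs)" if "e \<in> H" for e
        using that by (simp add: H_def mono_cliques_def lB)
    qed
    define f where "f U d = avg X (\<lambda>x. pr X (\<lambda>y. x \<in> U \<and> y \<in> U \<and> link H d x y))" for U d
    have f1: "f U d \<le> 1" for U d unfolding f_def using X by (intro avg_le_1 pr_le_1) auto
    have "\<exists>U\<subseteq>X. conn_density k (\<delta> / 2) ^ 4 / 128 \<le> avg D (f U) \<and> (\<forall>x\<in>U. \<forall>y\<in>U. rconn 5 x y)"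
      unfolding f_def using const
      by (intro ex_connected_set[of "\<delta> / 2"]) (auto simp: D_def P_def \<delta>2 lB conn_density_def \<delta>)
    then obtain U where U: "U \<subseteq> X" "2 * \<eta> \<le> avg D (f U)" "\<And>x y. x \<in> U \<Longrightarrow> y \<in> U \<Longrightarrow> rconn 5 x y"
      by (auto simp: \<eta>_def cover_density_def)
    define B0 where "B0 = {d\<in>D. \<eta> \<le> f U d}"
    have "2 * \<eta> / 2 \<le> pr D (\<lambda>d. 2 * \<eta> / 2 \<le> f U d)"
      using finD D0 U(2) const f1 by (intro pr_markov) auto
    then have "\<eta> * card D \<le> card B0"
      using finD \<open>0 < card D\<close> by (simp add: pr_card B0_def field_simps)
    moreover have "\<eta> * (\<delta> / 2 * card W) \<le> \<eta> * card D"
      using cD const by (intro mult_left_mono) auto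
    ultimately have B0: "2 * (\<eta> * \<delta> / 4) * card W \<le> card B0" by (simp add: algebra_simps)
    define b where "b = nat \<lceil>\<epsilon> * card W\<rceil>"
    have b: "\<epsilon> * card W \<le> b" "b \<le> 2 * \<epsilon> * card W" "1 \<le> b"
      using \<epsilon>W unfolding b_def by linarith+
    have "\<epsilon> \<le> \<eta> * \<delta> / 4" unfolding \<epsilon>_def by (rule min.cobounded2)
    then have "2 * \<epsilon> * card W \<le> 2 * (\<eta> * \<delta> / 4) * card W"
      by (intro mult_right_mono mult_left_mono) auto
    then have "b \<le> card B0" using b(2) B0 by linarith
    then obtain B where B: "B \<subseteq> B0" "card B = b" "finite B"
      using obtain_subset_with_card_n by (metis finD finite_subset B0_def mem_Collect_eq subsetI)
    have sm: "small (9 * Suc (length Bs) * Suc (card B)) {}"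
      unfolding small_def
    proof
      fix A assume "A \<in> set (D # Bs)"
      then have "A = D \<or> A = W" by (auto simp: Bs_def)
      then have "card D \<le> card A" using DW W(3) by (auto intro: card_mono)
      have "real (9 * Suc k * Suc b) \<le> 9 * Suc k * (2 * real b)"
        using b(3) by simp
      also have "\<dots> \<le> 9 * Suc k * (2 * (2 * \<epsilon> * card W))"
        using b(2) by (intro mult_left_mono) auto
      also have "\<dots> = (36 * Suc k * \<epsilon>) * card W" by simp
      also have "\<dots> \<le> (\<sigma> * (\<delta> / 2)) * card W" using \<epsilon>\<sigma> by (intro mult_right_mono) auto
      also have "\<dots> = \<sigma> * (\<delta> / 2 * card W)" by simp
      also have "\<dots> \<le> \<sigma> * card A"
        using cD \<open>card D \<le> card A\<close> const by (intro mult_left_mono) auto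
      finally show "real (card ({} \<inter> A) + 9 * Suc (length Bs) * Suc (card B)) \<le> \<sigma> * card A"
        using B lB by simp
    qed
    have "B \<noteq> {}" using B b(3) by auto
    have cov: "\<eta> \<le> avg X (\<lambda>x. pr X (\<lambda>y. x \<in> U \<and> y \<in> U \<and> link H d x y))" if "d \<in> B" for d
      using that B by (auto simp: B0_def f_def)
    have \<sigma>': "length Bs * \<sigma> < \<eta> / 2" using const lB by simp
    obtain x ps d where w: "walk H x ps d x" "length x = length Bs" "ps \<noteq> []"
      "\<forall>z\<in>snd ` set ps. length z = length Bs" "distinct (x @ flat ps @ [d])"
      "B \<subseteq> insert d (fst ` set ps)" "set (x @ flat ps @ [d]) \<subseteq> B \<union> D \<union> \<Union>(set Bs)"
      using ex_closed_walk_through[OF U(1,3) \<sigma>' const(2) B(3) \<open>B \<noteq> {}\<close> cov sm] by auto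
    define Z where "Z = set (x @ flat ps @ [d])"
    have "fst ` set ps \<subseteq> set (flat ps)" by (force simp: flat_def)
    moreover have "insert d (set (flat ps)) \<subseteq> Z" by (auto simp: Z_def)
    ultimately have BZ: "B \<subseteq> Z" using w(6) by blast
    have ZW: "Z \<subseteq> W" using w(7) B DW by (auto simp: Z_def B0_def Bs_def set_replicate_conv_if split: if_splits)
    have "cycle_set k V E col (Z - Y)" if "Y \<subseteq> B" for Y
      unfolding Z_def using w lB ZW W(1) that
      by (intro cycle_set_clique_walk[OF w(1) _ _ w(3,5) _ k H_def]) (auto simp: Z_def)
    then show ?thesis using BZ ZW b(1) B(2) by blast
  qed
  then have "\<forall>(V :: 'a set) E col W. admissible k r \<alpha> V E col \<longrightarrow> W \<subseteq> V \<longrightarrow> n0 \<le> card W \<longrightarrow> finite W \<longrightarrow>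
     (\<exists>A Z. A \<subseteq> Z \<and> Z \<subseteq> W \<and> \<epsilon> * card W \<le> card A \<and> (\<forall>Y\<subseteq>A. cycle_set k V E col (Z - Y)))"
    by (intro allI impI)
  with \<epsilon>0 show ?thesis by (intro exI[of _ \<epsilon>] conjI exI[of _ n0])
qed

section \<open>Covering by bounded families of cycles\<close>

definition coverable ::
    "nat \<Rightarrow> 'a set \<Rightarrow> 'a set set \<Rightarrow> ('a set \<Rightarrow> nat) \<Rightarrow> nat \<Rightarrow> 'a set \<Rightarrow> bool" where
  "coverable k V E col c S \<longleftrightarrow>
     (\<exists>P. partition_on S P \<and> finite P \<and> card P \<le> c \<and> (\<forall>C\<in>P. cycle_set k V E col C))"

lemma coverable_mono: "coverable k V E col c S \<Longrightarrow> c \<le> c' \<Longrightarrow> coverable k V E col c' S"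
  unfolding coverable_def using le_trans by blast

lemma coverable_empty: "coverable k V E col c {}"
  unfolding coverable_def by (intro exI[of _ "{}"]) (auto simp: partition_on_def)

lemma coverable_Un:
  assumes "coverable k V E col c S" "coverable k V E col c' T" "S \<inter> T = {}"
  shows "coverable k V E col (c + c') (S \<union> T)"
proof -
  obtain P where P: "partition_on S P" "finite P" "card P \<le> c" "\<forall>C\<in>P. cycle_set k V E col C"
    using assms(1) unfolding coverable_def by blast
  obtain Q where Q: "partition_on T Q" "finite Q" "card Q \<le> c'" "\<forall>C\<in>Q. cycle_set k V E col C"
    using assms(2) unfolding coverable_def by blast
  have "partition_on (S \<union> T) (P \<union> Q)"
    using P(1) Q(1) assms(3) unfolding partition_on_def
    by (intro conjI disjoint_union) auto
  moreover have "card (P \<union> Q) \<le> c + c'" using card_Un_le[of P Q] P(3) Q(3) by linarith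
  ultimately show ?thesis
    unfolding coverable_def using P Q by (intro exI[of _ "P \<union> Q"]) auto
qed

lemma coverable_cycle: "cycle_set k V E col C \<Longrightarrow> coverable k V E col 1 C"
  unfolding coverable_def cycle_set_def mono_tight_cycle_def
  by (intro exI[of _ "{C}"]) (auto simp: partition_on_def)

lemma coverable_singletons:
  assumes "finite S" "S \<subseteq> V"
  shows "coverable k V E col (card S) S"
proof -
  have "cycle_set k V E col {x}" if "x \<in> S" for x
    unfolding cycle_set_def mono_tight_cycle_def using that assms by (intro exI[of _ "[x]"]) auto
  then show ?thesis
    unfolding coverable_def using assms partition_on_singletons[of S]
    by (intro exI[of _ "(\<lambda>x. {x}) ` S"]) (auto simp: card_image_le)
qed

lemma greedy_cover:
  fixes \<epsilon> :: real
  assumes big: "\<And>W. W \<subseteq> V \<Longrightarrow> n0 \<le> card W \<Longrightarrow> finite W \<Longrightarrow>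
      \<exists>Z\<subseteq>W. \<epsilon> * card W \<le> card Z \<and> cycle_set k V E col Z"
    and W: "W \<subseteq> V" "finite W" and \<epsilon>: "\<epsilon> \<le> 1"
  shows "\<exists>R\<subseteq>W. coverable k V E col s (W - R) \<and> (card R \<le> (1 - \<epsilon>) ^ s * card W \<or> card R < n0)"
proof (induction s)
  case 0
  show ?case by (intro exI[of _ W]) (auto simp: coverable_empty)
next
  case (Suc s)
  then obtain R where R: "R \<subseteq> W" "coverable k V E col s (W - R)"
    "card R \<le> (1 - \<epsilon>) ^ s * card W \<or> card R < n0" by blast
  show ?case
  proof (cases "card R < n0")
    case True
    then show ?thesis using R coverable_mono[of k V E col s _ "Suc s"] by (intro exI[of _ R]) auto
  next
    case False
    have fR: "finite R" using R(1) W(2) by (rule finite_subset)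
    obtain Z where Z: "Z \<subseteq> R" "\<epsilon> * card R \<le> card Z" "cycle_set k V E col Z"
      using big[of R] R W False fR by auto
    have "coverable k V E col (s + 1) ((W - R) \<union> Z)"
      using R(2) coverable_cycle[OF Z(3)] by (rule coverable_Un) (use Z(1) in auto)
    moreover have "(W - R) \<union> Z = W - (R - Z)" using Z(1) R(1) by auto
    moreover have "real (card (R - Z)) = real (card R) - real (card Z)"
      using Z(1) fR by (simp add: card_Diff_subset finite_subset card_mono of_nat_diff)
    then have "card (R - Z) \<le> (1 - \<epsilon>) * card R" using Z(2) by (simp add: algebra_simps)
    moreover have "(1 - \<epsilon>) * card R \<le> (1 - \<epsilon>) * ((1 - \<epsilon>) ^ s * card W)"
      using False R(3) \<epsilon> by (intro mult_left_mono) auto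
    ultimately show ?thesis using R(1) by (intro exI[of _ "R - Z"]) auto
  qed
qed

text \<open>The absorbing cycle is set aside first, and the rest is covered greedily until the
  remainder is small against \<open>A\<close>. It matters that \<tau> is arbitrary: it is chosen
  after the constants of the next stage are known.\<close>

lemma ex_absorber_cover:
  fixes \<tau> :: real
  assumes k: "0 < k" and \<tau>: "0 < \<tau>"
  shows "\<exists>n0 c. \<forall>V E col W. admissible k r \<alpha> V E col \<longrightarrow> W \<subseteq> V \<longrightarrow> n0 \<le> card W \<longrightarrow> finite W \<longrightarrow>
    (\<exists>A Z R. A \<subseteq> Z \<and> Z \<subseteq> W \<and> R \<subseteq> W - Z \<and> card R \<le> \<tau> * card A \<and> A \<noteq> {} \<and>
      coverable k V E col c (W - Z - R) \<and> (\<forall>Y\<subseteq>A. cycle_set k V E col (Z - Y)))"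
proof -
  obtain \<epsilon>1 :: real and n1 where \<epsilon>1: "0 < \<epsilon>1" and abs0: "\<forall>(V :: 'a set) E col W. admissible k r \<alpha> V E col \<longrightarrow> W \<subseteq> V \<longrightarrow>
     n1 \<le> card W \<longrightarrow> finite W \<longrightarrow>
     (\<exists>A Z. A \<subseteq> Z \<and> Z \<subseteq> W \<and> \<epsilon>1 * card W \<le> card A \<and> (\<forall>Y\<subseteq>A. cycle_set k V E col (Z - Y)))"
    using ex_absorber[OF k, of r \<alpha>, where ?'a = 'a] by (elim exE conjE) (rule that, assumption+)
  note abs = abs0[rule_format]
  define \<epsilon> where "\<epsilon> = min \<epsilon>1 1"
  have \<epsilon>: "0 < \<epsilon>" "\<epsilon> \<le> 1" "\<epsilon> \<le> \<epsilon>1" using \<epsilon>1 by (auto simp: \<epsilon>_def)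
  obtain s where s: "(1 - \<epsilon>) ^ s < \<tau> * \<epsilon>"
    using real_arch_pow_inv[of "\<tau> * \<epsilon>" "1 - \<epsilon>"] \<tau> \<epsilon> by auto
  \<comment> \<open>Should the greedy covering stop with fewer than \<open>n1\<close> vertices left,
    these are still at most \<tau> \<epsilon> |W|.\<close>
  define n0 where "n0 = Suc (n1 + nat \<lceil>n1 / (\<tau> * \<epsilon>)\<rceil>)"
  have "\<exists>A Z R. A \<subseteq> Z \<and> Z \<subseteq> W \<and> R \<subseteq> W - Z \<and> card R \<le> \<tau> * card A \<and> A \<noteq> {} \<and>
      coverable k V E col s (W - Z - R) \<and> (\<forall>Y\<subseteq>A. cycle_set k V E col (Z - Y))"
    if G: "admissible k r \<alpha> V E col" and W: "W \<subseteq> V" "n0 \<le> card W" "finite W" for V :: "'a set" and E col W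
  proof -
    have n: "n1 \<le> card W" "nat \<lceil>n1 / (\<tau> * \<epsilon>)\<rceil> \<le> card W" "0 < card W"
      using W(2) unfolding n0_def by linarith+
    have abs': "\<exists>A Z. A \<subseteq> Z \<and> Z \<subseteq> W \<and> \<epsilon> * card W \<le> card A \<and> (\<forall>Y\<subseteq>A. cycle_set k V E col (Z - Y))"
      if W': "W \<subseteq> V" "n1 \<le> card W" "finite W" for W
    proof -
      have "\<epsilon> * card W \<le> \<epsilon>1 * card W" using \<epsilon> by (intro mult_right_mono) auto
      moreover obtain A Z where "A \<subseteq> Z" "Z \<subseteq> W" "\<epsilon>1 * card W \<le> card A"
        "\<forall>Y\<subseteq>A. cycle_set k V E col (Z - Y)" using abs[OF G W'] by (elim exE conjE) (rule that)
      ultimately show ?thesis by (intro exI[of _ A] exI[of _ Z]) auto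
    qed
    obtain A Z where AZ: "A \<subseteq> Z" "Z \<subseteq> W" "\<epsilon> * card W \<le> card A" "\<forall>Y\<subseteq>A. cycle_set k V E col (Z - Y)"
      using abs'[OF W(1) n(1) W(3)] by blast
    have "0 < \<epsilon> * card W" using n \<epsilon> by simp
    then have A: "A \<noteq> {}" using AZ(3) by auto
    have big: "\<exists>Z\<subseteq>W. \<epsilon> * card W \<le> card Z \<and> cycle_set k V E col Z"
      if W': "W \<subseteq> V" "n1 \<le> card W" "finite W" for W
    proof -
      obtain A Z where AZ: "A \<subseteq> Z" "Z \<subseteq> W" "\<epsilon> * card W \<le> card A" "\<forall>Y\<subseteq>A. cycle_set k V E col (Z - Y)"
        using abs'[OF W'] by (elim exE conjE) (rule that)
      have "card A \<le> card Z" using AZ W' by (intro card_mono) (auto intro: finite_subset)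
      then have "\<epsilon> * card W \<le> card Z" using AZ(3) by linarith
      moreover have "cycle_set k V E col Z" using AZ(4)[rule_format, of "{}"] by simp
      ultimately show ?thesis using AZ(2) by blast
    qed
    have WZ: "W - Z \<subseteq> V" "finite (W - Z)" using W by auto
    have "\<exists>R\<subseteq>W - Z. coverable k V E col s (W - Z - R) \<and>
        (card R \<le> (1 - \<epsilon>) ^ s * card (W - Z) \<or> card R < n1)"
      by (rule greedy_cover[OF _ WZ \<epsilon>(2)]) (rule big)
    then obtain R where R: "R \<subseteq> W - Z" "coverable k V E col s (W - Z - R)"
      "card R \<le> (1 - \<epsilon>) ^ s * card (W - Z) \<or> card R < n1"
      by (elim exE conjE) (rule that)
    have "card R \<le> \<tau> * \<epsilon> * card W"
    proof (cases "card R < n1")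
      case True
      have "n1 / (\<tau> * \<epsilon>) \<le> real (nat \<lceil>n1 / (\<tau> * \<epsilon>)\<rceil>)" by (rule real_nat_ceiling_ge)
      also have "\<dots> \<le> card W" using n(2) by (simp only: of_nat_le_iff)
      finally have "n1 \<le> \<tau> * \<epsilon> * card W" using \<tau> \<epsilon> by (simp add: field_simps)
      then show ?thesis using True by linarith
    next
      case False
      then have "card R \<le> (1 - \<epsilon>) ^ s * card (W - Z)" using R(3) by blast
      also have "\<dots> \<le> (1 - \<epsilon>) ^ s * card W"
        using \<epsilon> W(3) by (intro mult_left_mono) (auto intro: card_mono)
      also have "\<dots> \<le> \<tau> * \<epsilon> * card W" using s by (intro mult_right_mono) auto
      finally show ?thesis .
    qed
    also have "\<dots> = \<tau> * (\<epsilon> * card W)" by simp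
    also have "\<dots> \<le> \<tau> * card A" using AZ(3) \<tau> by (intro mult_left_mono) auto
    finally show ?thesis using AZ A R by (intro exI[of _ A] exI[of _ Z] exI[of _ R] conjI)
  qed
  then show ?thesis by (intro exI[of _ n0] exI[of _ s] allI impI)
qed

section \<open>Connectors and the vertices they can cover\<close>

definition covering_density :: "'a set list \<Rightarrow> 'a set set \<Rightarrow> 'a list set \<Rightarrow> 'a \<Rightarrow> real" where
  "covering_density Bs H U b =
     avg (listset Bs) (\<lambda>x. pr (listset Bs) (\<lambda>y. x \<in> U \<and> y \<in> U \<and> link H b x y))"

text \<open>Each connected set of tuples comes with its own supply \<open>fst C\<close> of
  connecting vertices, while \<open>Bs\<close> and \<open>H\<close> are shared by all
  connectors.\<close>

definition connector :: "'a set list \<Rightarrow> 'a set set \<Rightarrow> real \<Rightarrow> 'a set \<times> 'a list set \<Rightarrow> bool" where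
  "connector Bs H \<sigma> C \<longleftrightarrow> tuple_system Bs (fst C) H \<and> snd C \<subseteq> listset Bs \<and>
     (\<forall>x\<in>snd C. \<forall>y\<in>snd C. tuple_system.rconn Bs (fst C) H \<sigma> 5 x y)"

text \<open>The vertices of \<open>B\<close> need not belong to the system: they become prescribed
  connectors of a single closed walk in one colour class, and \<open>Y\<close> is what this walk
  borrows from \<open>D\<close> and \<open>Bs\<close>.\<close>

lemma cover_by_connector:
  fixes \<sigma> \<eta> :: real
  assumes C: "connector Bs H \<sigma> (D, U)"
    and G: "k_graph (Suc (length Bs)) V E" and H: "H = {e \<in> E. col e = c}"
    and V: "\<Union>(set (D # Bs)) \<subseteq> V" "B \<subseteq> V"
    and \<sigma>: "length Bs * \<sigma> < \<eta> / 2" "0 < \<eta>"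
    and B: "finite B" "\<And>b. b \<in> B \<Longrightarrow> \<eta> \<le> covering_density Bs H U b" "B \<inter> F = {}"
    and F: "\<And>A. A \<in> set (D # Bs) \<Longrightarrow>
        real (card (F \<inter> A) + 9 * Suc (length Bs) * Suc (card B)) \<le> \<sigma> * card A"
  shows "\<exists>Y \<subseteq> \<Union>(set (D # Bs)). Y \<inter> (B \<union> F) = {} \<and> finite Y \<and>
    card Y \<le> 14 * Suc (length Bs) * card B \<and> coverable (Suc (length Bs)) V E col 1 (B \<union> Y)"
proof (cases "B = {}")
  case True
  then show ?thesis by (intro exI[of _ "{}"]) (auto simp: coverable_empty)
next
  case False
  interpret tuple_system Bs D H \<sigma> using C by (simp add: connector_def)
  have U: "U \<subseteq> X" "\<And>x y. x \<in> U \<Longrightarrow> y \<in> U \<Longrightarrow> rconn 5 x y"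
    using C by (auto simp: connector_def)
  note cov = B(2)[unfolded covering_density_def]
  have "small (9 * Suc (length Bs) * Suc (card B)) F" unfolding small_def using F by blast
  then obtain x ps d where w: "walk H x ps d x" "length x = length Bs" "ps \<noteq> []"
      "\<forall>z\<in>snd ` set ps. length z = length Bs" "distinct (x @ flat ps @ [d])"
      "set (x @ flat ps @ [d]) \<inter> F = {}"
      "B \<subseteq> insert d (fst ` set ps)" "set (x @ flat ps @ [d]) \<subseteq> B \<union> D \<union> \<Union>(set Bs)"
      "length (x @ flat ps @ [d]) \<le> 14 * Suc (length Bs) * card B"
    using ex_closed_walk_through[OF U \<sigma> B(1) False cov _ B(3)] by blast
  define Z where "Z = set (x @ flat ps @ [d])"
  have "fst ` set ps \<subseteq> set (flat ps)" by (force simp: flat_def)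
  moreover have "insert d (set (flat ps)) \<subseteq> Z" by (auto simp: Z_def)
  ultimately have BZ: "B \<subseteq> Z" using w(7) by blast
  have "B \<union> D \<union> \<Union>(set Bs) \<subseteq> V" using V by simp
  then have ZV: "Z \<subseteq> V" using w(8) unfolding Z_def by (rule order_trans[rotated])
  have "cycle_set (Suc (length Bs)) V E col Z"
    unfolding Z_def using cycle_set_closed_walk[OF w(1,4,2,3,5) _ G H] ZV by (simp add: Z_def)
  then have "coverable (Suc (length Bs)) V E col 1 (B \<union> (Z - B))"
    using BZ coverable_cycle by (simp add: Un_absorb1)
  moreover have "card (Z - B) \<le> length (x @ flat ps @ [d])"
    unfolding Z_def by (rule order_trans[OF card_mono card_length]) auto
  moreover have "Z - B \<subseteq> \<Union>(set (D # Bs))" using w(8) by (auto simp: Z_def)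
  moreover have "(Z - B) \<inter> (B \<union> F) = {}" "finite (Z - B)" using w(6) by (auto simp: Z_def)
  ultimately show ?thesis using w(9) by (intro exI[of _ "Z - B"]) auto
qed

text \<open>Each vertex of \<open>R\<close> goes to the first connector in the list that meets it.
  In 23 = 14 + 9, the 14 pays for vertices borrowed by the other walks and the 9 is the budget of
  the current one.\<close>

lemma cover_by_connectors:
  fixes \<sigma> \<eta> :: real
  assumes "\<And>C. C \<in> set Cs \<Longrightarrow> connector Bs H \<sigma> C"
    and G: "k_graph (Suc (length Bs)) V E" and H: "H = {e \<in> E. col e = c}"
    and "\<Union>(set Bs) \<subseteq> V" "\<Union>(fst ` set Cs) \<subseteq> V" "R \<subseteq> V"
    and \<sigma>: "length Bs * \<sigma> < \<eta> / 2" "0 < \<eta>"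
    and "finite R" "\<And>b. b \<in> R \<Longrightarrow> \<exists>C\<in>set Cs. \<eta> \<le> covering_density Bs H (snd C) b" "R \<inter> F = {}"
    and "\<And>A. A \<in> set Bs \<union> fst ` set Cs \<Longrightarrow>
        real (card (F \<inter> A) + 23 * Suc (length Bs) * Suc (card R)) \<le> \<sigma> * card A"
  shows "\<exists>Y \<subseteq> \<Union>(set Bs \<union> fst ` set Cs). Y \<inter> (R \<union> F) = {} \<and> finite Y \<and>
    card Y \<le> 14 * Suc (length Bs) * card R \<and> coverable (Suc (length Bs)) V E col (length Cs) (R \<union> Y)"
  using assms
proof (induction Cs arbitrary: R F)
  case Nil
  then have "R = {}" by auto
  then show ?case by (intro exI[of _ "{}"]) (auto simp: coverable_empty)
next
  case (Cons C Cs)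
  let ?m = "length Bs"
  obtain D U where C: "C = (D, U)" by (cases C)
  define B where "B = {b\<in>R. \<eta> \<le> covering_density Bs H U b}"
  define R' where "R' = R - B"
  have fin: "finite B" "finite R'" and sub: "B \<subseteq> R" "R' \<subseteq> R"
    using Cons.prems(9) by (auto simp: B_def R'_def)
  have R: "R = B \<union> R'" "B \<inter> R' = {}" by (auto simp: B_def R'_def)
  have cR: "card R = card B + card R'" unfolding R(1) using fin R(2) by (rule card_Un_disjoint)
  have finA: "finite A" if "A \<in> set Bs \<union> fst ` set (C # Cs)" for A
  proof -
    have "A \<subseteq> \<Union>(set Bs \<union> fst ` set (C # Cs))" using that by blast
    also have "\<dots> \<subseteq> V" using Cons.prems(4,5) by simp
    finally have "A \<subseteq> V" .
    then show ?thesis using G by (auto simp: k_graph_def intro: finite_subset)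
  qed
  have "\<exists>Y \<subseteq> \<Union>(set Bs \<union> fst ` set Cs). Y \<inter> (R' \<union> (F \<union> B)) = {} \<and> finite Y \<and>
    card Y \<le> 14 * Suc ?m * card R' \<and> coverable (Suc ?m) V E col (length Cs) (R' \<union> Y)"
  proof (rule Cons.IH)
    show "\<exists>C\<in>set Cs. \<eta> \<le> covering_density Bs H (snd C) b" if "b \<in> R'" for b
      using that Cons.prems(10)[of b] by (auto simp: R'_def B_def C)
    show "real (card ((F \<union> B) \<inter> A) + 23 * Suc ?m * Suc (card R')) \<le> \<sigma> * card A"
      if A: "A \<in> set Bs \<union> fst ` set Cs" for A
    proof -
      have "card ((F \<union> B) \<inter> A) \<le> card (F \<inter> A \<union> B)"
        using fin finA A by (intro card_mono) auto
      also have "\<dots> \<le> card (F \<inter> A) + card B" by (rule card_Un_le)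
      finally have "card ((F \<union> B) \<inter> A) + 23 * Suc ?m * Suc (card R') \<le> card (F \<inter> A) + 23 * Suc ?m * Suc (card R)"
        unfolding cR by (simp add: algebra_simps)
      then have "real (card ((F \<union> B) \<inter> A) + 23 * Suc ?m * Suc (card R'))
          \<le> real (card (F \<inter> A) + 23 * Suc ?m * Suc (card R))" by (rule of_nat_mono)
      also have "\<dots> \<le> \<sigma> * card A" using A by (intro Cons.prems(12)) auto
      finally show ?thesis .
    qed
  qed (use Cons.prems fin sub R in auto)
  then obtain Y' where Y': "Y' \<subseteq> \<Union>(set Bs \<union> fst ` set Cs)" "Y' \<inter> (R' \<union> (F \<union> B)) = {}" "finite Y'"
    "card Y' \<le> 14 * Suc ?m * card R'" "coverable (Suc ?m) V E col (length Cs) (R' \<union> Y')" by blast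
  have "\<exists>Y \<subseteq> \<Union>(set (D # Bs)). Y \<inter> (B \<union> (F \<union> R' \<union> Y')) = {} \<and> finite Y \<and>
    card Y \<le> 14 * Suc ?m * card B \<and> coverable (Suc ?m) V E col 1 (B \<union> Y)"
  proof (rule cover_by_connector[OF _ G H _ _ \<sigma> fin(1)])
    show "connector Bs H \<sigma> (D, U)" using Cons.prems(1)[of C] by (simp add: C)
    show "\<Union>(set (D # Bs)) \<subseteq> V" "B \<subseteq> V" using Cons.prems(4-6) sub by (auto simp: C)
    show "B \<inter> (F \<union> R' \<union> Y') = {}" using Cons.prems(11) sub R Y' by auto
    show "\<eta> \<le> covering_density Bs H U b" if "b \<in> B" for b using that by (simp add: B_def)
    show "real (card ((F \<union> R' \<union> Y') \<inter> A) + 9 * Suc ?m * Suc (card B)) \<le> \<sigma> * card A"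
      if A: "A \<in> set (D # Bs)" for A
    proof -
      have "card ((F \<union> R' \<union> Y') \<inter> A) \<le> card (F \<inter> A \<union> (R' \<union> Y'))"
        using fin finA[of A] A Y' by (intro card_mono) (auto simp: C)
      also have "\<dots> \<le> card (F \<inter> A) + (card R' + card Y')"
        by (intro order_trans[OF card_Un_le] add_left_mono card_Un_le)
      finally have "card ((F \<union> R' \<union> Y') \<inter> A) + 9 * Suc ?m * Suc (card B)
          \<le> card (F \<inter> A) + 23 * Suc ?m * Suc (card R)"
        unfolding cR using Y'(4) by (simp add: algebra_simps)
      then have "real (card ((F \<union> R' \<union> Y') \<inter> A) + 9 * Suc ?m * Suc (card B))
          \<le> real (card (F \<inter> A) + 23 * Suc ?m * Suc (card R))" by (rule of_nat_mono)
      also have "\<dots> \<le> \<sigma> * card A" using A by (intro Cons.prems(12)) (auto simp: C)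
      finally show ?thesis .
    qed
  qed
  then obtain Y where Y: "Y \<subseteq> \<Union>(set (D # Bs))" "Y \<inter> (B \<union> (F \<union> R' \<union> Y')) = {}" "finite Y"
    "card Y \<le> 14 * Suc ?m * card B" "coverable (Suc ?m) V E col 1 (B \<union> Y)" by blast
  have "coverable (Suc ?m) V E col (length Cs + 1) ((R' \<union> Y') \<union> (B \<union> Y))"
    using Y'(5) Y(5) by (rule coverable_Un) (use Y Y' R in auto)
  moreover have "(R' \<union> Y') \<union> (B \<union> Y) = R \<union> (Y \<union> Y')" using R by auto
  moreover have "card (Y \<union> Y') \<le> 14 * Suc ?m * card R"
    using card_Un_le[of Y Y'] Y(4) Y'(4) unfolding cR by (simp add: algebra_simps)
  ultimately show ?case using Y Y' R by (intro exI[of _ "Y \<union> Y'"]) (auto simp: C)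
qed

section \<open>Vertices with dense links\<close>

text \<open>\<open>S\<close> is the stock of vertices from which the cycles covering
  \<open>R\<close> may borrow; bounding \<open>Y\<close> by a multiple of \<open>R\<close> limits
  the damage done to the absorbers in \<open>S\<close>.\<close>

definition extends_to_cover ::
    "nat \<Rightarrow> 'a set \<Rightarrow> 'a set set \<Rightarrow> ('a set \<Rightarrow> nat) \<Rightarrow> nat \<Rightarrow> nat \<Rightarrow> 'a set \<Rightarrow> 'a set \<Rightarrow> bool" where
  "extends_to_cover k V E col c K S R \<longleftrightarrow>
     (\<exists>Y\<subseteq>S. card Y \<le> K * card R \<and> coverable k V E col c (R \<union> Y))"

lemma extends_to_coverI:
  "Y \<subseteq> S \<Longrightarrow> card Y \<le> K * card R \<Longrightarrow> coverable k V E col c (R \<union> Y) \<Longrightarrow> extends_to_cover k V E col c K S R"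
  unfolding extends_to_cover_def by blast

text \<open>Steps over a vertex of \<open>D\<close> have average measure at least twice
  \<open>cover_density\<close> inside \<open>U\<close>, but at most \<open>cover_density\<close> of
  them lie in pairs already connected. Hence \<open>U\<close> contributes new pairs of measure at
  least \<open>cover_density\<close>.\<close>

lemma ex_new_connector:
  assumes \<delta>: "0 < \<delta>" and Bs: "\<forall>B\<in>set Bs. finite B \<and> B \<noteq> {}" and D: "finite D" "D \<noteq> {}"
    and H: "\<forall>e\<in>H. card e = Suc (length Bs)"
    and dens: "\<And>d. d \<in> D \<Longrightarrow> \<delta> \<le> pr (listset Bs) (\<lambda>x. insert d (set x) \<in> H)"
    and Cs: "length Cs \<le> max_connectors (length Bs) \<delta>"
    and sparse: "\<And>d C. d \<in> D \<Longrightarrow> C \<in> set Cs \<Longrightarrow>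
        covering_density Bs H (snd C) d \<le> cover_threshold (length Bs) \<delta>"
  shows "\<exists>U. connector Bs H (slack (length Bs) \<delta>) (D, U) \<and>
    cover_density (length Bs) \<delta> + avg (listset Bs) (\<lambda>x. pr (listset Bs) (\<lambda>y. \<exists>C\<in>set Cs. x \<in> snd C \<and> y \<in> snd C))
      \<le> avg (listset Bs) (\<lambda>x. pr (listset Bs) (\<lambda>y. \<exists>C\<in>set ((D, U) # Cs). x \<in> snd C \<and> y \<in> snd C))"
proof -
  let ?m = "length Bs"
  let ?\<kappa> = "cover_density ?m \<delta>" and ?\<eta> = "cover_threshold ?m \<delta>" and ?N = "max_connectors ?m \<delta>"
  interpret tuple_system Bs D H "slack ?m \<delta>"
    using Bs D H by unfold_locales auto
  obtain U where U: "U \<subseteq> X" "\<forall>x\<in>U. \<forall>y\<in>U. rconn 5 x y"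
    "conn_density ?m \<delta> ^ 4 / 128 \<le> avg D (\<lambda>d. avg X (\<lambda>x. pr X (\<lambda>y. x \<in> U \<and> y \<in> U \<and> link H d x y)))"
    using ex_connected_set[of \<delta> "conn_density ?m \<delta>", OF dens \<delta> conn_density_def slack_bound(1)[OF \<delta>] slack_le[OF \<delta>]]
    by blast
  have conn: "connector Bs H (slack ?m \<delta>) (D, U)"
    unfolding connector_def fst_conv snd_conv using U(1,2) tuple_system_axioms by blast
  define P where "P x y \<longleftrightarrow> (\<exists>C\<in>set Cs. x \<in> snd C \<and> y \<in> snd C)" for x y
  define q where "q = avg X (\<lambda>x. pr X (\<lambda>y. (x \<in> U \<and> y \<in> U) \<and> \<not> P x y))"
  have le: "avg X (\<lambda>x. pr X (\<lambda>y. x \<in> U \<and> y \<in> U \<and> link H d x y)) \<le> q + ?\<kappa>" if d: "d \<in> D" for d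
  proof -
    have "avg X (\<lambda>x. pr X (\<lambda>y. x \<in> U \<and> y \<in> U \<and> link H d x y))
      \<le> avg X (\<lambda>x. avg X (\<lambda>y. of_bool ((x \<in> U \<and> y \<in> U) \<and> \<not> P x y)
           + (\<Sum>C\<in>set Cs. of_bool (x \<in> snd C \<and> y \<in> snd C \<and> link H d x y))))"
    proof (intro avg_mono)
      fix x y
      let ?f = "\<lambda>C. of_bool (x \<in> snd C \<and> y \<in> snd C \<and> link H d x y) :: real"
      have nonneg: "0 \<le> sum ?f (set Cs)" by (intro sum_nonneg) auto
      show "of_bool (x \<in> U \<and> y \<in> U \<and> link H d x y) \<le> of_bool ((x \<in> U \<and> y \<in> U) \<and> \<not> P x y) + sum ?f (set Cs)"
      proof (cases "P x y \<and> link H d x y")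
        case True
        then obtain C where C: "C \<in> set Cs" "x \<in> snd C" "y \<in> snd C" by (auto simp: P_def)
        then have "?f C \<le> sum ?f (set Cs)" by (intro member_le_sum) auto
        then show ?thesis using True C by simp
      next
        case False
        then show ?thesis using nonneg by auto
      qed
    qed
    also have "\<dots> = q + (\<Sum>C\<in>set Cs. covering_density Bs H (snd C) d)"
      by (simp only: avg_add avg_sum q_def covering_density_def)
    also have "(\<Sum>C\<in>set Cs. covering_density Bs H (snd C) d) \<le> (\<Sum>C\<in>set Cs. ?\<eta>)"
      using sparse[OF d] by (intro sum_mono)
    also have "\<dots> = card (set Cs) * ?\<eta>" by simp
    also have "\<dots> \<le> ?N * ?\<eta>"
      using card_length[of Cs] Cs cover_threshold_pos[OF \<delta>, of ?m] by (intro mult_right_mono) auto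
    also have "\<dots> = ?\<kappa>" by (simp add: cover_threshold_def max_connectors_def del: of_nat_Suc)
    finally show ?thesis by simp
  qed
  have "2 * ?\<kappa> \<le> avg D (\<lambda>d. avg X (\<lambda>x. pr X (\<lambda>y. x \<in> U \<and> y \<in> U \<and> link H d x y)))"
    using U(3) by (simp add: cover_density_def)
  also have "\<dots> \<le> avg D (\<lambda>_. q + ?\<kappa>)" using le by (rule avg_mono)
  also have "\<dots> = q + ?\<kappa>" using D by simp
  finally have "?\<kappa> \<le> q" by simp
  moreover have "q + avg X (\<lambda>x. pr X (P x)) = avg X (\<lambda>x. avg X (\<lambda>y. of_bool ((x \<in> U \<and> y \<in> U) \<and> \<not> P x y) + of_bool (P x y)))"
    by (simp only: q_def avg_add)
  moreover have "\<dots> = avg X (\<lambda>x. pr X (\<lambda>y. \<exists>C\<in>set ((D, U) # Cs). x \<in> snd C \<and> y \<in> snd C))"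
    by (intro avg_cong) (auto simp: P_def)
  ultimately show ?thesis
    using conn unfolding P_def by (intro exI[of _ U]) auto
qed

text \<open>The inequality is the potential of the induction: every connector so far has contributed
  \<open>cover_density\<close> to the measure of connected pairs. \<open>F\<close> is the set of
  vertices already used elsewhere.\<close>

definition crossing_data ::
    "nat \<Rightarrow> nat \<Rightarrow> nat \<Rightarrow> real \<Rightarrow> 'a set \<Rightarrow> 'a set set \<Rightarrow> ('a set \<Rightarrow> nat) \<Rightarrow> nat \<Rightarrow> 'a set list \<Rightarrow>
     ('a set \<times> 'a list set) list \<Rightarrow> 'a set \<Rightarrow> 'a set \<Rightarrow> bool" where
  "crossing_data m r \<alpha> \<delta> V E col a Bs Cs R F \<longleftrightarrow>
     admissible (Suc m) r \<alpha> V E col \<and> length Bs = m \<and>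
     (\<forall>A\<in>set Bs \<union> fst ` set Cs. A \<noteq> {} \<and> A \<subseteq> V) \<and>
     (\<forall>C\<in>set Cs. connector Bs {e \<in> E. col e = a} (slack m \<delta>) C) \<and>
     length Cs * cover_density m \<delta>
       \<le> avg (listset Bs) (\<lambda>x. pr (listset Bs) (\<lambda>y. \<exists>C\<in>set Cs. x \<in> snd C \<and> y \<in> snd C)) \<and>
     R \<subseteq> V \<and> (\<forall>b\<in>R. \<delta> \<le> pr (listset Bs) (\<lambda>x. insert b (set x) \<in> {e \<in> E. col e = a})) \<and>
     R \<inter> (F \<union> \<Union>(set Bs \<union> fst ` set Cs)) = {}"

text \<open>Vertices whose links no available connector meets form, together with the tuples, a new
  connector, and each new connector increases the measure of the connected pairs.\<close>

lemma cover_dense_links: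
  assumes \<delta>: "0 < \<delta>"
  shows "\<exists>c K M. \<forall>(V :: 'a set) E col a Bs Cs R F. crossing_data m r \<alpha> \<delta> V E col a Bs Cs R F \<longrightarrow>
    length Cs + n = max_connectors m \<delta> \<longrightarrow>
    (\<forall>A\<in>set Bs \<union> fst ` set Cs. M * (card R + card (F \<inter> A)) \<le> card A) \<longrightarrow>
    extends_to_cover (Suc m) V E col c K (\<Union>(set Bs \<union> fst ` set Cs) - F) R"
proof (induction n)
  case 0
  let ?N = "max_connectors m \<delta>"
  \<comment> \<open>With the maximal number of connectors the potential would exceed 1.\<close>
  have False if d: "crossing_data m r \<alpha> \<delta> V E col a Bs Cs R F" and N: "length Cs + 0 = ?N"
    for V :: "'a set" and E col a Bs Cs R F
  proof -
    from d have "finite V" "\<forall>B\<in>set Bs. B \<subseteq> V \<and> B \<noteq> {}"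
      unfolding crossing_data_def admissible_def k_graph_def by blast+
    then have "\<forall>B\<in>set Bs. finite B \<and> B \<noteq> {}" using finite_subset by blast
    then have X: "finite (listset Bs)" "listset Bs \<noteq> {}"
      by (auto intro!: finite_listset simp: listset_nonempty)
    have "?N * cover_density m \<delta>
        \<le> avg (listset Bs) (\<lambda>x. pr (listset Bs) (\<lambda>y. \<exists>C\<in>set Cs. x \<in> snd C \<and> y \<in> snd C))"
      using d N by (simp add: crossing_data_def)
    also have "\<dots> \<le> 1" using X by (intro avg_le_1 pr_le_1)
    finally show False using max_connectors_gt[OF \<delta>, of m] by linarith
  qed
  then show ?case by (intro exI[of _ 0] allI impI) (rule FalseE)
next
  case (Suc n)
  let ?N = "max_connectors m \<delta>" and ?\<sigma> = "slack m \<delta>" and ?\<eta> = "cover_threshold m \<delta>"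
  obtain c' K' M' :: nat where IH0: "\<forall>(V :: 'a set) E col a Bs Cs R F. crossing_data m r \<alpha> \<delta> V E col a Bs Cs R F \<longrightarrow>
    length Cs + n = ?N \<longrightarrow>
    (\<forall>A\<in>set Bs \<union> fst ` set Cs. M' * (card R + card (F \<inter> A)) \<le> card A) \<longrightarrow>
    extends_to_cover (Suc m) V E col c' K' (\<Union>(set Bs \<union> fst ` set Cs) - F) R"
    using Suc.IH by (elim exE) (rule that)
  note IH = IH0[rule_format]
  \<comment> \<open>The new set \<open>D\<close> is taken from \<open>R\<close> and is not
    comparable with the older sets; this \<tau> makes \<open>M' * card R'\<close> at most
    \<open>card D\<close>, as the induction hypothesis needs.\<close>
  define \<tau> :: real where "\<tau> = 1 / Suc M'"
  have \<tau>: "0 < \<tau>" by (simp add: \<tau>_def)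
  obtain n0 cg where abs0: "\<forall>(V :: 'a set) E col W. admissible (Suc m) r \<alpha> V E col \<longrightarrow> W \<subseteq> V \<longrightarrow> n0 \<le> card W \<longrightarrow> finite W \<longrightarrow>
    (\<exists>A Z R. A \<subseteq> Z \<and> Z \<subseteq> W \<and> R \<subseteq> W - Z \<and> card R \<le> \<tau> * card A \<and> A \<noteq> {} \<and>
      coverable (Suc m) V E col cg (W - Z - R) \<and> (\<forall>Y\<subseteq>A. cycle_set (Suc m) V E col (Z - Y)))"
    using ex_absorber_cover[OF _ \<tau>, of "Suc m" r \<alpha>, where ?'a = 'a] by (elim exE meta_impE) (simp, rule that)
  note abs = abs0[rule_format]
  \<comment> \<open>In \<open>c\<close>: the recursive cycles, the absorbing cycle, the greedy
    cycles, fewer than \<open>n0\<close> single vertices, and one cycle per connector. In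
    \<open>M\<close>: 46 is twice 23 since \<open>Suc (card Rc)\<close> is at most
    \<open>2 * card R\<close>, \<open>K'\<close> accounts for the borrowed set \<open>Y1\<close>,
    and 1 for \<open>F\<close>.\<close>
  define c K M where "c = c' + 1 + cg + n0 + ?N" and "K = K' + 14 * Suc m"
    and "M = M' + nat \<lceil>(46 * Suc m + K' + 1) / ?\<sigma>\<rceil>"
  have "extends_to_cover (Suc m) V E col c K (\<Union>(set Bs \<union> fst ` set Cs) - F) R"
    if d: "crossing_data m r \<alpha> \<delta> V E col a Bs Cs R F" and len: "length Cs + Suc n = ?N"
      and M: "\<forall>A\<in>set Bs \<union> fst ` set Cs. M * (card R + card (F \<inter> A)) \<le> card A"
    for V :: "'a set" and E col a Bs Cs R F
  proof (cases "R = {}")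
    case True
    then show ?thesis by (intro extends_to_coverI[of "{}"]) (auto simp: coverable_empty)
  next
    case R0: False
    define H where "H = {e \<in> E. col e = a}"
    define As where "As = set Bs \<union> fst ` set Cs"
    have G: "admissible (Suc m) r \<alpha> V E col" and lB: "length Bs = m"
      and As: "\<And>A. A \<in> As \<Longrightarrow> A \<noteq> {} \<and> A \<subseteq> V" and conn: "\<And>C. C \<in> set Cs \<Longrightarrow> connector Bs H ?\<sigma> C"
      and pot: "length Cs * cover_density m \<delta>
       \<le> avg (listset Bs) (\<lambda>x. pr (listset Bs) (\<lambda>y. \<exists>C\<in>set Cs. x \<in> snd C \<and> y \<in> snd C))"
      and RV: "R \<subseteq> V" and dens: "\<And>b. b \<in> R \<Longrightarrow> \<delta> \<le> pr (listset Bs) (\<lambda>x. insert b (set x) \<in> H)"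
      and disj: "R \<inter> F = {}" "R \<inter> \<Union>As = {}"
      using d unfolding crossing_data_def As_def H_def by blast+
    have kg: "k_graph (Suc m) V E" and finV: "finite V" using G by (auto simp: admissible_def k_graph_def)
    have fin: "finite R" "\<And>A. A \<in> As \<Longrightarrow> finite A" using RV As finV finite_subset by blast+
    have cR: "1 \<le> card R" using R0 fin by (simp add: Suc_leI card_gt_0_iff)
    have \<sigma>: "length Bs * ?\<sigma> < ?\<eta> / 2" using slack_bound(2)[OF \<delta>] lB by simp
    have M1: "M' * (card R + card (F \<inter> A)) \<le> card A"
      and M2: "(46 * Suc m + K' + 1) * (card R + card (F \<inter> A)) \<le> ?\<sigma> * card A" if A: "A \<in> As" for A
    proof -
      have MA: "M * (card R + card (F \<inter> A)) \<le> card A" using M A by (simp add: As_def)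
      have "M' * (card R + card (F \<inter> A)) \<le> M * (card R + card (F \<inter> A))"
        unfolding M_def by (intro mult_right_mono) auto
      with MA show "M' * (card R + card (F \<inter> A)) \<le> card A" by linarith
      have "(46 * Suc m + K' + 1) / ?\<sigma> \<le> real (nat \<lceil>(46 * Suc m + K' + 1) / ?\<sigma>\<rceil>)" by (rule real_nat_ceiling_ge)
      also have "\<dots> \<le> real M" unfolding M_def by (intro of_nat_mono) simp
      finally have "(46 * Suc m + K' + 1) \<le> ?\<sigma> * M" using slack_pos[OF \<delta>, of m] by (simp add: field_simps)
      then have "(46 * Suc m + K' + 1) * (card R + card (F \<inter> A)) \<le> ?\<sigma> * M * (card R + card (F \<inter> A))"
        by (subst of_nat_mult) (rule mult_right_mono, simp_all only: of_nat_0_le_iff)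
      also have "\<dots> = ?\<sigma> * real (M * (card R + card (F \<inter> A)))" by simp
      also have "\<dots> \<le> ?\<sigma> * card A"
        using MA slack_pos[OF \<delta>, of m] by (intro mult_left_mono) (auto simp only: of_nat_le_iff)
      finally show "(46 * Suc m + K' + 1) * (card R + card (F \<inter> A)) \<le> ?\<sigma> * card A" .
    qed
    define Rc where "Rc = {b\<in>R. \<exists>C\<in>set Cs. ?\<eta> \<le> covering_density Bs H (snd C) b}"
    define Ru where "Ru = R - Rc"
    have R: "R = Ru \<union> Rc" "Ru \<inter> Rc = {}" "Ru \<subseteq> R" "Rc \<subseteq> R" by (auto simp: Rc_def Ru_def)
    have finR: "finite Ru" "finite Rc" using R fin finite_subset by blast+
    have cRc: "card Rc \<le> card R" "card Ru \<le> card R" using R fin by (auto intro: card_mono)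
    have "\<exists>Y\<subseteq>\<Union>As - F. finite Y \<and> card Y \<le> K' * card R \<and> coverable (Suc m) V E col (c' + 1 + cg + n0) (Ru \<union> Y)"
    proof (cases "card Ru < n0")
      case True
      have "coverable (Suc m) V E col (c' + 1 + cg + n0) Ru"
      proof (rule coverable_mono[OF coverable_singletons[OF finR(1)]])
        show "Ru \<subseteq> V" using R(3) RV by (rule order_trans)
        show "card Ru \<le> c' + 1 + cg + n0" using True by simp
      qed
      then show ?thesis by (intro exI[of _ "{}"]) simp
    next
      case False
      have RuV: "Ru \<subseteq> V" "n0 \<le> card Ru" using R RV False by auto
      obtain D Z R' where AZ: "D \<subseteq> Z" "Z \<subseteq> Ru" "R' \<subseteq> Ru - Z" "card R' \<le> \<tau> * card D" "D \<noteq> {}"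
        "coverable (Suc m) V E col cg (Ru - Z - R')" "\<forall>Y\<subseteq>D. cycle_set (Suc m) V E col (Z - Y)"
        using abs[OF G RuV finR(1)] by (elim exE conjE) (rule that)
      have D: "D \<subseteq> R" "finite D" using AZ(1,2) R(3) finR(1) by (auto intro: finite_subset)
      have R': "R' \<subseteq> R" "finite R'" using AZ(3) R(3) finR(1) by (auto intro: finite_subset)
      have sp: "covering_density Bs H (snd C) b \<le> ?\<eta>" if "b \<in> D" "C \<in> set Cs" for b C
        using that AZ(1,2) R(2) D(1) unfolding Rc_def by force
      have "\<exists>U. connector Bs H (slack (length Bs) \<delta>) (D, U) \<and>
        cover_density (length Bs) \<delta> + avg (listset Bs) (\<lambda>x. pr (listset Bs) (\<lambda>y. \<exists>C\<in>set Cs. x \<in> snd C \<and> y \<in> snd C))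
        \<le> avg (listset Bs) (\<lambda>x. pr (listset Bs) (\<lambda>y. \<exists>C\<in>set ((D, U) # Cs). x \<in> snd C \<and> y \<in> snd C))"
      proof (rule ex_new_connector[OF \<delta> _ D(2) AZ(5)])
        show "\<forall>B\<in>set Bs. finite B \<and> B \<noteq> {}" using As fin by (auto simp: As_def)
        show "\<forall>e\<in>H. card e = Suc (length Bs)" using card_edge[OF kg] lB by (auto simp: H_def)
        show "\<delta> \<le> pr (listset Bs) (\<lambda>x. insert d (set x) \<in> H)" if "d \<in> D" for d using dens that D by blast
        show "length Cs \<le> max_connectors (length Bs) \<delta>" using len lB by simp
        show "covering_density Bs H (snd C) d \<le> cover_threshold (length Bs) \<delta>" if "d \<in> D" "C \<in> set Cs" for d C
          using sp[OF that] lB by simp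
      qed
      then obtain U where U: "connector Bs H ?\<sigma> (D, U)"
        "cover_density m \<delta> + avg (listset Bs) (\<lambda>x. pr (listset Bs) (\<lambda>y. \<exists>C\<in>set Cs. x \<in> snd C \<and> y \<in> snd C))
        \<le> avg (listset Bs) (\<lambda>x. pr (listset Bs) (\<lambda>y. \<exists>C\<in>set ((D, U) # Cs). x \<in> snd C \<and> y \<in> snd C))"
        unfolding lB by (elim exE conjE) (rule that)
      have As': "set Bs \<union> fst ` set ((D, U) # Cs) = insert D As" by (auto simp: As_def)
      have "R' \<inter> D = {}" using AZ(1,3) by auto
      then have dis: "R' \<inter> (F \<union> \<Union>(insert D As)) = {}" using disj R'(1) by auto
      have DV: "\<forall>A\<in>insert D As. A \<noteq> {} \<and> A \<subseteq> V" using As AZ(5) D(1) RV by auto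
      have "real (length ((D, U) # Cs)) * cover_density m \<delta>
          = cover_density m \<delta> + length Cs * cover_density m \<delta>" by (simp add: algebra_simps)
      with pot U(2) have pot': "real (length ((D, U) # Cs)) * cover_density m \<delta>
        \<le> avg (listset Bs) (\<lambda>x. pr (listset Bs) (\<lambda>y. \<exists>C\<in>set ((D, U) # Cs). x \<in> snd C \<and> y \<in> snd C))"
        by linarith
      have "crossing_data m r \<alpha> \<delta> V E col a Bs ((D, U) # Cs) R' F"
        unfolding crossing_data_def As' H_def[symmetric]
        using G lB DV pot' dis R'(1) RV dens conn U(1)
        by (intro conjI) (simp_all only: set_simps, blast+)
      moreover have "length ((D, U) # Cs) + n = ?N" using len by simp
      moreover have "M' * (card R' + card (F \<inter> A)) \<le> card A" if A: "A \<in> insert D As" for A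
      proof (cases "A \<in> As")
        case True
        have "M' * (card R' + card (F \<inter> A)) \<le> M' * (card R + card (F \<inter> A))"
          using R' fin by (intro mult_left_mono add_right_mono card_mono) auto
        then show ?thesis using M1[OF True] by linarith
      next
        case False
        then have A: "A = D" using A by simp
        have FD: "F \<inter> D = {}" using disj(1) D(1) by auto
        have "Suc M' * real (card R') \<le> card D" using AZ(4) by (simp add: \<tau>_def field_simps)
        then have "real (Suc M' * card R') \<le> real (card D)" by (simp only: of_nat_mult)
        then have "Suc M' * card R' \<le> card D" by (simp only: of_nat_le_iff)
        then show ?thesis unfolding A FD by simp
      qed
      ultimately have "extends_to_cover (Suc m) V E col c' K' (\<Union>(insert D As) - F) R'"
        using IH[of V E col a Bs "(D, U) # Cs" R' F] unfolding As' by blast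
      then obtain Y where Y: "Y \<subseteq> \<Union>(insert D As) - F" "card Y \<le> K' * card R'"
        "coverable (Suc m) V E col c' (R' \<union> Y)" unfolding extends_to_cover_def by blast
      have "\<Union>(insert D As) \<subseteq> V" using DV by blast
      then have finY: "finite Y" using Y(1) finV by (meson Diff_subset finite_subset order_trans)
      have YR: "Y \<inter> R \<subseteq> D" using Y(1) disj(2) by auto
      \<comment> \<open>What the recursive cover borrows from \<open>D\<close> is dropped from the
        absorbing cycle, so nothing is covered twice.\<close>
      have "cycle_set (Suc m) V E col (Z - (Y \<inter> D))" using AZ(7) by blast
      then have "coverable (Suc m) V E col (c' + 1 + cg) ((R' \<union> Y) \<union> (Z - (Y \<inter> D)) \<union> (Ru - Z - R'))"
        by (intro coverable_Un Y(3) coverable_cycle AZ(6)) (use AZ(1-3) YR R(3) in auto)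
      moreover have "(R' \<union> Y) \<union> (Z - (Y \<inter> D)) \<union> (Ru - Z - R') = Ru \<union> (Y - D)"
        using AZ(1-3) YR R(3) by auto
      ultimately have "coverable (Suc m) V E col (c' + 1 + cg) (Ru \<union> (Y - D))" by (simp only:)
      then have "coverable (Suc m) V E col (c' + 1 + cg + n0) (Ru \<union> (Y - D))"
        by (rule coverable_mono) simp
      moreover have "card (Y - D) \<le> K' * card R"
      proof -
        have "card (Y - D) \<le> card Y" using finY by (intro card_mono) auto
        also have "\<dots> \<le> K' * card R'" by (rule Y(2))
        also have "\<dots> \<le> K' * card R" using R'(1) fin by (intro mult_left_mono card_mono) auto
        finally show ?thesis .
      qed
      ultimately show ?thesis using Y(1) finY by (intro exI[of _ "Y - D"]) auto
    qed
    then obtain Y1 where Y1: "Y1 \<subseteq> \<Union>As - F" "finite Y1" "card Y1 \<le> K' * card R"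
      "coverable (Suc m) V E col (c' + 1 + cg + n0) (Ru \<union> Y1)" by (elim exE conjE) (rule that)
    have "\<exists>Y \<subseteq> \<Union>(set Bs \<union> fst ` set Cs). Y \<inter> (Rc \<union> (F \<union> Y1)) = {} \<and> finite Y \<and>
      card Y \<le> 14 * Suc (length Bs) * card Rc \<and> coverable (Suc (length Bs)) V E col (length Cs) (Rc \<union> Y)"
    proof (rule cover_by_connectors[OF conn _ H_def _ _ _ \<sigma> cover_threshold_pos[OF \<delta>] finR(2)])
      show "k_graph (Suc (length Bs)) V E" using kg lB by simp
      show "\<Union>(set Bs) \<subseteq> V" "\<Union>(fst ` set Cs) \<subseteq> V" using As by (auto simp: As_def)
      show "Rc \<subseteq> V" using R RV by blast
      show "\<exists>C\<in>set Cs. ?\<eta> \<le> covering_density Bs H (snd C) b" if "b \<in> Rc" for b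
        using that by (simp add: Rc_def)
      show "Rc \<inter> (F \<union> Y1) = {}" using disj R(4) Y1(1) by auto
      show "real (card ((F \<union> Y1) \<inter> A) + 23 * Suc (length Bs) * Suc (card Rc)) \<le> ?\<sigma> * card A"
        if A: "A \<in> set Bs \<union> fst ` set Cs" for A
      proof -
        have A': "A \<in> As" using A by (simp add: As_def)
        have "card ((F \<union> Y1) \<inter> A) \<le> card (F \<inter> A \<union> Y1)"
          using fin(2)[OF A'] Y1(2) by (intro card_mono) auto
        also have "\<dots> \<le> card (F \<inter> A) + card Y1" by (rule card_Un_le)
        also have "\<dots> \<le> card (F \<inter> A) + K' * card R" using Y1(3) by simp
        finally have "card ((F \<union> Y1) \<inter> A) \<le> card (F \<inter> A) + K' * card R" .
        moreover have "23 * Suc (length Bs) * Suc (card Rc) \<le> 23 * Suc (length Bs) * (2 * card R)"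
          using cRc(1) cR by (intro mult_left_mono) auto
        moreover have "23 * Suc (length Bs) * (2 * card R) = 46 * Suc m * card R" by (simp add: lB)
        ultimately have "card ((F \<union> Y1) \<inter> A) + 23 * Suc (length Bs) * Suc (card Rc)
            \<le> card (F \<inter> A) + K' * card R + 46 * Suc m * card R" by linarith
        also have "\<dots> \<le> (46 * Suc m + K' + 1) * (card R + card (F \<inter> A))" by (simp add: algebra_simps)
        finally have "real (card ((F \<union> Y1) \<inter> A) + 23 * Suc (length Bs) * Suc (card Rc))
            \<le> real ((46 * Suc m + K' + 1) * (card R + card (F \<inter> A)))" by (rule of_nat_mono)
        also have "\<dots> \<le> ?\<sigma> * card A" using M2[OF A'] by simp
        finally show ?thesis .
      qed
    qed
    then obtain Y2 where Y2: "Y2 \<subseteq> \<Union>As" "Y2 \<inter> (Rc \<union> (F \<union> Y1)) = {}" "finite Y2"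
      "card Y2 \<le> 14 * Suc m * card Rc" "coverable (Suc m) V E col (length Cs) (Rc \<union> Y2)"
      unfolding As_def[symmetric] lB by (elim exE conjE) (rule that)
    have "coverable (Suc m) V E col (c' + 1 + cg + n0 + length Cs) ((Ru \<union> Y1) \<union> (Rc \<union> Y2))"
      using Y1(4) Y2(5) by (rule coverable_Un) (use R Y1(1) Y2(1,2) disj(2) in auto)
    then have "coverable (Suc m) V E col c ((Ru \<union> Y1) \<union> (Rc \<union> Y2))"
      by (rule coverable_mono) (use len in \<open>simp add: c_def\<close>)
    moreover have "(Ru \<union> Y1) \<union> (Rc \<union> Y2) = R \<union> (Y1 \<union> Y2)" using R(1) by auto
    moreover have "card (Y1 \<union> Y2) \<le> K * card R"
    proof -
      have "14 * Suc m * card Rc \<le> 14 * Suc m * card R" using cRc(1) by (intro mult_left_mono) auto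
      then show ?thesis using card_Un_le[of Y1 Y2] Y1(3) Y2(4) unfolding K_def add_mult_distrib by linarith
    qed
    moreover have "Y1 \<union> Y2 \<subseteq> \<Union>As - F" using Y1(1) Y2(1,2) by auto
    ultimately show ?thesis
      unfolding As_def by (intro extends_to_coverI[of "Y1 \<union> Y2"]) auto
  qed
  then show ?case by (intro exI[of _ c] exI[of _ K] exI[of _ M] allI impI)
qed

section \<open>The main induction\<close>

text \<open>One application of \<open>cross\<close> for each pair of a tuple of sets and a colour.
  The factor \<open>Suc K\<close> in the size condition makes room for what the other applications
  have borrowed.\<close>

lemma cover_dense_links_list:
  assumes cross: "\<And>a Bs R F. crossing_data m r \<alpha> \<delta> V E col a Bs [] R F \<Longrightarrow>
      (\<forall>A\<in>set Bs. M * (card R + card (F \<inter> A)) \<le> card A) \<Longrightarrow>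
      extends_to_cover (Suc m) V E col c K (\<Union>(set Bs) - F) R"
    and G: "admissible (Suc m) r \<alpha> V E col"
    and \<A>: "\<And>A. A \<in> \<A> \<Longrightarrow> A \<noteq> {} \<and> A \<subseteq> V"
    and "\<And>Bs a. (Bs, a) \<in> set Ks \<Longrightarrow> length Bs = m \<and> set Bs \<subseteq> \<A>"
    and "R \<subseteq> V" "R \<inter> (F \<union> \<Union>\<A>) = {}"
    and "\<And>b. b \<in> R \<Longrightarrow>
      \<exists>(Bs, a)\<in>set Ks. \<delta> \<le> pr (listset Bs) (\<lambda>x. insert b (set x) \<in> {e \<in> E. col e = a})"
    and "\<And>A. A \<in> \<A> \<Longrightarrow> M * Suc K * (card R + card (F \<inter> A)) \<le> card A"
  shows "extends_to_cover (Suc m) V E col (length Ks * c) K (\<Union>\<A> - F) R"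
  using assms(4-)
proof (induction Ks arbitrary: R)
  case Nil
  then have "R = {}" by auto
  then show ?case by (intro extends_to_coverI[of "{}"]) (auto simp: coverable_empty)
next
  case (Cons k Ks)
  obtain Bs a where k: "k = (Bs, a)" by (cases k)
  have finV: "finite V" using G by (auto simp: admissible_def k_graph_def)
  define B where "B = {b\<in>R. \<delta> \<le> pr (listset Bs) (\<lambda>x. insert b (set x) \<in> {e \<in> E. col e = a})}"
  define R' where "R' = R - B"
  have R: "R = B \<union> R'" "B \<inter> R' = {}" and sub: "B \<subseteq> R" "R' \<subseteq> R" by (auto simp: B_def R'_def)
  have finR: "finite R" using Cons.prems(2) finV by (rule finite_subset)
  have fin: "finite B" "finite R'" using sub finR by (auto intro: finite_subset)
  have cR: "card R = card B + card R'" unfolding R(1) using fin R(2) by (rule card_Un_disjoint)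
  have "extends_to_cover (Suc m) V E col (length Ks * c) K (\<Union>\<A> - F) R'"
  proof (rule Cons.IH)
    show "length Bs' = m \<and> set Bs' \<subseteq> \<A>" if "(Bs', a') \<in> set Ks" for Bs' a'
      using Cons.prems(1)[of Bs' a'] that by simp
    show "R' \<subseteq> V" "R' \<inter> (F \<union> \<Union>\<A>) = {}" using Cons.prems(2,3) sub by auto
    show "\<exists>(Bs, a)\<in>set Ks. \<delta> \<le> pr (listset Bs) (\<lambda>x. insert b (set x) \<in> {e \<in> E. col e = a})"
      if "b \<in> R'" for b
    proof -
      have b: "b \<in> R" "b \<notin> B" using that by (auto simp: R'_def)
      obtain Bs' a' where "(Bs', a') \<in> set (k # Ks)"
        "\<delta> \<le> pr (listset Bs') (\<lambda>x. insert b (set x) \<in> {e \<in> E. col e = a'})"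
        using Cons.prems(4)[OF b(1)] by blast
      then show ?thesis using b unfolding B_def k by auto
    qed
    show "M * Suc K * (card R' + card (F \<inter> A)) \<le> card A" if "A \<in> \<A>" for A
    proof -
      have "M * Suc K * (card R' + card (F \<inter> A)) \<le> M * Suc K * (card R + card (F \<inter> A))"
        unfolding cR by (intro mult_left_mono) auto
      then show ?thesis using Cons.prems(5)[OF that] by linarith
    qed
  qed
  then obtain Y' where Y': "Y' \<subseteq> \<Union>\<A> - F" "card Y' \<le> K * card R'"
    "coverable (Suc m) V E col (length Ks * c) (R' \<union> Y')" unfolding extends_to_cover_def by blast
  have "Y' \<subseteq> V" using Y'(1) \<A> by blast
  then have finY': "finite Y'" using finV by (rule finite_subset)
  have Bs: "length Bs = m" "set Bs \<subseteq> \<A>" using Cons.prems(1)[of Bs a] by (auto simp: k)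
  have "extends_to_cover (Suc m) V E col c K (\<Union>(set Bs) - (F \<union> Y')) B"
  proof (rule cross)
    have 1: "0 \<le> avg (listset Bs) (\<lambda>x. pr (listset Bs) (\<lambda>y. \<exists>C\<in>set ([] :: ('a set \<times> 'a list set) list). x \<in> snd C \<and> y \<in> snd C))"
      by (intro avg_nonneg) simp
    have 2: "\<forall>A\<in>set Bs \<union> fst ` set ([] :: ('a set \<times> 'a list set) list). A \<noteq> {} \<and> A \<subseteq> V"
      using Bs(2) \<A> by auto
    have "\<Union>(set Bs) \<subseteq> \<Union>\<A>" using Bs(2) by blast
    then have 3: "B \<inter> (F \<union> Y' \<union> \<Union>(set Bs \<union> fst ` set ([] :: ('a set \<times> 'a list set) list))) = {}"
      using Cons.prems(3) sub Y'(1) by auto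
    show "crossing_data m r \<alpha> \<delta> V E col a Bs [] B (F \<union> Y')"
      unfolding crossing_data_def using G Bs(1) 1 2 3 Cons.prems(2) sub(1)
      by (auto simp: B_def)
    show "\<forall>A\<in>set Bs. M * (card B + card ((F \<union> Y') \<inter> A)) \<le> card A"
    proof
      fix A assume "A \<in> set Bs"
      then have A: "A \<in> \<A>" using Bs(2) by blast
      have finA: "finite A" using \<A>[OF A] finV finite_subset by blast
      have "card ((F \<union> Y') \<inter> A) \<le> card (F \<inter> A \<union> Y')"
        using finA finY' by (intro card_mono) auto
      also have "\<dots> \<le> card (F \<inter> A) + card Y'" by (rule card_Un_le)
      also have "\<dots> \<le> card (F \<inter> A) + K * card R" using Y'(2) unfolding cR by (simp add: algebra_simps)
      finally have "card B + card ((F \<union> Y') \<inter> A) \<le> Suc K * (card R + card (F \<inter> A))"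
        unfolding cR by (simp add: algebra_simps)
      then have "M * (card B + card ((F \<union> Y') \<inter> A)) \<le> M * (Suc K * (card R + card (F \<inter> A)))"
        by (rule mult_left_mono) simp
      also have "\<dots> \<le> card A" using Cons.prems(5)[OF A] by (simp only: mult.assoc)
      finally show "M * (card B + card ((F \<union> Y') \<inter> A)) \<le> card A" .
    qed
  qed
  then obtain Y where Y: "Y \<subseteq> \<Union>(set Bs) - (F \<union> Y')" "card Y \<le> K * card B"
    "coverable (Suc m) V E col c (B \<union> Y)" unfolding extends_to_cover_def by blast
  have YA: "Y \<subseteq> \<Union>\<A> - F" using Y(1) Bs(2) by blast
  have "coverable (Suc m) V E col (c + length Ks * c) ((B \<union> Y) \<union> (R' \<union> Y'))"
    using Y(3) Y'(3) by (rule coverable_Un) (use R Y(1) Y'(1) YA Cons.prems(3) sub in auto)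
  moreover have "(B \<union> Y) \<union> (R' \<union> Y') = R \<union> (Y \<union> Y')" using R by auto
  moreover have "card (Y \<union> Y') \<le> K * card R"
    using card_Un_le[of Y Y'] Y(2) Y'(2) unfolding cR by (simp add: algebra_simps)
  ultimately show ?case using YA Y'(1) by (intro extends_to_coverI[of "Y \<union> Y'"]) auto
qed

section \<open>Edges in transversals of the absorbers\<close>

definition edge_density :: "nat \<Rightarrow> 'a set set \<Rightarrow> 'a set list \<Rightarrow> real" where
  "edge_density k E As = pr (listset As) (\<lambda>x. \<exists>y\<in>set (subseqs x). length y = k \<and> set y \<in> E)"

text \<open>An edge in a transversal of \<open>D # As\<close> either misses the new coordinate
  \<open>b\<close> or consists of \<open>b\<close> and \<open>m\<close> further entries. The second
  case is a union bound over at most 2^(length As) sublists and \<open>r\<close> colours.\<close>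

lemma edge_density_Cons:
  fixes \<delta> :: real
  assumes G: "edge_colouring r E col" and As: "\<forall>A\<in>set As. finite A \<and> A \<noteq> {}" and D: "finite D" "D \<noteq> {}"
    and sparse: "\<And>b Bs a. b \<in> D \<Longrightarrow> Bs \<in> set (subseqs As) \<Longrightarrow> length Bs = m \<Longrightarrow> a < r \<Longrightarrow>
      pr (listset Bs) (\<lambda>x. insert b (set x) \<in> {e \<in> E. col e = a}) \<le> \<delta>"
    and \<delta>: "0 \<le> \<delta>"
  shows "edge_density (Suc m) E (D # As) \<le> 2 ^ length As * (r * \<delta>) + edge_density (Suc m) E As"
proof -
  have X: "finite (listset As)" "listset As \<noteq> {}"
    using As by (auto intro!: finite_listset simp: listset_nonempty)
  define Q where "Q y \<longleftrightarrow> length y = Suc m \<and> set y \<in> E" for y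
  have "edge_density (Suc m) E (D # As)
      = avg D (\<lambda>b. pr (listset As) (\<lambda>x. (\<exists>y\<in>set (subseqs x). Q (b # y)) \<or> (\<exists>y\<in>set (subseqs x). Q y)))"
    unfolding edge_density_def avg_listset_Cons Q_def[symmetric]
    by (intro avg_cong arg_cong[of _ _ of_bool]) (auto simp: Let_def)
  also have "\<dots> \<le> avg D (\<lambda>b. 2 ^ length As * (r * \<delta>) + edge_density (Suc m) E As)"
  proof (rule avg_mono)
    fix b assume b: "b \<in> D"
    have "pr (listset As) (\<lambda>x. \<exists>y\<in>set (subseqs x). Q (b # y)) \<le> (\<Sum>Bs\<leftarrow>subseqs As. pr (listset Bs) (\<lambda>y. Q (b # y)))"
      using As by (rule pr_subseqs)
    also have "\<dots> \<le> (\<Sum>Bs\<leftarrow>subseqs As. r * \<delta>)"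
    proof (rule sum_list_mono)
      fix Bs assume Bs: "Bs \<in> set (subseqs As)"
      show "pr (listset Bs) (\<lambda>y. Q (b # y)) \<le> r * \<delta>"
      proof (cases "length Bs = m")
        case True
        have "pr (listset Bs) (\<lambda>y. Q (b # y))
            \<le> avg (listset Bs) (\<lambda>y. \<Sum>a<r. of_bool (insert b (set y) \<in> {e \<in> E. col e = a}))"
        proof (rule avg_mono)
          fix y
          let ?f = "\<lambda>a. of_bool (insert b (set y) \<in> {e \<in> E. col e = a}) :: real"
          show "of_bool (Q (b # y)) \<le> sum ?f {..<r}"
          proof (cases "Q (b # y)")
            case True
            then have e: "insert b (set y) \<in> E" by (simp add: Q_def)
            then have "?f (col (insert b (set y))) \<le> sum ?f {..<r}"
              using G by (intro member_le_sum) (auto simp: edge_colouring_def)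
            then show ?thesis using True e by simp
          qed (simp add: sum_nonneg)
        qed
        also have "\<dots> = (\<Sum>a<r. pr (listset Bs) (\<lambda>y. insert b (set y) \<in> {e \<in> E. col e = a}))" by (rule avg_sum)
        also have "\<dots> \<le> (\<Sum>a<r. \<delta>)" using sparse[OF b Bs True] by (intro sum_mono) simp
        finally show ?thesis by simp
      next
        case False
        have "pr (listset Bs) (\<lambda>y. Q (b # y)) \<le> avg (listset Bs) (\<lambda>_. 0)"
          using False by (intro avg_mono) (auto simp: Q_def dest: length_listset)
        also have "\<dots> = 0" by (simp add: avg_def)
        also have "0 \<le> r * \<delta>" using \<delta> by simp
        finally show ?thesis .
      qed
    qed
    also have "\<dots> = 2 ^ length As * (r * \<delta>)" by (simp add: sum_list_triv length_subseqs)
    finally show "pr (listset As) (\<lambda>x. (\<exists>y\<in>set (subseqs x). Q (b # y)) \<or> (\<exists>y\<in>set (subseqs x). Q y))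
        \<le> 2 ^ length As * (r * \<delta>) + edge_density (Suc m) E As"
      unfolding edge_density_def Q_def[symmetric] by (intro order_trans[OF pr_disj] add_right_mono)
  qed
  also have "\<dots> = 2 ^ length As * (r * \<delta>) + edge_density (Suc m) E As" using D by simp
  finally show ?thesis .
qed

text \<open>The parameter \<theta> is the increase of edge density allowed for each absorber
  added.\<close>

definition base_data ::
    "nat \<Rightarrow> nat \<Rightarrow> nat \<Rightarrow> real \<Rightarrow> 'a set \<Rightarrow> 'a set set \<Rightarrow> ('a set \<Rightarrow> nat) \<Rightarrow> 'a set list \<Rightarrow> 'a set \<Rightarrow> bool" where
  "base_data m r \<alpha> \<theta> V E col As R \<longleftrightarrow> admissible (Suc m) r \<alpha> V E col \<and>
     (\<forall>A\<in>set As. A \<noteq> {} \<and> A \<subseteq> V) \<and> (\<forall>x\<in>listset As. distinct x) \<and>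
     edge_density (Suc m) E As \<le> real (length As) * \<theta> \<and> R \<subseteq> V \<and> R \<inter> \<Union>(set As) = {}"

text \<open>This value of \<theta> would leave edge density at most 1/2, whereas the entries of a
  transversal form an (\<alpha> + 1)-set, so every transversal contains an edge.\<close>

lemma base_data_length:
  assumes "base_data m r \<alpha> (1 / (2 * real (Suc \<alpha>))) V E col As R"
  shows "length As \<noteq> Suc \<alpha>"
proof
  assume len: "length As = Suc \<alpha>"
  have G: "admissible (Suc m) r \<alpha> V E col" and kg: "k_graph (Suc m) V E" and finV: "finite V"
    and As: "\<forall>A\<in>set As. A \<subseteq> V \<and> A \<noteq> {}" and dist: "\<forall>x\<in>listset As. distinct x"
    and dens: "edge_density (Suc m) E As \<le> real (length As) * (1 / (2 * real (Suc \<alpha>)))"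
    using assms unfolding base_data_def admissible_def k_graph_def by blast+
  have "\<forall>A\<in>set As. finite A \<and> A \<noteq> {}" using As finV finite_subset by blast
  then have X: "finite (listset As)" "listset As \<noteq> {}"
    by (auto intro!: finite_listset simp: listset_nonempty)
  have "1 = avg (listset As) (\<lambda>_. 1)" using X by simp
  also have "\<dots> \<le> edge_density (Suc m) E As"
    unfolding edge_density_def
  proof (rule avg_mono)
    fix x assume x: "x \<in> listset As"
    have dx: "distinct x" using dist x by blast
    have "set x \<subseteq> V" using set_listset[OF x] As by blast
    moreover have "card (set x) = Suc \<alpha>" using length_listset[OF x] dx len by (simp add: distinct_card)
    ultimately obtain e where e: "e \<in> E" "e \<subseteq> set x" using G unfolding admissible_def by blast
    have "e \<in> set ` set (subseqs x)" using e(2) by (simp add: subseqs_powset)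
    then obtain y where y: "y \<in> set (subseqs x)" "set y = e" by blast
    have "distinct y" using subseqs_distinctD[OF y(1) dx] .
    then have "length y = card e" using y(2) by (simp add: distinct_card flip: y(2))
    also have "\<dots> = Suc m" using card_edge[OF kg e(1)] by simp
    finally show "1 \<le> (of_bool (\<exists>y\<in>set (subseqs x). length y = Suc m \<and> set y \<in> E) :: real)"
      using y e(1) by auto
  qed
  also have "\<dots> \<le> 1 / 2" using dens unfolding len by (simp del: of_nat_Suc)
  finally show False by simp
qed

text \<open>The induction is on the number of absorbers still missing. Vertices with a dense link to
  some \<open>m\<close> of the absorbers are left to the connectors; the others either are few or
  yield the next absorber, whose links are all sparse.\<close>

lemma extends_to_cover_base:
  fixes m r \<alpha> :: nat
  defines "\<theta> \<equiv> 1 / (2 * real (Suc \<alpha>))"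
  shows "\<exists>c K M. \<forall>(V :: 'a set) E col As R. base_data m r \<alpha> \<theta> V E col As R \<longrightarrow> length As + n = Suc \<alpha> \<longrightarrow>
    (\<forall>A\<in>set As. M * card R \<le> card A) \<longrightarrow> extends_to_cover (Suc m) V E col c K (\<Union>(set As)) R"
proof (induction n)
  case 0
  have False if "base_data m r \<alpha> \<theta> V E col As R" "length As + 0 = Suc \<alpha>" for V :: "'a set" and E col As R
    using that base_data_length[of m r \<alpha> V E col As R] by (simp add: \<theta>_def)
  then show ?case by (intro exI[of _ 0] allI impI) (rule FalseE)
next
  case (Suc n)
  obtain c' K' M' :: nat where IH0: "\<forall>(V :: 'a set) E col As R. base_data m r \<alpha> \<theta> V E col As R \<longrightarrow>
    length As + n = Suc \<alpha> \<longrightarrow>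
    (\<forall>A\<in>set As. M' * card R \<le> card A) \<longrightarrow> extends_to_cover (Suc m) V E col c' K' (\<Union>(set As)) R"
    using Suc.IH by (elim exE) (rule that)
  note IH = IH0[rule_format]
  \<comment> \<open>Chosen so that the union bound of \<open>edge_density_Cons\<close> costs at most
    \<theta>; \<open>Suc r\<close> keeps the denominator positive.\<close>
  define \<delta> where "\<delta> = \<theta> / (2 ^ Suc \<alpha> * real (Suc r))"
  have \<delta>: "0 < \<delta>" unfolding \<delta>_def \<theta>_def
    by (intro divide_pos_pos mult_pos_pos zero_less_power) auto
  obtain cx Kx Mx :: nat where cross0: "\<forall>(V :: 'a set) E col a Bs Cs R F. crossing_data m r \<alpha> \<delta> V E col a Bs Cs R F \<longrightarrow>
    length Cs + max_connectors m \<delta> = max_connectors m \<delta> \<longrightarrow>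
    (\<forall>A\<in>set Bs \<union> fst ` set Cs. Mx * (card R + card (F \<inter> A)) \<le> card A) \<longrightarrow>
    extends_to_cover (Suc m) V E col cx Kx (\<Union>(set Bs \<union> fst ` set Cs) - F) R"
    using cover_dense_links[OF \<delta>, of m r \<alpha> "max_connectors m \<delta>", where ?'a = 'a] by (elim exE) (rule that)
  have cross: "extends_to_cover (Suc m) V E col cx Kx (\<Union>(set Bs) - F) R"
    if "crossing_data m r \<alpha> \<delta> V E col a Bs [] R F" "\<forall>A\<in>set Bs. Mx * (card R + card (F \<inter> A)) \<le> card A"
    for V :: "'a set" and E col a Bs R F
    using cross0[rule_format, of V E col a Bs "[]" R F] that by simp
  define \<tau> :: real where "\<tau> = 1 / Suc M'"
  have \<tau>: "0 < \<tau>" by (simp add: \<tau>_def)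
  obtain n0 cg where abs0: "\<forall>(V :: 'a set) E col W. admissible (Suc m) r \<alpha> V E col \<longrightarrow> W \<subseteq> V \<longrightarrow> n0 \<le> card W \<longrightarrow> finite W \<longrightarrow>
    (\<exists>A Z R. A \<subseteq> Z \<and> Z \<subseteq> W \<and> R \<subseteq> W - Z \<and> card R \<le> \<tau> * card A \<and> A \<noteq> {} \<and>
      coverable (Suc m) V E col cg (W - Z - R) \<and> (\<forall>Y\<subseteq>A. cycle_set (Suc m) V E col (Z - Y)))"
    using ex_absorber_cover[OF _ \<tau>, of "Suc m" r \<alpha>, where ?'a = 'a] by (elim exE meta_impE) (simp, rule that)
  note abs = abs0[rule_format]
  \<comment> \<open>There are at most \<open>2 ^ Suc \<alpha> * r\<close> pairs of a sublist and a
    colour. In \<open>M\<close>, \<open>Suc K'\<close> covers the borrowed set \<open>Y1\<close>,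
    which is forbidden when \<open>Rd\<close> is treated, and \<open>Suc Kx\<close> is the factor
    demanded by \<open>cover_dense_links_list\<close>.\<close>
  define c K M where "c = c' + 1 + cg + n0 + 2 ^ Suc \<alpha> * r * cx" and "K = K' + Kx"
    and "M = M' + Mx * Suc Kx * Suc K'"
  have "extends_to_cover (Suc m) V E col c K (\<Union>(set As)) R"
    if d: "base_data m r \<alpha> \<theta> V E col As R" and len: "length As + Suc n = Suc \<alpha>"
      and M: "\<forall>A\<in>set As. M * card R \<le> card A"
    for V :: "'a set" and E col As R
  proof -
    have G: "admissible (Suc m) r \<alpha> V E col" and kg: "k_graph (Suc m) V E" and colr: "edge_colouring r E col"
      and finV: "finite V" and As: "\<And>A. A \<in> set As \<Longrightarrow> A \<noteq> {} \<and> A \<subseteq> V"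
      and dist: "\<And>x. x \<in> listset As \<Longrightarrow> distinct x"
      and ed: "edge_density (Suc m) E As \<le> real (length As) * \<theta>"
      and RV: "R \<subseteq> V" and disj: "R \<inter> \<Union>(set As) = {}"
      using d unfolding base_data_def admissible_def k_graph_def by blast+
    have finA: "\<forall>A\<in>set As. finite A \<and> A \<noteq> {}" using As finV finite_subset by blast
    have finR: "finite R" using RV finV by (rule finite_subset)
    define Ks where "Ks = List.product (filter (\<lambda>Bs. length Bs = m) (subseqs As)) [0..<r]"
    define Rd where "Rd = {b\<in>R. \<exists>(Bs, a)\<in>set Ks. \<delta> \<le> pr (listset Bs) (\<lambda>x. insert b (set x) \<in> {e \<in> E. col e = a})}"
    define Rs where "Rs = R - Rd"
    have R: "R = Rs \<union> Rd" "Rs \<inter> Rd = {}" "Rs \<subseteq> R" "Rd \<subseteq> R" by (auto simp: Rd_def Rs_def)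
    have fin: "finite Rs" "finite Rd" using R(3,4) finR by (auto intro: finite_subset)
    have cRd: "card Rd \<le> card R" using R(4) finR by (intro card_mono)
    have "\<exists>Y\<subseteq>\<Union>(set As). finite Y \<and> card Y \<le> K' * card R \<and> coverable (Suc m) V E col (c' + 1 + cg + n0) (Rs \<union> Y)"
    proof (cases "card Rs < n0")
      case True
      have "coverable (Suc m) V E col (c' + 1 + cg + n0) Rs"
      proof (rule coverable_mono[OF coverable_singletons[OF fin(1)]])
        show "Rs \<subseteq> V" using R(3) RV by (rule order_trans)
        show "card Rs \<le> c' + 1 + cg + n0" using True by simp
      qed
      then show ?thesis by (intro exI[of _ "{}"]) simp
    next
      case False
      have RsV: "Rs \<subseteq> V" "n0 \<le> card Rs" using R(3) RV False by auto
      obtain D Z R' where AZ: "D \<subseteq> Z" "Z \<subseteq> Rs" "R' \<subseteq> Rs - Z" "card R' \<le> \<tau> * card D" "D \<noteq> {}"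
        "coverable (Suc m) V E col cg (Rs - Z - R')" "\<forall>Y\<subseteq>D. cycle_set (Suc m) V E col (Z - Y)"
        using abs[OF G RsV fin(1)] by (elim exE conjE) (rule that)
      have D: "D \<subseteq> R" "finite D" using AZ(1,2) R(3) fin(1) by (auto intro: finite_subset)
      have R': "R' \<subseteq> R" "finite R'" using AZ(3) R(3) fin(1) by (auto intro: finite_subset)
      have "edge_density (Suc m) E (D # As) \<le> 2 ^ length As * (r * \<delta>) + edge_density (Suc m) E As"
      proof (rule edge_density_Cons[OF colr finA D(2) AZ(5)])
        fix b Bs a assume b: "b \<in> D" "Bs \<in> set (subseqs As)" "length Bs = m" "a < r"
        then have "(Bs, a) \<in> set Ks" by (simp add: Ks_def)
        moreover have "b \<in> R" "b \<notin> Rd" using b(1) AZ(1,2) R(2,3) by auto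
        ultimately show "pr (listset Bs) (\<lambda>x. insert b (set x) \<in> {e \<in> E. col e = a}) \<le> \<delta>"
          unfolding Rd_def by force
      qed (use \<delta> in simp)
      also have "2 ^ length As * (r * \<delta>) \<le> \<theta>"
      proof -
        have "(2::real) ^ length As \<le> 2 ^ Suc \<alpha>" using len by (intro power_increasing) auto
        then have "2 ^ length As * (r * \<delta>) \<le> 2 ^ Suc \<alpha> * (Suc r * \<delta>)"
          using \<delta> by (intro mult_mono mult_right_mono) auto
        also have "\<dots> = \<theta>" unfolding \<delta>_def by (simp del: power_Suc of_nat_Suc)
        finally show ?thesis .
      qed
      finally have ed': "edge_density (Suc m) E (D # As) \<le> real (length (D # As)) * \<theta>"
        using ed by (simp add: algebra_simps)
      have DAs: "D \<inter> \<Union>(set As) = {}" using D(1) disj by auto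
      have dist': "distinct x" if x: "x \<in> listset (D # As)" for x
      proof -
        obtain b z where bz: "x = b # z" "b \<in> D" "z \<in> listset As" using x by (auto simp: set_Cons_def)
        then show ?thesis using dist[OF bz(3)] set_listset[OF bz(3)] DAs by auto
      qed
      have U: "\<Union>(set (D # As)) = D \<union> \<Union>(set As)" by simp
      have "R' \<inter> D = {}" using AZ(1,3) by auto
      then have dis: "R' \<inter> \<Union>(set (D # As)) = {}" unfolding U using disj R'(1) by auto
      have "\<forall>A\<in>set (D # As). A \<noteq> {} \<and> A \<subseteq> V" using As AZ(5) D(1) RV by auto
      then have "base_data m r \<alpha> \<theta> V E col (D # As) R'"
        unfolding base_data_def using G dist' ed' dis R'(1) RV by (intro conjI) auto
      moreover have "length (D # As) + n = Suc \<alpha>" using len by simp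
      moreover have "M' * card R' \<le> card A" if A: "A \<in> set (D # As)" for A
      proof (cases "A \<in> set As")
        case True
        have "M' * card R' \<le> M * card R"
          using R' finR unfolding M_def by (intro mult_le_mono card_mono) auto
        then show ?thesis using M True by fastforce
      next
        case False
        then have A: "A = D" using A by simp
        have "Suc M' * real (card R') \<le> card D" using AZ(4) by (simp add: \<tau>_def field_simps)
        then have "real (Suc M' * card R') \<le> real (card D)" by (simp only: of_nat_mult)
        then have "Suc M' * card R' \<le> card D" by (simp only: of_nat_le_iff)
        then show ?thesis unfolding A by simp
      qed
      ultimately have "extends_to_cover (Suc m) V E col c' K' (\<Union>(set (D # As))) R'"
        by (intro IH) auto
      then obtain Y where Y: "Y \<subseteq> D \<union> \<Union>(set As)" "card Y \<le> K' * card R'"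
        "coverable (Suc m) V E col c' (R' \<union> Y)" unfolding extends_to_cover_def U by blast
      have "D \<union> \<Union>(set As) \<subseteq> V" using As D(1) RV by blast
      then have finY: "finite Y" using Y(1) finV by (meson finite_subset order_trans)
      have YR: "Y \<inter> R \<subseteq> D" using Y(1) disj by auto
      have "cycle_set (Suc m) V E col (Z - (Y \<inter> D))" using AZ(7) by blast
      then have "coverable (Suc m) V E col (c' + 1 + cg) ((R' \<union> Y) \<union> (Z - (Y \<inter> D)) \<union> (Rs - Z - R'))"
        by (intro coverable_Un Y(3) coverable_cycle AZ(6)) (use AZ(1-3) YR R(3) in auto)
      moreover have "(R' \<union> Y) \<union> (Z - (Y \<inter> D)) \<union> (Rs - Z - R') = Rs \<union> (Y - D)"
        using AZ(1-3) YR R(3) by auto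
      ultimately have "coverable (Suc m) V E col (c' + 1 + cg) (Rs \<union> (Y - D))" by (simp only:)
      then have "coverable (Suc m) V E col (c' + 1 + cg + n0) (Rs \<union> (Y - D))"
        by (rule coverable_mono) simp
      moreover have "card (Y - D) \<le> K' * card R"
      proof -
        have "card (Y - D) \<le> card Y" using finY by (intro card_mono) auto
        also have "\<dots> \<le> K' * card R'" by (rule Y(2))
        also have "\<dots> \<le> K' * card R" using R'(1) finR by (intro mult_left_mono card_mono) auto
        finally show ?thesis .
      qed
      ultimately show ?thesis using Y(1) finY by (intro exI[of _ "Y - D"]) auto
    qed
    then obtain Y1 where Y1: "Y1 \<subseteq> \<Union>(set As)" "finite Y1" "card Y1 \<le> K' * card R"
      "coverable (Suc m) V E col (c' + 1 + cg + n0) (Rs \<union> Y1)" by (elim exE conjE) (rule that)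
    have "extends_to_cover (Suc m) V E col (length Ks * cx) Kx (\<Union>(set As) - Y1) Rd"
    proof (rule cover_dense_links_list[OF cross G As])
      show "length Bs = m \<and> set Bs \<subseteq> set As" if "(Bs, a) \<in> set Ks" for Bs a
      proof -
        have Bs: "Bs \<in> set (subseqs As)" "length Bs = m" using that by (auto simp: Ks_def)
        then have "set Bs \<in> set ` set (subseqs As)" by blast
        then have "set Bs \<subseteq> set As" unfolding subseqs_powset by blast
        with Bs show ?thesis by simp
      qed
      show "Rd \<subseteq> V" using R(4) RV by (rule order_trans)
      show "Rd \<inter> (Y1 \<union> \<Union>(set As)) = {}" using R(4) disj Y1(1) by auto
      show "\<exists>(Bs, a)\<in>set Ks. \<delta> \<le> pr (listset Bs) (\<lambda>x. insert b (set x) \<in> {e \<in> E. col e = a})"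
        if "b \<in> Rd" for b using that unfolding Rd_def by blast
      show "Mx * Suc Kx * (card Rd + card (Y1 \<inter> A)) \<le> card A" if A: "A \<in> set As" for A
      proof -
        have "card (Y1 \<inter> A) \<le> card Y1" using Y1(2) by (intro card_mono) auto
        then have "card Rd + card (Y1 \<inter> A) \<le> Suc K' * card R" using Y1(3) cRd by simp
        then have "Mx * Suc Kx * (card Rd + card (Y1 \<inter> A)) \<le> Mx * Suc Kx * (Suc K' * card R)"
          by (rule mult_left_mono) simp
        also have "\<dots> = Mx * Suc Kx * Suc K' * card R" by (simp only: mult.assoc)
        also have "\<dots> \<le> M * card R" unfolding M_def by (rule mult_right_mono) simp_all
        also have "\<dots> \<le> card A" using M A by blast
        finally show ?thesis .
      qed
    qed
    then obtain Y2 where Y2: "Y2 \<subseteq> \<Union>(set As) - Y1" "card Y2 \<le> Kx * card Rd"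
      "coverable (Suc m) V E col (length Ks * cx) (Rd \<union> Y2)" unfolding extends_to_cover_def by blast
    have lKs: "length Ks * cx \<le> 2 ^ Suc \<alpha> * r * cx"
    proof -
      have "length Ks \<le> length (subseqs As) * r" by (simp add: Ks_def)
      also have "\<dots> \<le> 2 ^ Suc \<alpha> * r"
        unfolding length_subseqs using len by (intro mult_right_mono power_increasing) auto
      finally show ?thesis by (rule mult_right_mono) simp
    qed
    have "coverable (Suc m) V E col (c' + 1 + cg + n0 + length Ks * cx) ((Rs \<union> Y1) \<union> (Rd \<union> Y2))"
      using Y1(4) Y2(3) by (rule coverable_Un) (use R Y1(1) Y2(1) disj in auto)
    then have "coverable (Suc m) V E col c ((Rs \<union> Y1) \<union> (Rd \<union> Y2))"
      by (rule coverable_mono) (use lKs in \<open>simp add: c_def\<close>)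
    moreover have "(Rs \<union> Y1) \<union> (Rd \<union> Y2) = R \<union> (Y1 \<union> Y2)" using R(1) by auto
    moreover have "card (Y1 \<union> Y2) \<le> K * card R"
    proof -
      have "Kx * card Rd \<le> Kx * card R" using cRd by (intro mult_left_mono) auto
      then show ?thesis using card_Un_le[of Y1 Y2] Y1(3) Y2(2) unfolding K_def add_mult_distrib by linarith
    qed
    moreover have "Y1 \<union> Y2 \<subseteq> \<Union>(set As)" using Y1(1) Y2(1) by auto
    ultimately show ?thesis by (intro extends_to_coverI[of "Y1 \<union> Y2"]) auto
  qed
  then show ?case by (intro exI[of _ c] exI[of _ K] exI[of _ M] allI impI)
qed

section \<open>From the independence number to the uniform bound\<close>

lemma independence_number_admissible:
  assumes G: "k_graph k V E" "independence_number V E \<le> \<alpha>" "edge_colouring r E col"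
  shows "admissible k r \<alpha> V E col"
proof -
  have finV: "finite V" using G(1) by (simp add: k_graph_def)
  have "\<exists>e\<in>E. e \<subseteq> S" if S: "S \<subseteq> V" "card S = Suc \<alpha>" for S
  proof (rule ccontr)
    assume "\<not> ?thesis"
    then have "independent_set V E S" using S(1) unfolding independent_set_def by blast
    moreover have "finite {S. independent_set V E S}"
      by (rule finite_subset[of _ "Pow V"]) (use finV in \<open>auto simp: independent_set_def\<close>)
    ultimately have "card S \<le> independence_number V E"
      unfolding independence_number_def by (intro Max_ge) auto
    then show False using G(2) S(2) by simp
  qed
  then show ?thesis using G(1,3) by (simp add: admissible_def)
qed

text \<open>For \<open>k = 0\<close> only the empty set can be an edge, and it is one as soon as
  \<open>V\<close> has more than \<alpha> vertices. All windows are then this edge, so any ordering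
  of \<open>V\<close> is a monochromatic cycle.\<close>

lemma coverable_0_uniform:
  assumes "admissible 0 r \<alpha> V E col"
  shows "coverable 0 V E col (Suc \<alpha>) V"
proof -
  have finV: "finite V" and E: "E \<subseteq> {{}}"
    using assms by (auto simp: admissible_def k_graph_def nsets_def)
  show ?thesis
  proof (cases "card V \<le> \<alpha>")
    case True
    then show ?thesis using coverable_mono[OF coverable_singletons[OF finV, of V 0 E col]] by simp
  next
    case False
    then have "Suc \<alpha> \<le> card V" by simp
    then obtain S where "S \<subseteq> V" "card S = Suc \<alpha>" by (rule obtain_subset_with_card_n)
    then have "\<exists>e\<in>E. e \<subseteq> S" using assms by (simp add: admissible_def)
    then have "E = {{}}" using E by blast
    obtain vs where vs: "set vs = V" "distinct vs" using finite_distinct_list[OF finV] by blast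
    have "vs \<noteq> []" using vs(1) False by auto
    then have "mono_tight_cycle 0 V E col vs"
      using vs \<open>E = {{}}\<close> by (auto simp: mono_tight_cycle_def tight_cycle_edges_def cyclic_window_def)
    then have "cycle_set 0 V E col V" using vs unfolding cycle_set_def by blast
    then have "coverable 0 V E col 1 V" by (rule coverable_cycle)
    then show ?thesis by (rule coverable_mono) simp
  qed
qed

lemma ex_cover_bound:
  "\<exists>c. \<forall>(V :: 'a set) E col. admissible k r \<alpha> V E col \<longrightarrow> coverable k V E col c V"
proof (cases k)
  case 0
  then show ?thesis by (intro exI[of _ "Suc \<alpha>"]) (simp add: coverable_0_uniform)
next
  case (Suc m)
  obtain c K M :: nat where *: "\<forall>(V :: 'a set) E col As R. base_data m r \<alpha> (1 / (2 * real (Suc \<alpha>))) V E col As R \<longrightarrow>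
    length As + Suc \<alpha> = Suc \<alpha> \<longrightarrow>
    (\<forall>A\<in>set As. M * card R \<le> card A) \<longrightarrow> extends_to_cover (Suc m) V E col c K (\<Union>(set As)) R"
    using extends_to_cover_base[of m r \<alpha> "Suc \<alpha>", where ?'a = 'a] by (elim exE) (rule that)
  have "coverable k V E col c V" if G: "admissible k r \<alpha> V E col" for V :: "'a set" and E col
  proof -
    \<comment> \<open>The induction starts without absorbers and with \<open>V\<close> as remainder;
      nothing can be borrowed, so the cover obtained is one of \<open>V\<close> itself.\<close>
    have "base_data m r \<alpha> (1 / (2 * real (Suc \<alpha>))) V E col [] V"
      using G by (simp add: base_data_def Suc edge_density_def avg_def)
    then have "extends_to_cover (Suc m) V E col c K {} V"
      using *[rule_format, of V E col "[]" V] by simp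
    then show ?thesis by (simp add: extends_to_cover_def Suc)
  qed
  then show ?thesis by (intro exI[of _ c] allI impI)
qed

theorem theorem1p4:
  "\<forall>k r \<alpha> :: nat. \<exists>c :: nat. \<forall>(V :: 'a set) (E :: 'a set set) (col :: 'a set \<Rightarrow> nat).
     k_graph k V E \<longrightarrow> independence_number V E \<le> \<alpha> \<longrightarrow> edge_colouring r E col \<longrightarrow>
     (\<exists>P. mono_tight_cycle_partition k V E col P \<and> card P \<le> c)"
proof (intro allI)
  fix k r \<alpha> :: nat
  obtain c :: nat where c: "\<forall>(V :: 'a set) E col. admissible k r \<alpha> V E col \<longrightarrow> coverable k V E col c V"
    using ex_cover_bound[of k r \<alpha>, where ?'a = 'a] by (elim exE) (rule that)
  have "\<exists>P. mono_tight_cycle_partition k V E col P \<and> card P \<le> c"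
    if "k_graph k V E" "independence_number V E \<le> \<alpha>" "edge_colouring r E col"
    for V :: "'a set" and E col
  proof -
    have "coverable k V E col c V" using c independence_number_admissible[OF that] by blast
    then obtain P where "partition_on V P" "card P \<le> c" "\<forall>C\<in>P. cycle_set k V E col C"
      unfolding coverable_def by (elim exE conjE) (rule that)
    then show ?thesis
      unfolding mono_tight_cycle_partition_def cycle_set_def by (intro exI[of _ P] conjI)
  qed
  then show "\<exists>c. \<forall>(V :: 'a set) E col. k_graph k V E \<longrightarrow> independence_number V E \<le> \<alpha> \<longrightarrow>
      edge_colouring r E col \<longrightarrow> (\<exists>P. mono_tight_cycle_partition k V E col P \<and> card P \<le> c)"
    by (intro exI[of _ c] allI impI)
qed

end
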